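(* If $\mathbb{F}$ is a field and $\Gamma$ is a finite digraph whose cycles are pairwise disjoint, then the Gelfand-Kirillov dimension of the Leavitt path algebra $L_{\mathbb{F}}(\Gamma)$ equals the height of $\Gamma$: $$GKdim\, L_{\mathbb{F}}(\Gamma)=ht(\Gamma).$$
   Context: A digraph $\Gamma=(V,E,s,t)$ has vertex set $V$, arrow set $E$, and source and target maps $s,t:E\to V$ (written $se$, $te$); it is finite if $V$ and $E$ are both finite. A vertex $v$ is a sink if $s^{-1}(v)=\emptyset$. A path is either a vertex (length $0$) or a sequence $e_1\cdots e_n$ of arrows with $te_i=se_{i+1}$. A cycle is a path $C=e_1\cdots e_n$, $n>0$, with $sC=tC$ and $se_i\ne se_j$ for $i\neq j$; cycles differing by cyclic rotation are identified. Cycles are pairwise disjoint if distinct cycles share no vertex. An exit of a cycle $C$ is an arrow $e$ which is not on $C$ but whose source $se$ is on $C$. For vertices, $u\leadsto v$ means there is a path from $u$ to $v$; when the cycles are pairwise disjoint, $\leadsto$ induces a partial order on the set of sinks and cycles of $\Gamma$. Let $E^*=\{e^*\mid e\in E\}$ with $s(e^* )=te$, $t(e^* )=se$. The Leavitt path algebra $L_{\mathbb{F}}(\Gamma)$ is the $\mathbb{F}$-algebra generated by $V\sqcup E\sqcup E^*$ with relations: (V) $vw=\delta_{v,w}v$ for $v,w\in V$; (E) $s(e)e=e=e\,t(e)$ for $e\in E\sqcup E^*$; (CK1) $e^*f=\delta_{e,f}\,t(e)$ for $e,f\in E$; (CK2) $v=\sum_{s(e)=v}ee^*$ for every $v$ with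 $0<|s^{-1}(v)|<\infty$. When $V$ is finite it has identity $1=\sum_{v\in V}v$. Height: the height of a sink is $0$; the height of a cycle with no exit is $1$; the height of a cycle $C$ with an exit is recursively $ht(C)=2+\max\{ht(x)\mid x\text{ a sink or cycle},\ C\leadsto x,\ x\neq C\}$. The height $ht(\Gamma)$ is the maximum of the heights of the cycles of $\Gamma$, or $0$ if $\Gamma$ has no cycles. For a finitely generated $\mathbb{F}$-algebra $A$ with $1$, $GKdim(A)=\limsup_{n\to\infty}\frac{\log(\dim W^n)}{\log n}$, where $W$ is a finite dimensional $\mathbb{F}$-subspace generating $A$ with $1\in W$ and $W^n$ is the $\mathbb{F}$-span of $n$-fold products of elements of $W$; this is independent of the choice of $W$. *)

theory Defs
  imports
    "Graph_Theory.Graph_Theory"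
    "HOL-Library.Poly_Mapping"
    "HOL-Library.Extended_Real"
    "Jordan_Normal_Form.VS_Connect"
begin

section \<open>Sinks, cycles and height of a digraph\<close>

text \<open>
  \<^const>\<open>pre_digraph.cycle\<close> asks the heads of the arcs of a closed walk to be distinct, the heads
  being a rotation of the sources.  A cycle up to rotation is represented by the set of all
  rotations of an arc list.  Two cycles may run through the same vertices along parallel arcs;
  they are then distinct.
\<close>

definition cycles :: "('v, 'e) pre_digraph \<Rightarrow> 'e list set set" where
  "cycles G = {range (\<lambda>n. rotate n p) | p. pre_digraph.cycle G p}"

definition cycle_arcs :: "'e list set \<Rightarrow> 'e set" where
  "cycle_arcs C = (\<Union>p\<in>C. set p)"

definition cycle_verts :: "('v, 'e) pre_digraph \<Rightarrow> 'e list set \<Rightarrow> 'v set" where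
  "cycle_verts G C = tail G ` cycle_arcs C"

definition disjoint_cycles :: "('v, 'e) pre_digraph \<Rightarrow> bool" where
  "disjoint_cycles G \<longleftrightarrow>
     (\<forall>C\<in>cycles G. \<forall>D\<in>cycles G. C \<noteq> D \<longrightarrow> cycle_verts G C \<inter> cycle_verts G D = {})"

definition exits :: "('v, 'e) pre_digraph \<Rightarrow> 'e list set \<Rightarrow> 'e set" where
  "exits G C = {e \<in> arcs G. e \<notin> cycle_arcs C \<and> tail G e \<in> cycle_verts G C}"

definition sinks :: "('v, 'e) pre_digraph \<Rightarrow> 'v set" where
  "sinks G = {v \<in> verts G. out_arcs G v = {}}"

datatype ('v, 'e) sink_or_cycle = Sink 'v | Cycle "'e list set"

definition sinks_and_cycles :: "('v, 'e) pre_digraph \<Rightarrow> ('v, 'e) sink_or_cycle set" where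
  "sinks_and_cycles G = Sink ` sinks G \<union> Cycle ` cycles G"

fun verts_of :: "('v, 'e) pre_digraph \<Rightarrow> ('v, 'e) sink_or_cycle \<Rightarrow> 'v set" where
  "verts_of G (Sink v) = {v}"
| "verts_of G (Cycle C) = cycle_verts G C"

definition leads_to ::
  "('v, 'e) pre_digraph \<Rightarrow> ('v, 'e) sink_or_cycle \<Rightarrow> ('v, 'e) sink_or_cycle \<Rightarrow> bool" where
  "leads_to G x y \<longleftrightarrow> (\<exists>u\<in>verts_of G x. \<exists>v\<in>verts_of G y. u \<rightarrow>\<^sup>*\<^bsub>G\<^esub> v)"

definition strictly_below :: "('v, 'e) pre_digraph \<Rightarrow> ('v, 'e) sink_or_cycle rel" where
  "strictly_below G = {(y, x). x \<in> sinks_and_cycles G \<and> y \<in> sinks_and_cycles G \<and> leads_to G x y \<and> y \<noteq> x}"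

text \<open>
  The recursion runs along \<^const>\<open>strictly_below\<close>, which is well-founded for a finite digraph with
  pairwise disjoint cycles.  The value is meaningful only there.
\<close>

definition height_of :: "('v, 'e) pre_digraph \<Rightarrow> ('v, 'e) sink_or_cycle \<Rightarrow> nat" where
  "height_of G = wfrec (strictly_below G) (\<lambda>ht x.
     case x of
       Sink v \<Rightarrow> 0
     | Cycle C \<Rightarrow> if exits G C = {} then 1 else 2 + Max (ht ` {y. (y, x) \<in> strictly_below G}))"

definition digraph_height :: "('v, 'e) pre_digraph \<Rightarrow> nat" where
  "digraph_height G =
     (if cycles G = {} then 0 else Max ((\<lambda>C. height_of G (Cycle C)) ` cycles G))"


section \<open>Algebras given by generators and relations\<close>

text \<open>
  Finitely supported functions multiply by convolution along the addition of their domain.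
  With concatenation of words as addition this is the product of the free algebra.
\<close>

datatype 'g word_monoid = Word (letters: "'g list")

instantiation word_monoid :: (type) monoid_add
begin

definition zero_word_monoid :: "'a word_monoid" where
  "zero_word_monoid = Word []"

definition plus_word_monoid :: "'a word_monoid \<Rightarrow> 'a word_monoid \<Rightarrow> 'a word_monoid" where
  "plus_word_monoid u v = Word (letters u @ letters v)"

instance
  by standard (auto simp: zero_word_monoid_def plus_word_monoid_def)

end

type_synonym ('k, 'g) free_algebra = "'g word_monoid \<Rightarrow>\<^sub>0 'k"

definition gen :: "'g \<Rightarrow> ('k::field, 'g) free_algebra" where
  "gen x = Poly_Mapping.single (Word [x]) 1"

definition scale :: "'k::field \<Rightarrow> ('k, 'g) free_algebra \<Rightarrow> ('k, 'g) free_algebra" where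
  "scale c p = Poly_Mapping.single 0 c * p"

text \<open>The free algebra without unit on a set of generators: the empty word does not occur.\<close>

definition free_on :: "'g set \<Rightarrow> ('k::field, 'g) free_algebra set" where
  "free_on X = {p. \<forall>w\<in>Poly_Mapping.keys p. letters w \<noteq> [] \<and> set (letters w) \<subseteq> X}"

inductive_set ideal_on :: "'g set \<Rightarrow> ('k::field, 'g) free_algebra set \<Rightarrow> ('k, 'g) free_algebra set"
  for X R where
  zero: "0 \<in> ideal_on X R"
| base: "r \<in> R \<Longrightarrow> r \<in> ideal_on X R"
| add: "p \<in> ideal_on X R \<Longrightarrow> q \<in> ideal_on X R \<Longrightarrow> p + q \<in> ideal_on X R"
| scale: "p \<in> ideal_on X R \<Longrightarrow> scale c p \<in> ideal_on X R"
| mult_left: "p \<in> ideal_on X R \<Longrightarrow> a \<in> free_on X \<Longrightarrow> a * p \<in> ideal_on X R"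
| mult_right: "p \<in> ideal_on X R \<Longrightarrow> a \<in> free_on X \<Longrightarrow> p * a \<in> ideal_on X R"

definition coset :: "('k::field, 'g) free_algebra set \<Rightarrow> ('k, 'g) free_algebra \<Rightarrow> ('k, 'g) free_algebra set" where
  "coset I p = (+) p ` I"

text \<open>
  The quotient of the free algebra without unit by the ideal of relations.  The record type needs
  a unit, so an element \<open>e\<close> representing it has to be supplied.
\<close>

definition presented_algebra ::
  "'g set \<Rightarrow> ('k::field, 'g) free_algebra set \<Rightarrow> ('k, 'g) free_algebra
     \<Rightarrow> ('k, ('k, 'g) free_algebra set) module" where
  "presented_algebra X R e = (let I = ideal_on X R in
     \<lparr>carrier = coset I ` free_on X,
      mult = (\<lambda>P Q. \<Union>p\<in>P. \<Union>q\<in>Q. coset I (p * q)),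
      one = coset I e,
      zero = I,
      add = (\<lambda>P Q. \<Union>p\<in>P. \<Union>q\<in>Q. coset I (p + q)),
      smult = (\<lambda>c P. \<Union>p\<in>P. coset I (scale c p))\<rparr>)"


section \<open>Leavitt path algebras\<close>

datatype ('v, 'e) lpa_gen = Vertex 'v | Arrow 'e | Ghost 'e

definition lpa_gens :: "('v, 'e) pre_digraph \<Rightarrow> ('v, 'e) lpa_gen set" where
  "lpa_gens G = Vertex ` verts G \<union> Arrow ` arcs G \<union> Ghost ` arcs G"

text \<open>A relation \<open>a = b\<close> is represented by the element \<open>a - b\<close>.\<close>

definition lpa_rels_V :: "('v, 'e) pre_digraph \<Rightarrow> ('k::field, ('v, 'e) lpa_gen) free_algebra set" where
  "lpa_rels_V G =
     {gen (Vertex v) * gen (Vertex w) - (if v = w then gen (Vertex v) else 0) | v w.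
        v \<in> verts G \<and> w \<in> verts G}"

definition lpa_rels_E :: "('v, 'e) pre_digraph \<Rightarrow> ('k::field, ('v, 'e) lpa_gen) free_algebra set" where
  "lpa_rels_E G =
     {gen (Vertex (tail G e)) * gen (Arrow e) - gen (Arrow e) | e. e \<in> arcs G} \<union>
     {gen (Arrow e) * gen (Vertex (head G e)) - gen (Arrow e) | e. e \<in> arcs G} \<union>
     {gen (Vertex (head G e)) * gen (Ghost e) - gen (Ghost e) | e. e \<in> arcs G} \<union>
     {gen (Ghost e) * gen (Vertex (tail G e)) - gen (Ghost e) | e. e \<in> arcs G}"

definition lpa_rels_CK1 :: "('v, 'e) pre_digraph \<Rightarrow> ('k::field, ('v, 'e) lpa_gen) free_algebra set" where
  "lpa_rels_CK1 G =
     {gen (Ghost e) * gen (Arrow f) - (if e = f then gen (Vertex (head G e)) else 0) | e f.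
        e \<in> arcs G \<and> f \<in> arcs G}"

definition lpa_rels_CK2 :: "('v, 'e) pre_digraph \<Rightarrow> ('k::field, ('v, 'e) lpa_gen) free_algebra set" where
  "lpa_rels_CK2 G =
     {gen (Vertex v) - (\<Sum>e\<in>out_arcs G v. gen (Arrow e) * gen (Ghost e)) | v.
        v \<in> verts G \<and> out_arcs G v \<noteq> {} \<and> finite (out_arcs G v)}"

text \<open>The unit of the record is meaningful for a finite vertex set only.\<close>

definition leavitt_path_algebra ::
  "('v, 'e) pre_digraph
     \<Rightarrow> ('k::field, ('k, ('v, 'e) lpa_gen) free_algebra set) module" where
  "leavitt_path_algebra G =
     presented_algebra (lpa_gens G)
       (lpa_rels_V G \<union> lpa_rels_E G \<union> lpa_rels_CK1 G \<union> lpa_rels_CK2 G)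
       (\<Sum>v\<in>verts G. gen (Vertex v))"


section \<open>Gelfand-Kirillov dimension\<close>

definition is_subalgebra ::
  "('k, 'r) ring_scheme \<Rightarrow> ('k, 'a, 'm) module_scheme \<Rightarrow> 'a set \<Rightarrow> bool" where
  "is_subalgebra K A B \<longleftrightarrow>
     VectorSpace.subspace K B A \<and> \<one>\<^bsub>A\<^esub> \<in> B \<and> (\<forall>x\<in>B. \<forall>y\<in>B. x \<otimes>\<^bsub>A\<^esub> y \<in> B)"

definition generated_subalgebra ::
  "('k, 'r) ring_scheme \<Rightarrow> ('k, 'a, 'm) module_scheme \<Rightarrow> 'a set \<Rightarrow> 'a set" where
  "generated_subalgebra K A W = \<Inter>{B. is_subalgebra K A B \<and> W \<subseteq> B}"

definition generating_subspace ::
  "('k, 'r) ring_scheme \<Rightarrow> ('k, 'a, 'm) module_scheme \<Rightarrow> 'a set \<Rightarrow> bool" where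
  "generating_subspace K A W \<longleftrightarrow>
     VectorSpace.subspace K W A \<and> vectorspace.fin_dim K (A\<lparr>carrier := W\<rparr>) \<and> \<one>\<^bsub>A\<^esub> \<in> W \<and>
     generated_subalgebra K A W = carrier A"

definition power_subspace ::
  "('k, 'r) ring_scheme \<Rightarrow> ('k, 'a, 'm) module_scheme \<Rightarrow> 'a set \<Rightarrow> nat \<Rightarrow> 'a set" where
  "power_subspace K A W n =
     LinearCombinations.module.span K A
       {foldr (\<otimes>\<^bsub>A\<^esub>) xs \<one>\<^bsub>A\<^esub> | xs. set xs \<subseteq> W \<and> length xs = n}"

definition growth_exponent ::
  "('k, 'r) ring_scheme \<Rightarrow> ('k, 'a, 'm) module_scheme \<Rightarrow> 'a set \<Rightarrow> ereal" where
  "growth_exponent K A W =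
     limsup (\<lambda>n. ereal (ln (real (vectorspace.dim K (A\<lparr>carrier := power_subspace K A W n\<rparr>))) / ln (real n)))"

text \<open>
  The exponent does not depend on the generating subspace, so any choice may be made.
  The zero algebra has dimension \<open>0\<close>, because \<open>ln 0 = 0\<close>.
\<close>

definition GKdim :: "('k, 'r) ring_scheme \<Rightarrow> ('k, 'a, 'm) module_scheme \<Rightarrow> ereal" where
  "GKdim K A = growth_exponent K A (SOME W. generating_subspace K A W)"

end

theory Submission
  imports Defs
begin

text \<open>
  Write \<open>h\<close> for the height of the digraph.  Both bounds count monomials \<open>p q\<^sup>*\<close>, where \<open>p\<close> and \<open>q\<close>
  are paths with a common end.

  Upper bound.  The relations turn every word of length \<open>n\<close> in the generators into zero or into such
  a monomial with paths of length at most \<open>n\<close>.  If \<open>e\<close> is the only arrow leaving its source, (CK2)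
  removes \<open>e e\<^sup>*\<close> from the middle, so monomials in which \<open>p\<close> and \<open>q\<close> do not both end in such an arrow
  span (\<open>word_reduces\<close>).  Because the cycles are disjoint, a path never returns to a cycle that
  it has left and has no choice while it stays on one; so it is determined, up to finitely many
  choices, by the lengths of its stays on the cycles it meets, and there are of the order of \<open>n\<^sup>d\<close>
  paths of length at most \<open>n\<close> along a chain of \<open>d\<close> cycles.  Every cycle above another sink or cycle adds 2
  to the height.  A chain of \<open>d\<close> cycles that can be left at its end therefore has \<open>2 d \<le> h\<close>, which
  bounds the number of pairs \<open>(p, q)\<close>.  If the last cycle has no exit, only \<open>2 d - 1 \<le> h\<close> is
  available, but then the reduction prevents \<open>p\<close> and \<open>q\<close> from both ending on this cycle, and
  one parameter is lost (\<open>card_reduced_pairs\<close>).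

  Lower bound.  A chain that realizes the height ends in a sink or in a cycle without exit, with
  walk \<open>c\<close> around it (\<open>c\<close> is empty at a sink).  Running around the \<open>k\<close> cycles that have an exit
  arbitrarily often yields of the order of \<open>n\<^sup>k\<close> paths into this end
  (\<open>points_grow_digraph_height\<close>).  The algebra acts on functions on pairs of a maximal path and an
  integer: an arrow is prepended to the path, or removed from its front if it is a ghost, and
  the integer counts degrees.  There the monomials \<open>p c\<^sup>i q\<^sup>*\<close> act as matrix units which shift the
  degree by different amounts for different \<open>i\<close>, hence they are linearly independent
  (\<open>independent_monomials\<close>).  Their number is of the order of \<open>n\<^sup>2\<^sup>k\<close> at a sink, where \<open>h = 2 k\<close>,
  and \<open>n\<^sup>2\<^sup>k\<^sup>+\<^sup>1\<close> at a cycle, where \<open>h = 2 k + 1\<close>.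

  Any two generating subspaces are contained in fixed powers of each other, and replacing \<open>n\<close> by a
  multiple of \<open>n\<close> does not change the exponent of a polynomial growth rate (\<open>GKdim_eqI\<close>).
\<close>

section \<open>Growth of algebras\<close>

text \<open>
  Products of paths depend on their order, so the product is not assumed to be commutative.
\<close>
locale unital_algebra = vectorspace K A
  for K :: "('k, 'r) ring_scheme" and A :: "('k, 'a, 'm) module_scheme" +
  assumes mult_closed: "x \<in> carrier A \<Longrightarrow> y \<in> carrier A \<Longrightarrow> x \<otimes>\<^bsub>A\<^esub> y \<in> carrier A"
    and one_in: "\<one>\<^bsub>A\<^esub> \<in> carrier A"
    and mult_assoc: "x \<in> carrier A \<Longrightarrow> y \<in> carrier A \<Longrightarrow> z \<in> carrier A \<Longrightarrow>
          (x \<otimes>\<^bsub>A\<^esub> y) \<otimes>\<^bsub>A\<^esub> z = x \<otimes>\<^bsub>A\<^esub> (y \<otimes>\<^bsub>A\<^esub> z)"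
    and one_mult: "x \<in> carrier A \<Longrightarrow> \<one>\<^bsub>A\<^esub> \<otimes>\<^bsub>A\<^esub> x = x"
    and mult_one: "x \<in> carrier A \<Longrightarrow> x \<otimes>\<^bsub>A\<^esub> \<one>\<^bsub>A\<^esub> = x"
    and add_mult: "x \<in> carrier A \<Longrightarrow> y \<in> carrier A \<Longrightarrow> z \<in> carrier A \<Longrightarrow>
          (x \<oplus>\<^bsub>A\<^esub> y) \<otimes>\<^bsub>A\<^esub> z = x \<otimes>\<^bsub>A\<^esub> z \<oplus>\<^bsub>A\<^esub> y \<otimes>\<^bsub>A\<^esub> z"
    and mult_add: "x \<in> carrier A \<Longrightarrow> y \<in> carrier A \<Longrightarrow> z \<in> carrier A \<Longrightarrow>
          z \<otimes>\<^bsub>A\<^esub> (x \<oplus>\<^bsub>A\<^esub> y) = z \<otimes>\<^bsub>A\<^esub> x \<oplus>\<^bsub>A\<^esub> z \<otimes>\<^bsub>A\<^esub> y"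
    and smult_mult: "c \<in> carrier K \<Longrightarrow> x \<in> carrier A \<Longrightarrow> y \<in> carrier A \<Longrightarrow>
          (c \<odot>\<^bsub>A\<^esub> x) \<otimes>\<^bsub>A\<^esub> y = c \<odot>\<^bsub>A\<^esub> (x \<otimes>\<^bsub>A\<^esub> y)"
    and mult_smult: "c \<in> carrier K \<Longrightarrow> x \<in> carrier A \<Longrightarrow> y \<in> carrier A \<Longrightarrow>
          x \<otimes>\<^bsub>A\<^esub> (c \<odot>\<^bsub>A\<^esub> y) = c \<odot>\<^bsub>A\<^esub> (x \<otimes>\<^bsub>A\<^esub> y)"
begin

lemma zero_mult: assumes "x \<in> carrier A" shows "\<zero>\<^bsub>A\<^esub> \<otimes>\<^bsub>A\<^esub> x = \<zero>\<^bsub>A\<^esub>"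
proof -
  have "\<zero>\<^bsub>A\<^esub> \<otimes>\<^bsub>A\<^esub> x = (\<zero>\<^bsub>K\<^esub> \<odot>\<^bsub>A\<^esub> \<one>\<^bsub>A\<^esub>) \<otimes>\<^bsub>A\<^esub> x"
    using one_in by (simp add: lmult_0)
  also have "\<dots> = \<zero>\<^bsub>K\<^esub> \<odot>\<^bsub>A\<^esub> (\<one>\<^bsub>A\<^esub> \<otimes>\<^bsub>A\<^esub> x)"
    using assms one_in by (intro smult_mult) auto
  also have "\<dots> = \<zero>\<^bsub>A\<^esub>"
    using assms by (simp add: one_mult lmult_0)
  finally show ?thesis .
qed

lemma mult_zero: assumes "x \<in> carrier A" shows "x \<otimes>\<^bsub>A\<^esub> \<zero>\<^bsub>A\<^esub> = \<zero>\<^bsub>A\<^esub>"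
proof -
  have "x \<otimes>\<^bsub>A\<^esub> \<zero>\<^bsub>A\<^esub> = x \<otimes>\<^bsub>A\<^esub> (\<zero>\<^bsub>K\<^esub> \<odot>\<^bsub>A\<^esub> \<one>\<^bsub>A\<^esub>)"
    using one_in by (simp add: lmult_0)
  also have "\<dots> = \<zero>\<^bsub>K\<^esub> \<odot>\<^bsub>A\<^esub> (x \<otimes>\<^bsub>A\<^esub> \<one>\<^bsub>A\<^esub>)"
    using assms one_in by (intro mult_smult) auto
  also have "\<dots> = \<zero>\<^bsub>A\<^esub>"
    using assms by (simp add: mult_one lmult_0)
  finally show ?thesis .
qed

text \<open>
  The elements that a fixed factor multiplies into \<open>N\<close> form a submodule; this is used once for
  each factor.
\<close>
lemma span_mult_in:
  assumes N: "submodule K N A" and S: "S \<subseteq> carrier A" and T: "T \<subseteq> carrier A"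
    and ST: "\<And>s t. s \<in> S \<Longrightarrow> t \<in> T \<Longrightarrow> s \<otimes>\<^bsub>A\<^esub> t \<in> N"
    and x: "x \<in> span S" and y: "y \<in> span T"
  shows "x \<otimes>\<^bsub>A\<^esub> y \<in> N"
proof -
  interpret N: submodule K N A by (rule N)
  have left: "x \<otimes>\<^bsub>A\<^esub> t \<in> N" if t: "t \<in> T" for t
  proof -
    have "submodule K {x \<in> carrier A. x \<otimes>\<^bsub>A\<^esub> t \<in> N} A"
      using t T by unfold_locales (auto simp: zero_mult add_mult smult_mult subset_iff)
    moreover have "S \<subseteq> {x \<in> carrier A. x \<otimes>\<^bsub>A\<^esub> t \<in> N}"
      using S ST t by auto
    ultimately show ?thesis
      using span_is_subset x by blast
  qed
  have xc: "x \<in> carrier A" using x span_is_subset2[OF S] by auto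
  have "submodule K {y \<in> carrier A. x \<otimes>\<^bsub>A\<^esub> y \<in> N} A"
    using xc by unfold_locales (auto simp: mult_zero mult_add mult_smult)
  moreover have "T \<subseteq> {y \<in> carrier A. x \<otimes>\<^bsub>A\<^esub> y \<in> N}"
    using T left by auto
  ultimately show ?thesis
    using span_is_subset y by blast
qed

abbreviation monomial :: "'a list \<Rightarrow> 'a" where
  "monomial xs \<equiv> foldr (\<otimes>\<^bsub>A\<^esub>) xs \<one>\<^bsub>A\<^esub>"

lemma monomial_closed: "set xs \<subseteq> carrier A \<Longrightarrow> monomial xs \<in> carrier A"
  by (induction xs) (auto simp: one_in mult_closed)

lemma monomial_append:
  "set xs \<subseteq> carrier A \<Longrightarrow> set ys \<subseteq> carrier A \<Longrightarrow>
     monomial (xs @ ys) = monomial xs \<otimes>\<^bsub>A\<^esub> monomial ys"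
proof (induction xs)
  case Nil
  then show ?case by (simp add: one_mult monomial_closed)
next
  case (Cons x xs)
  then show ?case by (simp add: mult_assoc monomial_closed)
qed

text \<open>
  Finite dimension is part of the claim, since the dimension of a space without a finite spanning
  set is a meaningless number.  An independent subset of \<open>S\<close> is independent in \<open>span T\<close>, hence
  has at most \<open>card T\<close> elements, and a maximal one is a basis of \<open>S\<close>.
\<close>
lemma dim_le_card_spanning:
  assumes S: "submodule K S A" and T: "finite T" "T \<subseteq> carrier A" and ST: "S \<subseteq> span T"
  shows "vectorspace.fin_dim K (vs S)" and "vectorspace.dim K (vs S) \<le> card T"
proof -
  have vS: "vectorspace K (vs S)"
    using S by (intro subspace_is_vs) (simp add: VectorSpace.subspace_def vectorspace_axioms)
  interpret S: vectorspace K "vs S" by (rule vS)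
  have Sc: "S \<subseteq> carrier A" using S by (simp add: submodule_def)
  have sT: "submodule K (span T) A" using T by (intro span_is_submodule)
  have li: "lin_indpt U" if U: "U \<subseteq> S" "S.lin_indpt U" for U
  proof
    assume "lin_dep U"
    then obtain B a v where B: "finite B" "B \<subseteq> U" "a \<in> B \<rightarrow> carrier K"
      "lincomb a B = \<zero>\<^bsub>A\<^esub>" "v \<in> B" "a v \<noteq> \<zero>\<^bsub>K\<^esub>"
      unfolding lin_dep_def by blast
    then have "S.lincomb a B = lincomb a B"
      using lincomb_not_depend[OF _ _ S, of B a] U by auto
    with B U show False unfolding S.lin_dep_def by auto
  qed
  have bound: "finite U \<and> card U \<le> card T" if U: "finite U" "U \<subseteq> S" "S.lin_indpt U" for U
  proof -
    interpret sp: vectorspace K "vs (span T)"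
      using T by (intro subspace_is_vs span_is_subspace)
    have "sp.lin_indpt U"
    proof
      assume "sp.lin_dep U"
      then obtain B a v where B: "finite B" "B \<subseteq> U" "a \<in> B \<rightarrow> carrier K"
        "sp.lincomb a B = \<zero>\<^bsub>A\<^esub>" "v \<in> B" "a v \<noteq> \<zero>\<^bsub>K\<^esub>"
        unfolding sp.lin_dep_def by auto
      moreover from this have "sp.lincomb a B = lincomb a B"
        using lincomb_not_depend[OF _ _ sT, of B a] U ST by auto
      ultimately have "lin_dep U" unfolding lin_dep_def by auto
      with li U show False by blast
    qed
    moreover have "sp.gen_set T"
      using span_li_not_depend[OF in_own_span sT] T by simp
    moreover have "T \<subseteq> carrier (vs (span T))" using in_own_span[OF T(2)] by simp
    moreover have "U \<subseteq> carrier (vs (span T))" using U ST by simp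
    ultimately show ?thesis
      using sp.li_smaller_than_gen[of U T] U(1) T(1) by blast
  qed
  have "\<exists>U. finite U \<and> maximal U (\<lambda>U. U \<subseteq> S \<and> S.lin_indpt U)"
  proof (rule maximal_exists[where B = "{}" and N = "card T"])
    fix U assume "U \<subseteq> S \<and> S.lin_indpt U"
    then have US: "U \<subseteq> S" "S.lin_indpt U" by auto
    have "finite U"
    proof (rule ccontr)
      assume "infinite U"
      then obtain V where V: "V \<subseteq> U" "finite V" "card V = Suc (card T)"
        using infinite_arbitrarily_large by blast
      have "S.lin_indpt V"
        using S.subset_li_is_li[of U V] US V by auto
      with bound[of V] V US show False by auto
    qed
    with bound US show "finite U \<and> card U \<le> card T" by blast
  next
    show "{} \<subseteq> S \<and> S.lin_indpt {}" unfolding S.lin_dep_def by auto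
  qed
  then obtain U where U: "finite U" "maximal U (\<lambda>U. U \<subseteq> S \<and> S.lin_indpt U)" by blast
  have US: "U \<subseteq> S" "S.lin_indpt U" using U unfolding maximal_def by auto
  have gen: "S.gen_set U"
    using S.max_li_is_gen[of U] U(2) by simp
  show "S.fin_dim"
    unfolding S.fin_dim_def using U gen US by auto
  have "S.dim = card U"
    using S.dim_basis[of U] U gen US by (simp add: S.basis_def)
  then show "S.dim \<le> card T" using bound U US by simp
qed

lemma card_indep_le_dim:
  assumes S: "submodule K S A" and fd: "vectorspace.fin_dim K (vs S)"
    and U: "U \<subseteq> S" "lin_indpt U"
  shows "card U \<le> vectorspace.dim K (vs S)"
proof -
  have vS: "vectorspace K (vs S)"
    using S by (intro subspace_is_vs) (simp add: VectorSpace.subspace_def vectorspace_axioms)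
  interpret S: vectorspace K "vs S" by (rule vS)
  have "S.lin_indpt U"
  proof
    assume "S.lin_dep U"
    then obtain B a v where B: "finite B" "B \<subseteq> U" "a \<in> B \<rightarrow> carrier K"
      "S.lincomb a B = \<zero>\<^bsub>A\<^esub>" "v \<in> B" "a v \<noteq> \<zero>\<^bsub>K\<^esub>"
      unfolding S.lin_dep_def by auto
    moreover from this have "S.lincomb a B = lincomb a B"
      using lincomb_not_depend[OF _ _ S, of B a] U by auto
    ultimately have "lin_dep U" unfolding lin_dep_def by auto
    with U show False by blast
  qed
  then show ?thesis using S.li_le_dim[of U] fd U by simp
qed

end

lemma filterlim_ln_real: "filterlim (\<lambda>n. ln (real n)) at_top sequentially"
  by (rule filterlim_compose[OF ln_at_top filterlim_real_sequentially])

text \<open>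
  The lower estimate is required along multiples of \<open>m\<close> only; this loses a constant factor, which
  the logarithms do not see.
\<close>
lemma limsup_log_growth:
  fixes f :: "nat \<Rightarrow> nat" and C h m :: nat
  assumes upper: "\<And>n. n \<ge> 1 \<Longrightarrow> f n \<le> C * n ^ h"
    and m: "m \<ge> 1" and lower: "\<And>n. h > 0 \<Longrightarrow> n \<ge> 1 \<Longrightarrow> n ^ h \<le> f (m * n)"
  shows "limsup (\<lambda>n. ereal (ln (real (f n)) / ln (real n))) = ereal (real h)"
proof (rule antisym)
  let ?g = "\<lambda>n. ereal (ln (real (f n)) / ln (real n))"
  define c where "c = real (Suc C)"
  have c: "c \<ge> 1" unfolding c_def by simp
  have "eventually (\<lambda>n. ?g n \<le> ereal (ln c / ln (real n) + real h)) sequentially"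
    using eventually_ge_at_top[of 2]
  proof eventually_elim
    case (elim n)
    have pos: "ln (real n) > 0" using elim by simp
    have "ln (real (f n)) \<le> ln c + real h * ln (real n)"
    proof (cases "f n = 0")
      case True
      then show ?thesis using c pos by simp
    next
      case False
      have "real (f n) \<le> real (C * n ^ h)" using upper[of n] elim by (intro of_nat_mono) simp
      also have "\<dots> \<le> c * real n ^ h" unfolding c_def
        by (simp add: mult_right_mono)
      finally have "ln (real (f n)) \<le> ln (c * real n ^ h)"
        using False by (subst ln_le_cancel_iff) (auto simp: c_def elim intro: less_le_trans)
      also have "\<dots> = ln c + real h * ln (real n)"
        using elim c by (subst ln_mult) (auto simp: ln_realpow)
      finally show ?thesis .
    qed
    then show ?case using pos by (simp add: field_simps)
  qed
  then have "limsup ?g \<le> limsup (\<lambda>n. ereal (ln c / ln (real n) + real h))"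
    by (rule Limsup_mono)
  also have "(\<lambda>n. ln c / ln (real n) + real h) \<longlonglongrightarrow> 0 + real h"
    by (intro tendsto_add tendsto_const tendsto_divide_0[OF tendsto_const] filterlim_at_top_imp_at_infinity filterlim_ln_real)
  then have "(\<lambda>n. ereal (ln c / ln (real n) + real h)) \<longlonglongrightarrow> ereal (real h)"
    by (intro tendsto_ereal) simp
  then have "limsup (\<lambda>n. ereal (ln c / ln (real n) + real h)) = ereal (real h)"
    by (intro lim_imp_Limsup) auto
  finally show "limsup ?g \<le> ereal (real h)" .
  show "ereal (real h) \<le> limsup ?g"
  proof (cases "h = 0")
    case True
    have "(\<lambda>n. ereal 0) \<longlonglongrightarrow> ereal 0" by simp
    then have "ereal 0 = limsup (\<lambda>n. ereal 0)" by (intro lim_imp_Limsup[symmetric]) auto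
    also have "\<dots> \<le> limsup ?g"
    proof (rule Limsup_mono, rule always_eventually, rule allI)
      fix n show "ereal 0 \<le> ?g n" by (cases "f n = 0"; cases "n = 0") auto
    qed
    finally show ?thesis using True by simp
  next
    case False
    have "(\<lambda>n. real h / (ln (real m) / ln (real n) + 1)) \<longlonglongrightarrow> real h / (0 + 1)"
      by (intro tendsto_add tendsto_divide tendsto_const tendsto_divide_0[OF tendsto_const]
          filterlim_at_top_imp_at_infinity filterlim_ln_real) auto
    moreover have "eventually (\<lambda>n. real h / (ln (real m) / ln (real n) + 1)
        = real h * ln (real n) / ln (real m * real n)) sequentially"
      using eventually_ge_at_top[of 2]
    proof eventually_elim
      case (elim n)
      then have "ln (real m * real n) = ln (real m) + ln (real n)" "ln (real n) > 0"
        using m by (auto simp: ln_mult)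
      then show ?case using m by (simp add: field_simps)
    qed
    ultimately have "(\<lambda>n. real h * ln (real n) / ln (real m * real n)) \<longlonglongrightarrow> real h"
      by (auto dest: Lim_transform_eventually)
    then have "(\<lambda>n. ereal (real h * ln (real n) / ln (real m * real n))) \<longlonglongrightarrow> ereal (real h)"
      by (rule tendsto_ereal)
    then have "ereal (real h) = limsup (\<lambda>n. ereal (real h * ln (real n) / ln (real m * real n)))"
      by (intro lim_imp_Limsup[symmetric]) auto
    also have "\<dots> \<le> limsup (?g \<circ> (\<lambda>n. m * n))"
    proof (rule Limsup_mono, use eventually_ge_at_top[of 2] in eventually_elim)
      fix n :: nat assume n: "2 \<le> n"
      have "real n \<le> real m * real n" using m mult_right_mono[of 1 "real m" "real n"] by simp
      then have pos: "ln (real m * real n) > 0" using n m by (intro ln_gt_zero) linarith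
      have "real n ^ h = real (n ^ h)" by simp
      also have "\<dots> \<le> real (f (m * n))" using lower[of n] False n by (intro of_nat_mono) auto
      finally have le: "real n ^ h \<le> real (f (m * n))" .
      moreover have "real n ^ h > 0" using n by simp
      ultimately have "ln (real n ^ h) \<le> ln (real (f (m * n)))"
        by (intro iffD2[OF ln_le_cancel_iff]) linarith+
      then have "real h * ln (real n) \<le> ln (real (f (m * n)))"
        using n by (simp add: ln_realpow)
      then show "ereal (real h * ln (real n) / ln (real m * real n)) \<le> (?g \<circ> (\<lambda>n. m * n)) n"
        using pos by (simp add: divide_right_mono)
    qed
    also have "\<dots> \<le> limsup ?g"
      using m by (intro limsup_subseq_mono) (auto simp: strict_mono_def)
    finally show ?thesis .
  qed
qed

context unital_algebra
begin

definition monomials :: "'a set \<Rightarrow> nat \<Rightarrow> 'a set" where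
  "monomials X n = {monomial xs | xs. set xs \<subseteq> X \<and> length xs \<le> n}"

lemma submodule_carrier: "submodule K (carrier A) A"
  by unfold_locales auto

lemma power_subspace_eq:
  "power_subspace K A W n = span {monomial xs | xs. set xs \<subseteq> W \<and> length xs = n}"
  by (simp add: power_subspace_def)

lemma monomial_in_monomials: "set xs \<subseteq> X \<Longrightarrow> length xs \<le> n \<Longrightarrow> monomial xs \<in> monomials X n"
  unfolding monomials_def by blast

lemma monomials_closed: "X \<subseteq> carrier A \<Longrightarrow> monomials X n \<subseteq> carrier A"
  unfolding monomials_def using monomial_closed by blast

lemma submodule_span_monomials: "X \<subseteq> carrier A \<Longrightarrow> submodule K (span (monomials X n)) A"
  by (intro span_is_submodule monomials_closed)

lemma finite_monomials: "finite X \<Longrightarrow> finite (monomials X n)"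
  unfolding monomials_def
  using finite_lists_length_le[of X n] by (simp add: setcompr_eq_image)

lemma monomials_mono: "m \<le> n \<Longrightarrow> monomials X m \<subseteq> monomials X n"
  unfolding monomials_def by force

lemma span_monomials_mult:
  assumes X: "X \<subseteq> carrier A"
    and x: "x \<in> span (monomials X m)" and y: "y \<in> span (monomials X n)"
  shows "x \<otimes>\<^bsub>A\<^esub> y \<in> span (monomials X (m + n))"
proof (rule span_mult_in[OF _ _ _ _ x y])
  fix s t assume "s \<in> monomials X m" "t \<in> monomials X n"
  then obtain xs ys where xs: "s = monomial xs" "set xs \<subseteq> X" "length xs \<le> m"
    and ys: "t = monomial ys" "set ys \<subseteq> X" "length ys \<le> n"
    unfolding monomials_def by blast
  then have "s \<otimes>\<^bsub>A\<^esub> t = monomial (xs @ ys)" "set (xs @ ys) \<subseteq> X" "length (xs @ ys) \<le> m + n"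
    using X monomial_append[of xs ys] by (auto simp del: foldr_append)
  then have "s \<otimes>\<^bsub>A\<^esub> t \<in> monomials X (m + n)" unfolding monomials_def by blast
  then show "s \<otimes>\<^bsub>A\<^esub> t \<in> span (monomials X (m + n))"
    using in_own_span[OF monomials_closed[OF X]] by blast
qed (auto intro!: span_is_submodule monomials_closed[OF X])

lemma monomial_in_power: "set xs \<subseteq> W \<Longrightarrow> W \<subseteq> carrier A \<Longrightarrow> monomial xs \<in> power_subspace K A W (length xs)"
  unfolding power_subspace_eq
  using in_own_span[of "{monomial ys | ys. set ys \<subseteq> W \<and> length ys = length xs}"] monomial_closed
  by fastforce

lemma submodule_power: "W \<subseteq> carrier A \<Longrightarrow> submodule K (power_subspace K A W n) A"
  unfolding power_subspace_eq using monomial_closed by (intro span_is_submodule) blast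

lemma power_mono:
  assumes W: "W \<subseteq> carrier A" "\<one>\<^bsub>A\<^esub> \<in> W" and mn: "m \<le> n"
  shows "power_subspace K A W m \<subseteq> power_subspace K A W n"
proof -
  have "monomial xs \<in> {monomial ys | ys. set ys \<subseteq> W \<and> length ys = n}"
    if xs: "set xs \<subseteq> W" "length xs = m" for xs
  proof -
    have "monomial (replicate k \<one>\<^bsub>A\<^esub> @ xs) = monomial xs" for k
      using xs W by (induction k) (auto simp: one_mult monomial_closed)
    from this[of "n - m"] show ?thesis
      using xs W mn by (intro CollectI exI[of _ "replicate (n - m) \<one>\<^bsub>A\<^esub> @ xs"]) auto
  qed
  then show ?thesis unfolding power_subspace_eq
    by (intro span_is_monotone) blast
qed

lemma power_mult:
  assumes W: "W \<subseteq> carrier A"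
    and x: "x \<in> power_subspace K A W m" and y: "y \<in> power_subspace K A W n"
  shows "x \<otimes>\<^bsub>A\<^esub> y \<in> power_subspace K A W (m + n)"
proof (rule span_mult_in[OF _ _ _ _ x[unfolded power_subspace_eq] y[unfolded power_subspace_eq]])
  fix s t assume "s \<in> {monomial xs | xs. set xs \<subseteq> W \<and> length xs = m}"
    "t \<in> {monomial xs | xs. set xs \<subseteq> W \<and> length xs = n}"
  then obtain xs ys where xs: "s = monomial xs" "set xs \<subseteq> W" "length xs = m"
    and ys: "t = monomial ys" "set ys \<subseteq> W" "length ys = n"
    by blast
  then have "s \<otimes>\<^bsub>A\<^esub> t = monomial (xs @ ys)" "set (xs @ ys) \<subseteq> W" "length (xs @ ys) = m + n"
    using W monomial_append[of xs ys] by (auto simp del: foldr_append)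
  then show "s \<otimes>\<^bsub>A\<^esub> t \<in> power_subspace K A W (m + n)"
    using monomial_in_power W by metis
qed (use W monomial_closed in \<open>auto intro!: submodule_power\<close>)

text \<open>
  Because \<open>W\<close> contains the unit, the powers of \<open>W\<close> increase, so their union is a subalgebra.
\<close>
lemma generated_subset_powers:
  assumes W: "W \<subseteq> carrier A" "\<one>\<^bsub>A\<^esub> \<in> W"
  shows "generated_subalgebra K A W \<subseteq> (\<Union>n. power_subspace K A W n)"
proof -
  let ?U = "\<Union>n. power_subspace K A W n"
  note sub = submodule_power[OF W(1)]
  have closed: "?U \<subseteq> carrier A" using sub unfolding submodule_def by blast
  have "submodule K ?U A"
  proof
    fix v w assume "v \<in> ?U" "w \<in> ?U"
    then obtain m n where "v \<in> power_subspace K A W m" "w \<in> power_subspace K A W n" by blast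
    then have "v \<in> power_subspace K A W (max m n)" "w \<in> power_subspace K A W (max m n)"
      using power_mono[OF W] by (meson max.cobounded1 max.cobounded2 subsetD)+
    then have "v \<oplus>\<^bsub>A\<^esub> w \<in> power_subspace K A W (max m n)"
      using sub by (simp add: submodule_def)
    then show "v \<oplus>\<^bsub>A\<^esub> w \<in> ?U" by blast
  next
    show "\<zero>\<^bsub>A\<^esub> \<in> ?U" using sub[of 0] by (auto simp: submodule_def)
  next
    fix c v assume "c \<in> carrier K" "v \<in> ?U"
    then show "c \<odot>\<^bsub>A\<^esub> v \<in> ?U" using sub by (auto simp: submodule_def)
  qed (use closed in auto)
  moreover have "\<one>\<^bsub>A\<^esub> \<in> ?U"
    using monomial_in_power[of "[]" W] W by auto
  moreover have "x \<otimes>\<^bsub>A\<^esub> y \<in> ?U" if "x \<in> ?U" "y \<in> ?U" for x y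
    using that power_mult[OF W(1)] by blast
  ultimately have "is_subalgebra K A ?U"
    by (simp add: is_subalgebra_def VectorSpace.subspace_def vectorspace_axioms)
  moreover have "W \<subseteq> ?U"
  proof
    fix w assume w: "w \<in> W"
    then have "w = monomial [w]" using W by (auto simp: mult_one)
    then show "w \<in> ?U" using monomial_in_power[of "[w]" W] w W by auto
  qed
  ultimately show ?thesis unfolding generated_subalgebra_def by blast
qed

end

text \<open>
  The inclusion \<open>carrier_span\<close> says that \<open>X\<close> generates the algebra.
\<close>
locale fg_algebra = unital_algebra K A
  for K :: "('k, 'r) ring_scheme" and A :: "('k, 'a, 'm) module_scheme" +
  fixes X :: "'a set"
  assumes finite_X: "finite X" and X_closed: "X \<subseteq> carrier A"
    and carrier_span: "carrier A \<subseteq> (\<Union>n. span (monomials X n))"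
begin

lemma generating_subspace_exists: "\<exists>W. generating_subspace K A W"
proof
  let ?W = "span (monomials X 1)"
  have mc: "monomials X 1 \<subseteq> carrier A" by (rule monomials_closed[OF X_closed])
  have sub: "submodule K ?W A" by (rule submodule_span_monomials[OF X_closed])
  have own: "monomials X 1 \<subseteq> ?W" by (rule in_own_span[OF mc])
  have fd: "vectorspace.fin_dim K (vs ?W)"
    using dim_le_card_spanning(1)[OF sub finite_monomials[OF finite_X] mc] by blast
  have one: "\<one>\<^bsub>A\<^esub> \<in> ?W"
    using own monomial_in_monomials[of "[]" X 1] by auto
  have XW: "X \<subseteq> ?W"
  proof
    fix x assume x: "x \<in> X"
    then have "monomial [x] = x" using X_closed by (auto simp: mult_one)
    with x have "x \<in> monomials X 1" using monomial_in_monomials[of "[x]" X 1] by simp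
    then show "x \<in> ?W" using own by blast
  qed
  have "carrier A \<subseteq> B" if B: "is_subalgebra K A B" "?W \<subseteq> B" for B
  proof -
    have sB: "submodule K B A" using B by (simp add: is_subalgebra_def VectorSpace.subspace_def)
    have "monomial xs \<in> B" if "set xs \<subseteq> X" for xs
      using that B XW by (induction xs) (auto simp: is_subalgebra_def)
    then have "monomials X n \<subseteq> B" for n unfolding monomials_def by blast
    then show ?thesis using carrier_span span_is_subset[OF _ sB] by blast
  qed
  moreover have "is_subalgebra K A (carrier A)"
    using submodule_carrier one_in mult_closed
    by (simp add: is_subalgebra_def VectorSpace.subspace_def vectorspace_axioms)
  ultimately have "generated_subalgebra K A ?W = carrier A"
    using sub unfolding generated_subalgebra_def submodule_def by blast
  then show "generating_subspace K A ?W"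
    using sub fd one by (simp add: generating_subspace_def VectorSpace.subspace_def vectorspace_axioms)
qed

lemma in_span_monomials_finite:
  assumes "finite T" "T \<subseteq> carrier A"
  shows "\<exists>m\<ge>1. T \<subseteq> span (monomials X m)"
  using assms
proof (induction T)
  case empty
  then show ?case by auto
next
  case (insert x T)
  then obtain m where m: "m \<ge> 1" "T \<subseteq> span (monomials X m)" by auto
  obtain n where n: "x \<in> span (monomials X n)" using insert carrier_span by blast
  have "span (monomials X m) \<subseteq> span (monomials X (max m n))"
       "span (monomials X n) \<subseteq> span (monomials X (max m n))"
    by (auto intro!: span_is_monotone monomials_mono del: subsetI)
  then show ?case using m n by (intro exI[of _ "max m n"]) auto
qed

text \<open>
  An arbitrary generating subspace \<open>W\<close> lies in the span of the monomials of some length \<open>m\<close>, and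
  conversely some power \<open>k\<close> of \<open>W\<close> contains the generators.  So the \<open>n\<close>-th power of \<open>W\<close> is
  squeezed between the spans of the monomials of length \<open>n div k\<close> and of length \<open>m * n\<close>.
\<close>
theorem GKdim_eqI:
  assumes upper: "\<And>n. n \<ge> 1 \<Longrightarrow> \<exists>T. finite T \<and> T \<subseteq> carrier A \<and> card T \<le> C * n ^ h \<and>
      monomials X n \<subseteq> span T"
    and M: "M \<ge> 1"
    and lower: "\<And>n. h > 0 \<Longrightarrow> n \<ge> 1 \<Longrightarrow>
      \<exists>S. lin_indpt S \<and> S \<subseteq> span (monomials X (M * n)) \<and> n ^ h \<le> card S"
  shows "GKdim K A = ereal (real h)"
proof -
  define W where "W = (SOME W. generating_subspace K A W)"
  have "generating_subspace K A W"
    unfolding W_def using generating_subspace_exists by (rule someI_ex)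
  then have subW: "submodule K W A" and fdW: "vectorspace.fin_dim K (vs W)"
    and oneW: "\<one>\<^bsub>A\<^esub> \<in> W" and genW: "generated_subalgebra K A W = carrier A"
    by (auto simp: generating_subspace_def VectorSpace.subspace_def)
  have Wc: "W \<subseteq> carrier A" using subW by (simp add: submodule_def)
  note subP = submodule_power[OF Wc]
  have "\<exists>m\<ge>1. W \<subseteq> span (monomials X m)"
  proof -
    interpret W: vectorspace K "vs W"
      by (intro subspace_is_vs) (simp add: VectorSpace.subspace_def vectorspace_axioms subW)
    obtain T where T: "finite T" "T \<subseteq> W" "W.span T = W"
      using fdW unfolding W.fin_dim_def by auto
    then have spT: "span T = W" using span_li_not_depend[OF _ subW] by simp
    obtain m where "m \<ge> 1" and Tm: "T \<subseteq> span (monomials X m)"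
      using in_span_monomials_finite[OF T(1) subset_trans[OF T(2) Wc]] by blast
    have "W \<subseteq> span (monomials X m)"
      using span_is_subset[OF Tm submodule_span_monomials[OF X_closed]] unfolding spT .
    with \<open>m \<ge> 1\<close> show ?thesis by (intro exI[of _ m] conjI)
  qed
  then obtain m where m: "m \<ge> 1" "W \<subseteq> span (monomials X m)" by auto
  have mon: "monomial xs \<in> span (monomials X (m * length xs))" if "set xs \<subseteq> W" for xs
    using that
  proof (induction xs)
    case Nil
    have "\<one>\<^bsub>A\<^esub> \<in> monomials X 0" using monomial_in_monomials[of "[]" X 0] by simp
    then show ?case using in_own_span[OF monomials_closed[OF X_closed]] by auto
  next
    case (Cons x xs)
    then show ?case
      using span_monomials_mult[OF X_closed, of x m "monomial xs" "m * length xs"] m by auto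
  qed
  have PX: "power_subspace K A W n \<subseteq> span (monomials X (m * n))" for n
    unfolding power_subspace_eq
    by (rule span_is_subset[OF _ submodule_span_monomials[OF X_closed]]) (use mon in auto)
  let ?d = "\<lambda>n. vectorspace.dim K (vs (power_subspace K A W n))"
  have dims: "vectorspace.fin_dim K (vs (power_subspace K A W n)) \<and> ?d n \<le> card T"
    if T: "finite T" "T \<subseteq> carrier A" "monomials X (m * n) \<subseteq> span T" for n T
  proof -
    have "power_subspace K A W n \<subseteq> span T"
      using PX span_is_subset[OF T(3) span_is_submodule[OF T(2)]] by blast
    then show ?thesis using dim_le_card_spanning[OF subP T(1,2)] by blast
  qed
  have fdP: "vectorspace.fin_dim K (vs (power_subspace K A W n))" for n
    by (rule dims[OF finite_monomials[OF finite_X] monomials_closed[OF X_closed]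
      in_own_span[OF monomials_closed[OF X_closed]], THEN conjunct1])
  have dupper: "?d n \<le> (C * m ^ h) * n ^ h" if n: "n \<ge> 1" for n
  proof -
    have "m * n \<ge> 1" using n m by (cases m; cases n) auto
    from upper[OF this] obtain T where T: "finite T" "T \<subseteq> carrier A"
      "card T \<le> C * (m * n) ^ h" "monomials X (m * n) \<subseteq> span T" by blast
    from dims[OF T(1,2,4)] T(3) have "?d n \<le> C * (m * n) ^ h" by linarith
    then show ?thesis by (simp add: power_mult_distrib mult_ac)
  qed
  have genP: "carrier A \<subseteq> (\<Union>n. power_subspace K A W n)"
    using generated_subset_powers[OF Wc oneW] unfolding genW .
  have "\<exists>k\<ge>1. T \<subseteq> power_subspace K A W k" if "finite T" "T \<subseteq> carrier A" for T
    using that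
  proof (induction T)
    case empty
    show ?case by (intro exI[of _ 1]) simp
  next
    case (insert x T)
    then obtain k where k: "k \<ge> 1" "T \<subseteq> power_subspace K A W k" by auto
    obtain n where n: "x \<in> power_subspace K A W n"
      using insert.prems genP by auto
    have "power_subspace K A W k \<subseteq> power_subspace K A W (max k n)"
      "power_subspace K A W n \<subseteq> power_subspace K A W (max k n)"
      by (intro power_mono Wc oneW max.cobounded1 max.cobounded2)+
    then have "insert x T \<subseteq> power_subspace K A W (max k n)" using k(2) n by (meson insert_subset subset_trans subsetD)
    then show ?case using k by (intro exI[of _ "max k n"]) simp
  qed
  from this[OF finite_X X_closed] obtain k where k: "k \<ge> 1" "X \<subseteq> power_subspace K A W k"
    by blast
  have monX: "monomial xs \<in> power_subspace K A W (k * length xs)" if "set xs \<subseteq> X" for xs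
    using that
  proof (induction xs)
    case Nil
    then show ?case using monomial_in_power[of "[]" W] Wc by simp
  next
    case (Cons x xs)
    then show ?case using power_mult[OF Wc, of x k "monomial xs" "k * length xs"] k by auto
  qed
  have XP: "span (monomials X n) \<subseteq> power_subspace K A W (k * n)" for n
  proof -
    have "x \<in> power_subspace K A W (k * n)" if x: "x \<in> monomials X n" for x
    proof -
      obtain xs where xs: "x = monomial xs" "set xs \<subseteq> X" "length xs \<le> n"
        using x by (auto simp: monomials_def)
      have le: "k * length xs \<le> k * n" using xs(3) by simp
      have "power_subspace K A W (k * length xs) \<subseteq> power_subspace K A W (k * n)"
        by (rule power_mono[OF Wc oneW le])
      moreover have "x \<in> power_subspace K A W (k * length xs)"
        using monX[OF xs(2)] xs(1) by simp
      ultimately show ?thesis by (rule subsetD)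
    qed
    then have "monomials X n \<subseteq> power_subspace K A W (k * n)" by (rule subsetI)
    then show ?thesis by (rule span_is_subset[OF _ subP])
  qed
  have dlower: "n ^ h \<le> ?d ((k * M) * n)" if n: "h > 0" "n \<ge> 1" for n
  proof -
    obtain S where S: "lin_indpt S" "S \<subseteq> span (monomials X (M * n))" "n ^ h \<le> card S"
      using lower[OF n] by blast
    have "S \<subseteq> power_subspace K A W (k * (M * n))" using S(2) XP[of "M * n"] by (rule subset_trans)
    then have "card S \<le> ?d (k * (M * n))" using S(1) by (intro card_indep_le_dim subP fdP)
    with S(3) show ?thesis by (simp add: mult.assoc)
  qed
  have "k * M \<ge> 1" using k M by (cases k; cases M) auto
  with dupper dlower have "limsup (\<lambda>n. ereal (ln (real (?d n)) / ln (real n))) = ereal (real h)"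
    by (intro limsup_log_growth[of ?d "C * m ^ h" h "k * M"])
  then show ?thesis by (simp add: GKdim_def growth_exponent_def W_def)
qed

end

section \<open>Algebras presented by generators and relations\<close>

definition word :: "'g list \<Rightarrow> ('k::field, 'g) free_algebra" where
  "word ws = Poly_Mapping.single (Word ws) 1"

lemma word_Nil: "word [] = 1"
  by (simp add: word_def flip: zero_word_monoid_def)

lemma word_append: "word (us @ vs) = word us * word vs"
  by (simp add: word_def mult_single plus_word_monoid_def)

lemma word_Cons: "word (x # ws) = gen x * word ws"
  by (simp add: word_def gen_def mult_single plus_word_monoid_def)

lemma gen_eq_word: "gen x = word [x]"
  by (simp add: word_def gen_def)

lemma scale_word: "scale c (word ws) = Poly_Mapping.single (Word ws) c"
  by (simp add: word_def scale_def mult_single)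

lemma scale_add: "scale c (p + q) = scale c p + scale c q"
  by (simp add: scale_def distrib_left)

lemma add_scale: "scale (c + d) p = scale c p + scale d p"
  by (simp add: scale_def single_add distrib_right)

lemma scale_diff: "scale c (p - q) = scale c p - scale c q"
  by (simp add: scale_def right_diff_distrib)

lemma scale_one [simp]: "scale 1 p = p"
  by (simp add: scale_def)

lemma scale_zero [simp]: "scale 0 p = 0" "scale c 0 = 0"
  by (simp_all add: scale_def)

lemma scale_scale: "scale c (scale d p) = scale (c * d) p"
  by (simp add: scale_def mult_single flip: mult.assoc)

lemma scale_minus_one: "scale (-1) p = - p"
  by (simp add: scale_def single_uminus)

lemma scale_mult: "scale c p * q = scale c (p * q)"
  by (simp add: scale_def mult.assoc)

lemma lookup_scale: "Poly_Mapping.lookup (scale c p) w = c * Poly_Mapping.lookup p w"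
proof -
  have "Poly_Mapping.lookup (Poly_Mapping.map ((*) c) p) w = c * Poly_Mapping.lookup p w"
    by (simp add: Poly_Mapping.map.rep_eq when_def)
  then show ?thesis by (simp add: scale_def mult_map_scale_conv_mult)
qed

lemma sum_words:
  "p = (\<Sum>w\<in>Poly_Mapping.keys p. scale (Poly_Mapping.lookup p w) (word (letters w)))"
proof (rule poly_mapping_eqI)
  fix v
  have "Poly_Mapping.lookup (scale (Poly_Mapping.lookup p w) (word (letters w))) v
      = (if w = v then Poly_Mapping.lookup p w else 0)" for w
    by (simp add: scale_word lookup_single when_def)
  then show "Poly_Mapping.lookup p v = Poly_Mapping.lookup
      (\<Sum>w\<in>Poly_Mapping.keys p. scale (Poly_Mapping.lookup p w) (word (letters w))) v"
    by (simp add: lookup_sum in_keys_iff)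
qed

text \<open>
  The case of words is restricted to the support of \<open>p\<close>, so that elements of \<^const>\<open>free_on\<close> need no
  induction principle of their own.
\<close>
lemma free_algebra_induct [case_names zero add word]:
  assumes "P 0" and add: "\<And>p q. P p \<Longrightarrow> P q \<Longrightarrow> P (p + q)"
    and word: "\<And>c ws. Word ws \<in> Poly_Mapping.keys p \<Longrightarrow> P (scale c (word ws))"
  shows "P p"
proof -
  have "P (\<Sum>w\<in>S. scale (Poly_Mapping.lookup p w) (word (letters w)))"
    if "finite S" "S \<subseteq> Poly_Mapping.keys p" for S
    using that
  proof (induction S)
    case (insert w S)
    then show ?case using word[of "letters w"] add by auto
  qed (use \<open>P 0\<close> in simp)
  then show ?thesis using sum_words[of p] by (metis finite_keys order_refl)
qed

lemma mult_scale: "p * scale c q = scale c (p * q)"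
proof (induction p rule: free_algebra_induct)
  case (word d ws)
  show ?case
  proof (induction q rule: free_algebra_induct)
    case (word b vs)
    then show ?case
      by (simp add: scale_word scale_def word_def mult_single plus_word_monoid_def
          zero_word_monoid_def mult_ac)
  qed (simp_all add: scale_add distrib_left)
qed (simp_all add: scale_add distrib_right)

subsection \<open>Representations of the free algebra\<close>

text \<open>
  A module over the free algebra is given by arbitrary linear operators for the generators.
  They act on all functions on a set, which avoids any condition of finite support.
\<close>
locale free_algebra_rep =
  fixes T :: "'g \<Rightarrow> ('x \<Rightarrow> 'k::field) \<Rightarrow> ('x \<Rightarrow> 'k)"
  assumes T_add: "T g (\<lambda>x. f x + h x) = (\<lambda>x. T g f x + T g h x)"
    and T_scale: "T g (\<lambda>x. c * f x) = (\<lambda>x. c * T g f x)"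
begin

abbreviation act_word :: "'g list \<Rightarrow> ('x \<Rightarrow> 'k) \<Rightarrow> ('x \<Rightarrow> 'k)" where
  "act_word ws \<equiv> foldr T ws"

definition act :: "('k, 'g) free_algebra \<Rightarrow> ('x \<Rightarrow> 'k) \<Rightarrow> ('x \<Rightarrow> 'k)" where
  "act p f x = (\<Sum>w\<in>Poly_Mapping.keys p. Poly_Mapping.lookup p w * act_word (letters w) f x)"

lemma act_word_add: "act_word ws (\<lambda>x. f x + h x) = (\<lambda>x. act_word ws f x + act_word ws h x)"
  by (induction ws) (simp_all add: T_add)

lemma act_word_scale: "act_word ws (\<lambda>x. c * f x) = (\<lambda>x. c * act_word ws f x)"
  by (induction ws) (simp_all add: T_scale)

lemma act_word_zero: "act_word ws (\<lambda>x. 0) = (\<lambda>x. 0)"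
  using act_word_scale[of ws 0 "\<lambda>x. 0"] by simp

lemma act_zero [simp]: "act 0 f x = 0"
  by (simp add: act_def)

lemma act_add: "act (p + q) f x = act p f x + act q f x"
  unfolding act_def
  by (rule setsum_keys_plus_distrib[where f = "\<lambda>w c. c * act_word (letters w) f x"])
    (simp_all add: distrib_right)

lemma act_single: "act (Poly_Mapping.single w c) f x = c * act_word (letters w) f x"
  by (simp add: act_def)

lemma act_scale: "act (scale c p) f x = c * act p f x"
proof (induction p rule: free_algebra_induct)
  case (word d ws)
  show ?case by (subst scale_scale) (simp add: scale_word act_single mult.assoc)
qed (simp_all add: scale_add act_add distrib_left)

lemma act_word_eq: "act (word ws) f x = act_word ws f x"
  by (simp add: word_def act_single)

lemma act_word_mult: "act (word ws * q) f x = act_word ws (act q f) x"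
proof (induction q rule: free_algebra_induct)
  case zero
  then show ?case using act_word_zero by (simp add: act_def[abs_def])
next
  case (add p q)
  have "act (p + q) f = (\<lambda>x. act p f x + act q f x)" by (simp add: act_add fun_eq_iff)
  with add show ?case by (simp add: distrib_left act_add act_word_add)
next
  case (word c vs)
  have "act (scale c (word vs)) f = (\<lambda>x. c * act (word vs) f x)" by (simp add: act_scale fun_eq_iff)
  moreover have "act (word vs) f = act_word vs f" by (simp add: act_word_eq fun_eq_iff)
  moreover have "act (word ws * word vs) f x = act_word ws (act_word vs f) x"
    using act_word_eq[of "ws @ vs"] by (simp add: word_append)
  ultimately show ?case by (simp add: mult_scale act_scale act_word_scale)
qed

lemma act_mult: "act (p * q) f x = act p (act q f) x"
proof (induction p rule: free_algebra_induct)
  case (word c ws)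
  then show ?case by (simp add: scale_mult act_scale act_word_mult act_word_eq)
qed (simp_all add: distrib_right act_add)

lemma act_diff: "act (p - q) f x = act p f x - act q f x"
  using act_add[of p "- q" f x] act_scale[of "-1" q f x] by (simp add: scale_minus_one)

lemma act_sum: "act (\<Sum>i\<in>I. p i) f x = (\<Sum>i\<in>I. act (p i) f x)"
  by (induction I rule: infinite_finite_induct) (simp_all add: act_add)

lemma act_gen: "act (gen g) f x = T g f x"
  using act_word_eq[of "[g]"] by (simp add: gen_eq_word)

lemma act_ideal_eq_0:
  assumes R: "\<And>r f x. r \<in> R \<Longrightarrow> act r f x = 0" and p: "p \<in> ideal_on Y R"
  shows "act p f x = 0"
  using p
proof (induction arbitrary: f x)
  case (mult_left p a)
  then have "act p f = (\<lambda>x. 0)" by (simp add: fun_eq_iff)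
  moreover have "act a (\<lambda>x. 0) x = 0" by (simp add: act_def act_word_zero)
  ultimately show ?case by (simp add: act_mult)
qed (simp_all add: R act_add act_scale act_mult)

end

subsection \<open>The quotient algebra\<close>

lemma free_on_word: "ws \<noteq> [] \<Longrightarrow> set ws \<subseteq> X \<Longrightarrow> word ws \<in> free_on X"
  by (simp add: free_on_def word_def)

lemma free_on_zero: "0 \<in> free_on X"
  by (simp add: free_on_def)

lemma free_on_add: "p \<in> free_on X \<Longrightarrow> q \<in> free_on X \<Longrightarrow> p + q \<in> free_on X"
  unfolding free_on_def using keys_add[of p q] by blast

lemma free_on_mult: "p \<in> free_on X \<Longrightarrow> q \<in> free_on X \<Longrightarrow> p * q \<in> free_on X"
  unfolding free_on_def using keys_mult[of p q] by (fastforce simp: plus_word_monoid_def)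

lemma free_on_scale: "p \<in> free_on X \<Longrightarrow> scale c p \<in> free_on X"
  unfolding free_on_def by (auto simp: in_keys_iff lookup_scale)

lemma free_on_minus: "p \<in> free_on X \<Longrightarrow> - p \<in> free_on X"
  using free_on_scale[of p X "-1"] by (simp add: scale_minus_one)

lemma free_on_diff: "p \<in> free_on X \<Longrightarrow> q \<in> free_on X \<Longrightarrow> p - q \<in> free_on X"
  using free_on_add[of p X "- q"] by (simp add: free_on_minus)

lemma free_on_gen: "x \<in> X \<Longrightarrow> gen x \<in> free_on X"
  by (simp add: gen_eq_word free_on_word)

lemma free_on_sum: "(\<And>i. i \<in> I \<Longrightarrow> p i \<in> free_on X) \<Longrightarrow> (\<Sum>i\<in>I. p i) \<in> free_on X"
  by (induction I rule: infinite_finite_induct) (auto simp: free_on_zero free_on_add)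

lemma ideal_on_context:
  assumes "p \<in> ideal_on X R" "set as \<subseteq> X" "set bs \<subseteq> X"
  shows "word as * p * word bs \<in> ideal_on X R"
proof -
  have "word as * p \<in> ideal_on X R"
    using assms by (cases "as = []") (auto simp: word_Nil intro!: ideal_on.mult_left free_on_word)
  then show ?thesis
    using assms by (cases "bs = []") (auto simp: word_Nil intro!: ideal_on.mult_right free_on_word)
qed

text \<open>
  It suffices to test the candidate for the unit on the generators.
\<close>
locale presented_unital =
  fixes X :: "'g set" and R :: "('k::field, 'g) free_algebra set" and e :: "('k, 'g) free_algebra"
  assumes R_free: "R \<subseteq> free_on X" and e_free: "e \<in> free_on X"
    and e_gen: "x \<in> X \<Longrightarrow> e * gen x - gen x \<in> ideal_on X R"
    and gen_e: "x \<in> X \<Longrightarrow> gen x * e - gen x \<in> ideal_on X R"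
begin

abbreviation "I \<equiv> ideal_on X R"
abbreviation "A \<equiv> presented_algebra X R e"
abbreviation cls where "cls \<equiv> coset I"

text \<open>
  Ideals absorb factors from the free algebra without unit only.  By this inclusion they also absorb
  every representative of a coset, which makes the product of cosets well defined.
\<close>
lemma ideal_free: "p \<in> I \<Longrightarrow> p \<in> free_on X"
  by (induction rule: ideal_on.induct)
    (use R_free in \<open>auto intro: free_on_zero free_on_add free_on_scale free_on_mult\<close>)

lemma ideal_minus: "p \<in> I \<Longrightarrow> - p \<in> I"
  using ideal_on.scale[of p X R "-1"] by (simp add: scale_minus_one)

lemma ideal_diff: "p \<in> I \<Longrightarrow> q \<in> I \<Longrightarrow> p - q \<in> I"
  using ideal_on.add[of p X R "- q"] by (simp add: ideal_minus)

lemma cls_eq_iff: "cls p = cls q \<longleftrightarrow> p - q \<in> I"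
proof
  assume "cls p = cls q"
  moreover have "p \<in> cls p" using ideal_on.zero[of X R] unfolding coset_def by force
  ultimately obtain i where "i \<in> I" "p = q + i" unfolding coset_def by auto
  then show "p - q \<in> I" by simp
next
  assume pq: "p - q \<in> I"
  have "r \<in> cls p \<longleftrightarrow> r - p \<in> I" for r p
    unfolding coset_def by (force simp: algebra_simps)
  moreover have "r - p \<in> I \<longleftrightarrow> r - q \<in> I" for r
    using ideal_on.add[OF _ pq, of "r - p"] ideal_diff[OF _ pq, of "r - q"]
    by auto
  ultimately show "cls p = cls q" by blast
qed

lemma cls_eqI: "p - q \<in> I \<Longrightarrow> cls p = cls q"
  by (simp add: cls_eq_iff)

lemma in_cls_iff: "p' \<in> cls p \<longleftrightarrow> p' - p \<in> I"
  unfolding coset_def by (force simp: algebra_simps)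

lemma cls_self: "p \<in> cls p"
  by (simp add: in_cls_iff ideal_on.zero)

lemma carrier_A: "carrier A = cls ` free_on X"
  by (simp add: presented_algebra_def Let_def)

lemma zero_A: "\<zero>\<^bsub>A\<^esub> = cls 0"
  by (simp add: presented_algebra_def Let_def coset_def)

lemma one_A: "\<one>\<^bsub>A\<^esub> = cls e"
  by (simp add: presented_algebra_def Let_def)

lemma add_A: "cls p \<oplus>\<^bsub>A\<^esub> cls q = cls (p + q)"
proof -
  have "cls (p' + q') = cls (p + q)" if "p' \<in> cls p" "q' \<in> cls q" for p' q'
    using that ideal_on.add[of "p' - p" X R "q' - q"]
    by (intro cls_eqI) (simp add: in_cls_iff algebra_simps)
  moreover have "cls p \<oplus>\<^bsub>A\<^esub> cls q = (\<Union>p'\<in>cls p. \<Union>q'\<in>cls q. cls (p' + q'))"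
    by (simp add: presented_algebra_def Let_def)
  ultimately show ?thesis using cls_self[of p] cls_self[of q] by blast
qed

lemma smult_A: "c \<odot>\<^bsub>A\<^esub> cls p = cls (scale c p)"
proof -
  have "cls (scale c p') = cls (scale c p)" if "p' \<in> cls p" for p'
    using that ideal_on.scale[of "p' - p" X R c]
    by (intro cls_eqI) (simp add: in_cls_iff scale_diff)
  moreover have "c \<odot>\<^bsub>A\<^esub> cls p = (\<Union>p'\<in>cls p. cls (scale c p'))"
    by (simp add: presented_algebra_def Let_def)
  ultimately show ?thesis using cls_self[of p] by blast
qed

lemma mult_A:
  assumes p: "p \<in> free_on X" and q: "q \<in> free_on X"
  shows "cls p \<otimes>\<^bsub>A\<^esub> cls q = cls (p * q)"
proof -
  have "cls (p' * q') = cls (p * q)" if "p' \<in> cls p" "q' \<in> cls q" for p' q'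
  proof (rule cls_eqI)
    from that have i: "p' - p \<in> I" "q' - q \<in> I" by (simp_all add: in_cls_iff)
    then have "q' \<in> free_on X" using free_on_add[OF ideal_free[OF i(2)] q] by simp
    then have "(p' - p) * q' + p * (q' - q) \<in> I"
      using i p by (intro ideal_on.add ideal_on.mult_left ideal_on.mult_right)
    then show "p' * q' - p * q \<in> I" by (simp add: algebra_simps)
  qed
  moreover have "cls p \<otimes>\<^bsub>A\<^esub> cls q = (\<Union>p'\<in>cls p. \<Union>q'\<in>cls q. cls (p' * q'))"
    by (simp add: presented_algebra_def Let_def)
  ultimately show ?thesis using cls_self[of p] cls_self[of q] by blast
qed

text \<open>
  The first letter of a word absorbs \<open>e\<close> from the left.
\<close>
lemma e_mult: "p \<in> free_on X \<Longrightarrow> cls (e * p) = cls p"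
proof (rule cls_eqI)
  assume p: "p \<in> free_on X"
  show "e * p - p \<in> I"
  proof (induction p rule: free_algebra_induct)
    case zero
    show ?case by (simp add: ideal_on.zero)
  next
    case (add p q)
    then show ?case using ideal_on.add[of "e * p - p" X R "e * q - q"] by (simp add: algebra_simps)
  next
    case (word c ws)
    with p have ws: "ws \<noteq> []" "set ws \<subseteq> X" by (force simp: free_on_def)+
    then obtain x vs where xs: "ws = x # vs" "x \<in> X" "set vs \<subseteq> X" by (cases ws) auto
    have "e * word ws - word ws = (e * gen x - gen x) * word vs"
      by (simp add: xs word_Cons algebra_simps)
    also have "\<dots> \<in> I"
      using e_gen[OF xs(2)] xs(3)
      by (cases "vs = []") (auto simp: word_Nil intro!: ideal_on.mult_right free_on_word)
    finally show ?case using ideal_on.scale[of "e * word ws - word ws" X R c]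
      by (simp add: mult_scale scale_diff)
  qed
qed

lemma mult_e: "p \<in> free_on X \<Longrightarrow> cls (p * e) = cls p"
proof (rule cls_eqI)
  assume p: "p \<in> free_on X"
  show "p * e - p \<in> I"
  proof (induction p rule: free_algebra_induct)
    case zero
    show ?case by (simp add: ideal_on.zero)
  next
    case (add p q)
    then show ?case using ideal_on.add[of "p * e - p" X R "q * e - q"] by (simp add: algebra_simps)
  next
    case (word c ws)
    with p have ws: "ws \<noteq> []" "set ws \<subseteq> X" by (force simp: free_on_def)+
    then obtain x vs where xs: "ws = vs @ [x]" "x \<in> X" "set vs \<subseteq> X" by (cases ws rule: rev_cases) auto
    have "word ws * e - word ws = word vs * (gen x * e - gen x)"
      by (simp add: xs word_append gen_eq_word algebra_simps)
    also have "\<dots> \<in> I"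
      using gen_e[OF xs(2)] xs(3)
      by (cases "vs = []") (auto simp: word_Nil intro!: ideal_on.mult_left free_on_word)
    finally show ?case using ideal_on.scale[of "word ws * e - word ws" X R c]
      by (simp add: scale_mult scale_diff)
  qed
qed

lemma carrier_cases: assumes "x \<in> carrier A" obtains p where "p \<in> free_on X" "x = cls p"
  using assms by (auto simp: carrier_A)

lemma cls_closed: "p \<in> free_on X \<Longrightarrow> cls p \<in> carrier A"
  by (simp add: carrier_A)

lemmas A_simps = add_A smult_A mult_A zero_A one_A free_on_zero free_on_add free_on_scale
  free_on_mult e_free

lemma vectorspace_A: "vectorspace class_ring A"
proof (rule vs_criteria)
  show "field (class_ring :: 'k ring)" by (rule class_field)
  show "\<forall>v\<in>carrier A. \<exists>neg_v\<in>carrier A. v \<oplus>\<^bsub>A\<^esub> neg_v = \<zero>\<^bsub>A\<^esub>"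
  proof
    fix v assume "v \<in> carrier A"
    then obtain p where p: "p \<in> free_on X" "v = cls p" by (rule carrier_cases)
    then show "\<exists>neg_v\<in>carrier A. v \<oplus>\<^bsub>A\<^esub> neg_v = \<zero>\<^bsub>A\<^esub>"
      by (intro bexI[of _ "cls (- p)"]) (simp_all add: A_simps carrier_A free_on_minus)
  qed
qed (auto simp: carrier_A A_simps scale_add add_scale scale_scale add_ac)

lemma unital_algebra_A: "unital_algebra class_ring A"
proof -
  interpret vectorspace class_ring A by (rule vectorspace_A)
  show ?thesis
  proof
    fix x assume "x \<in> carrier A"
    then obtain p where "p \<in> free_on X" "x = cls p" by (rule carrier_cases)
    then show "\<one>\<^bsub>A\<^esub> \<otimes>\<^bsub>A\<^esub> x = x" "x \<otimes>\<^bsub>A\<^esub> \<one>\<^bsub>A\<^esub> = x"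
      by (simp_all add: A_simps e_mult mult_e)
  qed (auto simp: carrier_A A_simps distrib_left distrib_right scale_mult mult_scale mult.assoc)
qed

sublocale A: unital_algebra class_ring A
  by (rule unital_algebra_A)

lemma monomial_cls:
  assumes "ws \<noteq> []" "set ws \<subseteq> X"
  shows "A.monomial (map (\<lambda>x. cls (gen x)) ws) = cls (word ws)"
  using assms
proof (induction ws rule: list_nonempty_induct)
  case (single x)
  then show ?case by (simp add: A_simps free_on_gen mult_e word_Cons word_Nil)
next
  case (cons x ws)
  then show ?case by (simp add: A_simps free_on_gen free_on_word word_Cons)
qed

lemma fg_algebra_A:
  assumes "finite X"
  shows "fg_algebra class_ring A ((\<lambda>x. cls (gen x)) ` X)"
proof
  show "finite ((\<lambda>x. cls (gen x)) ` X)" using assms by simp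
  show Xc: "(\<lambda>x. cls (gen x)) ` X \<subseteq> carrier A" by (auto intro: cls_closed free_on_gen)
  let ?M = "\<lambda>n. A.monomials ((\<lambda>x. cls (gen x)) ` X) n"
  have sub: "submodule class_ring (A.span (?M n)) A" for n
    by (rule A.submodule_span_monomials[OF Xc])
  show "carrier A \<subseteq> (\<Union>n. A.span (?M n))"
  proof
    fix x assume "x \<in> carrier A"
    then obtain p where p: "p \<in> free_on X" "x = cls p" by (rule carrier_cases)
    have "\<exists>n. cls p \<in> A.span (?M n)"
    proof (induction p rule: free_algebra_induct)
      case zero
      show ?case using sub[of 0] by (auto simp: submodule_def zero_A)
    next
      case (add p q)
      then obtain m n where mn: "cls p \<in> A.span (?M m)" "cls q \<in> A.span (?M n)" by blast
      have "A.span (?M m) \<subseteq> A.span (?M (max m n))" "A.span (?M n) \<subseteq> A.span (?M (max m n))"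
        by (intro A.span_is_monotone A.monomials_mono max.cobounded1 max.cobounded2)+
      with mn have "cls p \<in> A.span (?M (max m n))" "cls q \<in> A.span (?M (max m n))" by auto
      then have "cls p \<oplus>\<^bsub>A\<^esub> cls q \<in> A.span (?M (max m n))"
        using sub[of "max m n"] by (simp add: submodule_def)
      then show ?case by (auto simp: add_A)
    next
      case (word c ws)
      with p have ws: "ws \<noteq> []" "set ws \<subseteq> X" by (force simp: free_on_def)+
      have "A.monomial (map (\<lambda>x. cls (gen x)) ws) \<in> ?M (length ws)"
        using ws by (intro A.monomial_in_monomials) auto
      then have "cls (word ws) \<in> ?M (length ws)" by (simp add: monomial_cls ws)
      then have "cls (word ws) \<in> A.span (?M (length ws))"
        using A.in_own_span[OF A.monomials_closed[OF Xc]] by blast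
      then have "c \<odot>\<^bsub>A\<^esub> cls (word ws) \<in> A.span (?M (length ws))"
        using sub[of "length ws"] by (simp add: submodule_def)
      then show ?case by (auto simp: smult_A)
    qed
    then show "x \<in> (\<Union>n. A.span (?M n))" using p by auto
  qed
qed

text \<open>
  A dual family of functionals on the free algebra that vanish on the ideal proves independence in
  the quotient, so no representation of the quotient itself has to be set up.
\<close>
lemma independent_by_functionals:
  fixes a :: "'j \<Rightarrow> ('k, 'g) free_algebra" and \<phi> :: "'j \<Rightarrow> ('k, 'g) free_algebra \<Rightarrow> 'k"
  assumes J: "finite J" and a: "\<And>j. j \<in> J \<Longrightarrow> a j \<in> free_on X"
    and add: "\<And>j p q. \<phi> j (p + q) = \<phi> j p + \<phi> j q"
    and scale: "\<And>j c p. \<phi> j (scale c p) = c * \<phi> j p"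
    and ideal: "\<And>j p. p \<in> I \<Longrightarrow> \<phi> j p = 0"
    and dual: "\<And>i j. i \<in> J \<Longrightarrow> j \<in> J \<Longrightarrow> \<phi> i (a j) = (if i = j then 1 else 0)"
  shows "A.lin_indpt ((\<lambda>j. cls (a j)) ` J)" and "card ((\<lambda>j. cls (a j)) ` J) = card J"
proof -
  have zero: "\<phi> j 0 = 0" for j using scale[of j 0 0] by simp
  have wd: "\<phi> j p = \<phi> j q" if "cls p = cls q" for j p q
  proof -
    have "\<phi> j p = \<phi> j ((p - q) + q)" by simp
    also have "\<dots> = \<phi> j q" unfolding add using ideal that by (simp add: cls_eq_iff)
    finally show ?thesis .
  qed
  have inj: "inj_on (\<lambda>j. cls (a j)) J"
  proof (rule inj_onI)
    fix i j assume ij: "i \<in> J" "j \<in> J" "cls (a i) = cls (a j)"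
    then have "\<phi> i (a i) = \<phi> i (a j)" by (intro wd)
    then show "i = j" using ij dual by (auto split: if_splits)
  qed
  then show "card ((\<lambda>j. cls (a j)) ` J) = card J" by (rule card_image)
  show "A.lin_indpt ((\<lambda>j. cls (a j)) ` J)"
  proof (rule A.finite_lin_indpt2)
    show "finite ((\<lambda>j. cls (a j)) ` J)" using J by simp
    show "(\<lambda>j. cls (a j)) ` J \<subseteq> carrier A" using a by (auto intro: cls_closed)
    fix c :: "('k, 'g) free_algebra set \<Rightarrow> 'k"
    assume "A.lincomb c ((\<lambda>j. cls (a j)) ` J) = \<zero>\<^bsub>A\<^esub>"
    moreover have "A.lincomb c ((\<lambda>j. cls (a j)) ` S) = cls (\<Sum>j\<in>S. scale (c (cls (a j))) (a j))"
      if "finite S" "S \<subseteq> J" for S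
      using that
    proof (induction S)
      case empty
      then show ?case by (simp add: A.lincomb_def zero_A)
    next
      case (insert j S)
      have "cls (a j) \<notin> (\<lambda>j. cls (a j)) ` S"
        using insert inj by (auto simp: inj_on_def)
      moreover have "(\<lambda>j. cls (a j)) ` S \<subseteq> carrier A" "cls (a j) \<in> carrier A"
        using a insert by (auto intro: cls_closed)
      ultimately have "A.lincomb c (insert (cls (a j)) ((\<lambda>j. cls (a j)) ` S)) =
        c (cls (a j)) \<odot>\<^bsub>A\<^esub> cls (a j) \<oplus>\<^bsub>A\<^esub> A.lincomb c ((\<lambda>j. cls (a j)) ` S)"
        using A.lincomb_insert[of "(\<lambda>j. cls (a j)) ` S" c "cls (a j)"] insert by simp
      with insert show ?case by (simp add: smult_A add_A)
    qed
    ultimately have "cls (\<Sum>j\<in>J. scale (c (cls (a j))) (a j)) = cls 0"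
      using J by (simp add: zero_A)
    then have eq: "\<phi> i (\<Sum>j\<in>J. scale (c (cls (a j))) (a j)) = 0" for i
      using wd zero by metis
    have sum: "\<phi> i (\<Sum>j\<in>S. scale (c (cls (a j))) (a j)) = (\<Sum>j\<in>S. c (cls (a j)) * \<phi> i (a j))"
      if "finite S" for i S
      using that by (induction S) (simp_all add: zero add scale)
    have "c (cls (a i)) = 0" if i: "i \<in> J" for i
    proof -
      have "0 = (\<Sum>j\<in>J. c (cls (a j)) * \<phi> i (a j))" using eq[of i] sum[OF J] by simp
      also have "\<dots> = (\<Sum>j\<in>J. if i = j then c (cls (a j)) else 0)"
        using i dual by (intro sum.cong) auto
      also have "\<dots> = c (cls (a i))" using i J by simp
      finally show ?thesis by simp
    qed
    then show "\<forall>v\<in>(\<lambda>j. cls (a j)) ` J. c v = \<zero>\<^bsub>class_ring\<^esub>" by simp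
  qed
qed

end

section \<open>Digraphs with disjoint cycles\<close>

text \<open>
  These are the arrows that lie on cycles.  This form avoids rotations and makes the uniqueness of
  the cycle through a vertex a statement about arrows.
\<close>
definition (in pre_digraph) cyclic_arc :: "'b \<Rightarrow> bool" where
  "cyclic_arc e \<longleftrightarrow> e \<in> arcs G \<and> head G e \<rightarrow>\<^sup>* tail G e"

lemma (in wf_digraph) arc_reachable: "e \<in> arcs G \<Longrightarrow> tail G e \<rightarrow>\<^sup>* head G e"
  by (metis arc_implies_awalk reachable_awalk)

lemma (in wf_digraph) walk_tails_heads:
  "awalk u p v \<Longrightarrow> insert v (tail G ` set p) = insert u (head G ` set p)"
proof (induction p arbitrary: u)
  case (Cons e p)
  from Cons.prems have "tail G e = u" "awalk (head G e) p v" by (auto simp: awalk_Cons_iff)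
  with Cons.IH[OF this(2)] show ?case by (simp add: insert_commute)
qed (simp add: awalk_Nil_iff)

lemma (in wf_digraph) closed_walk_heads:
  assumes p: "awalk u p u" "p \<noteq> []"
  shows "head G ` set p = tail G ` set p"
proof -
  have "u \<in> tail G ` set p" using p by (cases p) (auto simp: awalk_Cons_iff)
  moreover have "u \<in> head G ` set p"
    using p by (cases p rule: rev_cases) (auto simp: awalk_Cons_iff awalk_Nil_iff)
  ultimately show ?thesis using walk_tails_heads[OF p(1)] by (simp add: insert_absorb)
qed

text \<open>
  A path back without repeated vertices closes up to a cycle.  The uniqueness clauses hold because
  neither end of \<open>e\<close> is visited a second time.
\<close>
lemma (in wf_digraph) cycle_through_cyclic_arc:
  assumes e: "cyclic_arc e"
  obtains p where "cycle (e # p)" "awalk (tail G e) (e # p) (tail G e)"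
    "\<And>f. f \<in> set (e # p) \<Longrightarrow> tail G f = tail G e \<Longrightarrow> f = e"
    "\<And>f. f \<in> set (e # p) \<Longrightarrow> head G f = head G e \<Longrightarrow> f = e"
proof -
  have eG: "e \<in> arcs G" using e by (simp add: cyclic_arc_def)
  obtain p where p: "apath (head G e) p (tail G e)"
    using e unfolding cyclic_arc_def reachable_apath by blast
  then have aw: "awalk (head G e) p (tail G e)" and d: "distinct (awalk_verts (head G e) p)"
    by (simp_all add: apath_def)
  have aw': "awalk (tail G e) (e # p) (tail G e)"
    using eG aw by (simp add: awalk_Cons_iff)
  have "cycle (e # p)"
    unfolding cycle_def using aw' d by (intro exI[of _ "tail G e"]) simp
  moreover have "f = e" if "f \<in> set (e # p)" "tail G f = tail G e" for f
  proof (rule ccontr)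
    assume "f \<noteq> e"
    with that have f: "f \<in> set p" by simp
    then have "p \<noteq> []" by auto
    then have "awalk_verts (head G e) p = map (tail G) p @ [tail G e]"
      using awlast_of_awalk[OF aw] by (simp add: awalk_verts_conv)
    with d have "tail G e \<notin> tail G ` set p" by simp
    moreover have "tail G f \<in> tail G ` set p" using f by (rule imageI)
    ultimately show False using that(2) by simp
  qed
  moreover have "f = e" if "f \<in> set (e # p)" "head G f = head G e" for f
  proof (rule ccontr)
    assume "f \<noteq> e"
    with that have f: "f \<in> set p" by simp
    then have "p \<noteq> []" by auto
    then have "awalk_verts (head G e) p = head G e # map (head G) p"
    proof -
      have "cas (head G e) p (tail G e)" using aw by blast
      moreover from this \<open>p \<noteq> []\<close> have "tail G (hd p) = head G e" by (cases p) auto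
      ultimately show ?thesis using \<open>p \<noteq> []\<close> awalk_verts_conv'[of "head G e" p] by simp
    qed
    with d have "head G e \<notin> head G ` set p" by simp
    moreover have "head G f \<in> head G ` set p" using f by (rule imageI)
    ultimately show False using that(2) by simp
  qed
  ultimately show ?thesis by (intro that[of p] aw')
qed

lemma cycle_arcs_rotations: "cycle_arcs (range (\<lambda>n. rotate n p)) = set p"
  by (simp add: cycle_arcs_def)

context wf_digraph
begin

lemma cyclesE:
  assumes "C \<in> cycles G"
  obtains u p where "awalk u p u" "p \<noteq> []" "cycle p" "C = range (\<lambda>n. rotate n p)" "cycle_arcs C = set p"
    "cycle_verts G C = tail G ` set p"
proof -
  obtain p where C: "C = range (\<lambda>n. rotate n p)" and p: "cycle p"
    using assms unfolding cycles_def by blast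
  obtain u where "awalk u p u" "p \<noteq> []" using p unfolding cycle_def by blast
  then show ?thesis using p C by (intro that[of u p]) (simp_all add: cycle_verts_def cycle_arcs_rotations)
qed

lemma cycle_mutually_reachable:
  assumes "C \<in> cycles G" "u \<in> cycle_verts G C" "v \<in> cycle_verts G C"
  shows "u \<rightarrow>\<^sup>* v"
proof -
  obtain w p where p: "awalk w p w" "cycle_verts G C = tail G ` set p"
    using assms(1) by (rule cyclesE)
  have "w \<rightarrow>\<^sup>* x \<and> x \<rightarrow>\<^sup>* w" if x: "x \<in> tail G ` set p" for x
  proof -
    obtain e where e: "e \<in> set p" "x = tail G e" using x by blast
    then have "x \<in> set (awalk_verts w p)" using awalk_verts_arc1[OF e(1)] p by auto
    then show ?thesis using awalk_verts_reachable_from[OF p(1)] awalk_verts_reachable_to[OF p(1)] by auto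
  qed
  then have "u \<rightarrow>\<^sup>* w" "w \<rightarrow>\<^sup>* v" using assms p by auto
  then show ?thesis by (rule reachable_trans)
qed

lemma cycle_head_in_verts:
  assumes "C \<in> cycles G" "e \<in> cycle_arcs C"
  shows "head G e \<in> cycle_verts G C" "tail G e \<in> cycle_verts G C"
proof -
  obtain u p where p: "awalk u p u" "p \<noteq> []" "cycle_arcs C = set p" "cycle_verts G C = tail G ` set p"
    using assms(1) by (rule cyclesE)
  then show "head G e \<in> cycle_verts G C" "tail G e \<in> cycle_verts G C"
    using closed_walk_heads[OF p(1,2)] assms(2) by auto
qed

lemma cycle_arcs_in_arcs: "C \<in> cycles G \<Longrightarrow> cycle_arcs C \<subseteq> arcs G"
  by (auto elim!: cyclesE)

lemma cycle_arc_cyclic: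
  assumes "C \<in> cycles G" "e \<in> cycle_arcs C"
  shows "cyclic_arc e"
  using assms cycle_mutually_reachable[OF assms(1) cycle_head_in_verts[OF assms]] cycle_arcs_in_arcs
  by (auto simp: cyclic_arc_def)

lemma cycle_verts_nonempty: "C \<in> cycles G \<Longrightarrow> cycle_verts G C \<noteq> {}"
  by (auto elim!: cyclesE)

lemma cycle_verts_in_verts: "C \<in> cycles G \<Longrightarrow> cycle_verts G C \<subseteq> verts G"
  using cycle_arcs_in_arcs[of C] by (auto simp: cycle_verts_def)

lemma cyclic_arc_in_cycle:
  assumes "cyclic_arc e"
  obtains C where "C \<in> cycles G" "e \<in> cycle_arcs C"
proof -
  obtain p where "cycle (e # p)" using assms by (rule cycle_through_cyclic_arc)
  then show ?thesis
    using that[of "range (\<lambda>n. rotate n (e # p))"] by (auto simp: cycles_def cycle_arcs_rotations)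
qed

end

lemma (in fin_digraph) finite_cycles: "finite (cycles G)"
proof -
  have "{p. cycle p} \<subseteq> {p. set p \<subseteq> arcs G \<and> length p \<le> card (arcs G)}"
  proof
    fix p assume "p \<in> {p. cycle p}"
    then obtain u where u: "awalk u p u" and "distinct p" by (auto simp: cycle_conv)
    then have "set p \<subseteq> arcs G" "distinct p" by (auto simp: awalk_def)
    then show "p \<in> {p. set p \<subseteq> arcs G \<and> length p \<le> card (arcs G)}"
      using distinct_card[of p] card_mono[OF finite_arcs, of "set p"] by simp
  qed
  then have "finite {p. cycle p}" by (rule finite_subset) (simp add: finite_lists_length_le)
  moreover have "cycles G = (\<lambda>p. range (\<lambda>n. rotate n p)) ` {p. cycle p}"
    unfolding cycles_def by auto
  ultimately show ?thesis by simp
qed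

locale disjoint_cycles_digraph = fin_digraph +
  assumes disjoint_cycles: "disjoint_cycles G"
begin

lemma cycles_eqI:
  assumes "C \<in> cycles G" "D \<in> cycles G" "v \<in> cycle_verts G C" "v \<in> cycle_verts G D"
  shows "C = D"
proof (rule ccontr)
  assume "C \<noteq> D"
  then have "cycle_verts G C \<inter> cycle_verts G D = {}"
    using disjoint_cycles assms(1,2) by (simp add: disjoint_cycles_def)
  then show False using assms(3,4) by (simp add: disjoint_iff)
qed

text \<open>
  This is the form in which disjointness of the cycles is used below: within a cycle there is
  only one way forward and only one way back.  Both arrows lie on the same cycle, which
  passes through each end of \<open>e\<close> only once.
\<close>
lemma cyclic_arcs_share_cycle:
  assumes e: "cyclic_arc e" and f: "cyclic_arc f" and ef: "tail G e = tail G f \<or> head G e = head G f"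
  shows "e = f"
proof -
  obtain p where p: "cycle (e # p)" "awalk (tail G e) (e # p) (tail G e)"
    "\<And>f. f \<in> set (e # p) \<Longrightarrow> tail G f = tail G e \<Longrightarrow> f = e"
    "\<And>f. f \<in> set (e # p) \<Longrightarrow> head G f = head G e \<Longrightarrow> f = e"
    using cycle_through_cyclic_arc[OF e] by metis
  obtain D where D: "D \<in> cycles G" "f \<in> cycle_arcs D"
    using f by (rule cyclic_arc_in_cycle)
  let ?C = "range (\<lambda>n. rotate n (e # p))"
  have C: "?C \<in> cycles G" "cycle_arcs ?C = set (e # p)"
    using p(1) by (auto simp: cycles_def cycle_arcs_rotations)
  have "?C = D"
    using ef
  proof
    assume "tail G e = tail G f"
    then show ?thesis
      using cycles_eqI[OF C(1) D(1), of "tail G e"] cycle_head_in_verts[OF D]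
        cycle_head_in_verts[OF C(1), of e] C(2) by simp
  next
    assume "head G e = head G f"
    then show ?thesis
      using cycles_eqI[OF C(1) D(1), of "head G e"] cycle_head_in_verts[OF D]
        cycle_head_in_verts[OF C(1), of e] C(2) by simp
  qed
  then have "f \<in> set (e # p)" using D C(2) by simp
  then show ?thesis using p ef by metis
qed

lemma cyclic_arc_in_given_cycle:
  assumes "C \<in> cycles G" "cyclic_arc e" "tail G e \<in> cycle_verts G C"
  shows "e \<in> cycle_arcs C"
proof -
  obtain f where f: "f \<in> cycle_arcs C" "tail G e = tail G f"
    using assms(3) unfolding cycle_verts_def by (rule imageE)
  then show ?thesis
    using cyclic_arcs_share_cycle[OF assms(2) cycle_arc_cyclic[OF assms(1) f(1)]] by simp
qed

lemma exits_iff: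
  assumes C: "C \<in> cycles G"
  shows "e \<in> exits G C \<longleftrightarrow> e \<in> arcs G \<and> \<not> cyclic_arc e \<and> tail G e \<in> cycle_verts G C"
  using cyclic_arc_in_given_cycle[OF C] cycle_arc_cyclic[OF C] by (auto simp: exits_def)

text \<open>
  Every arrow of a walk from \<open>u\<close> to \<open>v\<close> is cyclic as \<open>v\<close> leads back to \<open>u\<close>, so the walk cannot leave \<open>C\<close>.
\<close>
lemma strongly_connected_cycle_verts:
  assumes C: "C \<in> cycles G" and "u \<in> cycle_verts G C" "u \<rightarrow>\<^sup>* v" "v \<rightarrow>\<^sup>* u"
  shows "v \<in> cycle_verts G C"
proof -
  obtain p where "awalk u p v" using assms reachable_awalk by blast
  then show ?thesis using assms
  proof (induction p arbitrary: u)
    case Nil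
    then show ?case by (simp add: awalk_Nil_iff)
  next
    case (Cons e p)
    then have e: "e \<in> arcs G" "tail G e = u" "awalk (head G e) p v" by (auto simp: awalk_Cons_iff)
    then have hv: "head G e \<rightarrow>\<^sup>* v" using reachable_awalk by blast
    then have "cyclic_arc e" using e Cons.prems reachable_trans unfolding cyclic_arc_def by metis
    then have "e \<in> cycle_arcs C" using C Cons.prems e by (intro cyclic_arc_in_given_cycle) auto
    then have "head G e \<in> cycle_verts G C" using C cycle_head_in_verts by blast
    moreover have "v \<rightarrow>\<^sup>* head G e"
      using Cons.prems e arc_reachable[OF e(1)] by (metis reachable_trans)
    ultimately show ?case using Cons.IH e C hv by blast
  qed
qed

lemma leaving_walk_exit:
  assumes C: "C \<in> cycles G" and "u \<in> cycle_verts G C" "u \<rightarrow>\<^sup>* v" "v \<notin> cycle_verts G C"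
  obtains e where "e \<in> exits G C" "head G e \<rightarrow>\<^sup>* v"
proof -
  obtain p where "awalk u p v" using assms reachable_awalk by blast
  then have "\<exists>e\<in>exits G C. head G e \<rightarrow>\<^sup>* v" using assms(2)
  proof (induction p arbitrary: u)
    case Nil
    then show ?case using assms by (simp add: awalk_Nil_iff)
  next
    case (Cons e p)
    then have e: "e \<in> arcs G" "tail G e = u" "awalk (head G e) p v" by (auto simp: awalk_Cons_iff)
    show ?case
    proof (cases "e \<in> cycle_arcs C")
      case True
      then show ?thesis using Cons.IH e C cycle_head_in_verts by blast
    next
      case False
      then have "e \<in> exits G C" using e Cons.prems by (simp add: exits_def)
      then show ?thesis using e reachable_awalk by blast
    qed
  qed
  then show ?thesis using that by blast
qed

subsection \<open>The order on sinks and cycles, and the height\<close>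

abbreviation "SC \<equiv> sinks_and_cycles G"

lemma finite_SC: "finite SC"
  unfolding sinks_and_cycles_def sinks_def using finite_cycles by simp

lemma verts_of_in_verts: "x \<in> SC \<Longrightarrow> verts_of G x \<subseteq> verts G"
  unfolding sinks_and_cycles_def sinks_def by (auto dest: subsetD[OF cycle_verts_in_verts])

lemma verts_of_mutually_reachable:
  "x \<in> SC \<Longrightarrow> u \<in> verts_of G x \<Longrightarrow> v \<in> verts_of G x \<Longrightarrow> u \<rightarrow>\<^sup>* v"
  unfolding sinks_and_cycles_def sinks_def using cycle_mutually_reachable by auto

lemma sink_reachable: "v \<in> sinks G \<Longrightarrow> v \<rightarrow>\<^sup>* w \<Longrightarrow> w = v"
  unfolding sinks_def reachable_awalk
proof (elim exE)
  fix p assume v: "v \<in> {v \<in> verts G. out_arcs G v = {}}" and p: "awalk v p w"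
  then show "w = v" by (cases p) (auto simp: awalk_Cons_iff awalk_Nil_iff out_arcs_def)
qed

text \<open>
  Antisymmetry of the order on sinks and cycles: mutually reachable vertices lie on a common cycle,
  or coincide if one of them is a sink.
\<close>
lemma SC_eqI:
  assumes "x \<in> SC" "y \<in> SC" "u \<in> verts_of G x" "v \<in> verts_of G y" "u \<rightarrow>\<^sup>* v" "v \<rightarrow>\<^sup>* u"
  shows "x = y"
proof -
  have no_sink: "w \<notin> sinks G" if "C \<in> cycles G" "w \<in> cycle_verts G C" for C w
    using that cycle_arcs_in_arcs[OF that(1)] unfolding cycle_verts_def sinks_def by force
  show ?thesis
  proof (cases x)
    case (Sink a)
    then have "a \<in> sinks G" "u = a" using assms unfolding sinks_and_cycles_def by auto
    moreover have "v = u" using sink_reachable calculation assms by auto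
    ultimately show ?thesis using Sink assms no_sink unfolding sinks_and_cycles_def by auto
  next
    case (Cycle C)
    then have C: "C \<in> cycles G" "u \<in> cycle_verts G C"
      using assms unfolding sinks_and_cycles_def by auto
    have vC: "v \<in> cycle_verts G C"
      using strongly_connected_cycle_verts[OF C assms(5,6)] .
    show ?thesis
    proof (cases y)
      case (Sink b)
      then have "v \<in> sinks G" using assms unfolding sinks_and_cycles_def by auto
      then show ?thesis using no_sink[OF C(1) vC] by simp
    next
      case Cycle': (Cycle D)
      then have "D \<in> cycles G" "v \<in> cycle_verts G D"
        using assms unfolding sinks_and_cycles_def by auto
      then show ?thesis using cycles_eqI[OF C(1) _ vC] Cycle Cycle' by simp
    qed
  qed
qed

lemma leads_to_trans:
  assumes "leads_to G x y" "leads_to G y z" "y \<in> SC"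
  shows "leads_to G x z"
  using assms verts_of_mutually_reachable unfolding leads_to_def by (meson reachable_trans)

lemma leads_to_antisym:
  assumes "leads_to G x y" "leads_to G y x" "x \<in> SC" "y \<in> SC"
  shows "x = y"
proof -
  obtain u v where uv: "u \<in> verts_of G x" "v \<in> verts_of G y" "u \<rightarrow>\<^sup>* v"
    using assms(1) unfolding leads_to_def by blast
  obtain v' u' where "v' \<in> verts_of G y" "u' \<in> verts_of G x" "v' \<rightarrow>\<^sup>* u'"
    using assms(2) unfolding leads_to_def by blast
  then have "v \<rightarrow>\<^sup>* u" using uv assms verts_of_mutually_reachable by (meson reachable_trans)
  then show ?thesis using uv assms SC_eqI by blast
qed

lemma wf_strictly_below: "wf (strictly_below G)"
proof (rule finite_acyclic_wf)
  show "finite (strictly_below G)"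
    using finite_SC by (rule_tac finite_subset[of _ "SC \<times> SC"]) (auto simp: strictly_below_def)
  have "trans (strictly_below G)"
    unfolding trans_def strictly_below_def using leads_to_trans leads_to_antisym by blast
  then show "acyclic (strictly_below G)"
    by (simp add: acyclic_def trancl_id) (simp add: strictly_below_def)
qed

text \<open>
  The recursion equation: cutting off the recursive calls does not matter, as all of them go
  strictly below \<open>x\<close>.
\<close>
lemma height_of_unfold:
  "height_of G x = (case x of Sink v \<Rightarrow> 0
     | Cycle C \<Rightarrow> if exits G C = {} then 1
         else 2 + Max (height_of G ` {y. (y, x) \<in> strictly_below G}))"
proof -
  have "cut (height_of G) (strictly_below G) x ` {y. (y, x) \<in> strictly_below G}
      = height_of G ` {y. (y, x) \<in> strictly_below G}"
    by (rule image_cong) (auto simp: cut_apply)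
  with def_wfrec[OF eq_reflection[OF height_of_def] wf_strictly_below, of x]
  show ?thesis by (cases x) simp_all
qed

lemma height_of_Sink [simp]: "height_of G (Sink v) = 0"
  by (subst height_of_unfold) simp

lemma height_of_no_exit: "exits G C = {} \<Longrightarrow> height_of G (Cycle C) = 1"
  by (subst height_of_unfold) simp

lemma finite_below: "finite {y. (y, x) \<in> strictly_below G}"
  using finite_SC by (rule rev_finite_subset) (auto simp: strictly_below_def)

text \<open>
  Walk along arbitrary arrows.  An arrow that lies on no cycle makes its source unreachable, so the set of
  reachable vertices shrinks until a sink or a cycle is met.
\<close>
lemma reaches_sink_or_cycle:
  "v \<in> verts G \<Longrightarrow> \<exists>x\<in>SC. \<exists>w\<in>verts_of G x. v \<rightarrow>\<^sup>* w"
proof (induction "card {w. v \<rightarrow>\<^sup>* w}" arbitrary: v rule: less_induct)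
  case less
  show ?case
  proof (cases "out_arcs G v = {}")
    case True
    then have "Sink v \<in> SC" "v \<in> verts_of G (Sink v)"
      using less.prems by (auto simp: sinks_and_cycles_def sinks_def)
    then show ?thesis using less.prems by (meson reachable_refl)
  next
    case False
    then obtain e where "e \<in> out_arcs G v" by blast
    then have e: "e \<in> arcs G" "tail G e = v" by auto
    show ?thesis
    proof (cases "cyclic_arc e")
      case True
      then obtain C where C: "C \<in> cycles G" "e \<in> cycle_arcs C" by (rule cyclic_arc_in_cycle)
      then have "Cycle C \<in> SC" "v \<in> verts_of G (Cycle C)"
        using e by (auto simp: sinks_and_cycles_def cycle_verts_def)
      then show ?thesis using less.prems by (meson reachable_refl)
    next
      case False
      have fin: "finite {w. v \<rightarrow>\<^sup>* w}"
        by (rule finite_subset[OF _ finite_verts]) (auto intro: reachable_in_verts)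
      have ve: "v \<rightarrow>\<^sup>* head G e" using arc_reachable[OF e(1)] e(2) by simp
      have "{w. head G e \<rightarrow>\<^sup>* w} \<subseteq> {w. v \<rightarrow>\<^sup>* w}" using reachable_trans[OF ve] by auto
      moreover have "v \<notin> {w. head G e \<rightarrow>\<^sup>* w}" using False e by (simp add: cyclic_arc_def)
      moreover have "v \<in> {w. v \<rightarrow>\<^sup>* w}" using less.prems reachable_refl by simp
      ultimately have "card {w. head G e \<rightarrow>\<^sup>* w} < card {w. v \<rightarrow>\<^sup>* w}"
        by (intro psubset_card_mono fin) blast
      then have "\<exists>x\<in>SC. \<exists>w\<in>verts_of G x. head G e \<rightarrow>\<^sup>* w"
        using less.hyps e(1) by simp
      then show ?thesis using reachable_trans[OF ve] by blast
    qed
  qed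
qed

lemma below_imp_exit:
  assumes "(y, Cycle C) \<in> strictly_below G"
  obtains e v where "e \<in> exits G C" "v \<in> verts_of G y" "head G e \<rightarrow>\<^sup>* v"
proof -
  have y: "y \<in> SC" "Cycle C \<in> SC" "leads_to G (Cycle C) y" "y \<noteq> Cycle C"
    using assms by (auto simp: strictly_below_def)
  then have C: "C \<in> cycles G" by (auto simp: sinks_and_cycles_def)
  obtain u v where uv: "u \<in> cycle_verts G C" "v \<in> verts_of G y" "u \<rightarrow>\<^sup>* v"
    using y unfolding leads_to_def by auto
  have "v \<notin> cycle_verts G C"
    using SC_eqI[OF y(1,2) uv(2), of v] y uv verts_of_in_verts[OF y(1)] reachable_refl by auto
  then show ?thesis using leaving_walk_exit[OF C uv(1,3)] that uv by metis
qed

text \<open>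
  An exit cannot lead back to its cycle, so whatever it leads to is strictly below.  Hence the maximum in the
  definition of the height is taken over a nonempty set.
\<close>
lemma below_nonempty:
  assumes C: "C \<in> cycles G" and ex: "exits G C \<noteq> {}"
  shows "{y. (y, Cycle C) \<in> strictly_below G} \<noteq> {}"
proof -
  obtain e where e: "e \<in> exits G C" using ex by blast
  then have e': "e \<in> arcs G" "\<not> cyclic_arc e" "tail G e \<in> cycle_verts G C" using exits_iff C by auto
  obtain x w where x: "x \<in> SC" "w \<in> verts_of G x" "head G e \<rightarrow>\<^sup>* w"
    using reaches_sink_or_cycle[of "head G e"] e' by auto
  have tw: "tail G e \<rightarrow>\<^sup>* w" using arc_reachable[OF e'(1)] x(3) by (rule reachable_trans)
  have "x \<noteq> Cycle C"
  proof
    assume "x = Cycle C"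
    then have "w \<rightarrow>\<^sup>* tail G e" using x e' C cycle_mutually_reachable by auto
    then have "cyclic_arc e" using x e' reachable_trans unfolding cyclic_arc_def by metis
    then show False using e' by simp
  qed
  then have "(x, Cycle C) \<in> strictly_below G"
    using x tw e' C by (auto simp: strictly_below_def leads_to_def sinks_and_cycles_def)
  then show ?thesis by blast
qed

lemma height_of_exit:
  assumes "(y, Cycle C) \<in> strictly_below G"
  shows "2 + height_of G y \<le> height_of G (Cycle C)"
proof -
  have "exits G C \<noteq> {}" using assms by (rule below_imp_exit) auto
  then have "height_of G (Cycle C) = 2 + Max (height_of G ` {y. (y, Cycle C) \<in> strictly_below G})"
    by (subst height_of_unfold) simp
  then show ?thesis using assms finite_below by simp
qed

lemma height_of_attained:
  assumes "C \<in> cycles G" "exits G C \<noteq> {}"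
  obtains y where "(y, Cycle C) \<in> strictly_below G" "height_of G (Cycle C) = 2 + height_of G y"
proof -
  have "height_of G (Cycle C) = 2 + Max (height_of G ` {y. (y, Cycle C) \<in> strictly_below G})"
    using assms by (subst height_of_unfold) simp
  moreover have "Max (height_of G ` {y. (y, Cycle C) \<in> strictly_below G})
      \<in> height_of G ` {y. (y, Cycle C) \<in> strictly_below G}"
    using below_nonempty[OF assms] finite_below by (intro Max_in) auto
  ultimately show ?thesis using that by auto
qed

lemma height_of_cycle_pos: "C \<in> cycles G \<Longrightarrow> height_of G (Cycle C) \<ge> 1"
  by (subst height_of_unfold) simp

lemma height_le_digraph_height: "x \<in> SC \<Longrightarrow> height_of G x \<le> digraph_height G"
  unfolding sinks_and_cycles_def digraph_height_def using finite_cycles by auto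

subsection \<open>The height below a vertex\<close>

text \<open>
  The height of a cycle looks at what lies below it, whereas paths into a vertex are counted by moving
  upwards from the vertex.  This function of vertices mediates between the two: it does not decrease along
  reversed arrows, and it grows by at least 2 whenever an exit of a cycle is crossed.
\<close>
definition height_from :: "'a \<Rightarrow> nat" where
  "height_from v = Max (height_of G ` {x \<in> SC. \<exists>w\<in>verts_of G x. v \<rightarrow>\<^sup>* w})"

lemma height_from_attained:
  assumes "v \<in> verts G"
  obtains x w where "x \<in> SC" "w \<in> verts_of G x" "v \<rightarrow>\<^sup>* w" "height_from v = height_of G x"
proof -
  have "height_from v \<in> height_of G ` {x \<in> SC. \<exists>w\<in>verts_of G x. v \<rightarrow>\<^sup>* w}"
    unfolding height_from_def using finite_SC reaches_sink_or_cycle[OF assms] by (intro Max_in) auto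
  then show ?thesis using that by auto
qed

lemma height_of_le_from:
  "x \<in> SC \<Longrightarrow> w \<in> verts_of G x \<Longrightarrow> v \<rightarrow>\<^sup>* w \<Longrightarrow> height_of G x \<le> height_from v"
  unfolding height_from_def using finite_SC by (intro Max_ge) auto

lemma height_from_mono: "u \<rightarrow>\<^sup>* v \<Longrightarrow> height_from v \<le> height_from u"
  using height_from_attained[of v] height_of_le_from reachable_trans reachable_in_verts by metis

lemma height_from_le: "v \<in> verts G \<Longrightarrow> height_from v \<le> digraph_height G"
  using height_from_attained[of v] height_le_digraph_height by metis

lemma height_from_cyclic: "cyclic_arc e \<Longrightarrow> height_from (head G e) \<ge> 1"
proof -
  assume e: "cyclic_arc e"
  then obtain C where C: "C \<in> cycles G" "e \<in> cycle_arcs C" by (rule cyclic_arc_in_cycle)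
  then have "Cycle C \<in> SC" "head G e \<in> verts_of G (Cycle C)"
    using cycle_head_in_verts by (auto simp: sinks_and_cycles_def)
  moreover have "head G e \<in> verts G" using e by (simp add: cyclic_arc_def)
  ultimately show ?thesis
    using height_of_le_from height_of_cycle_pos[OF C(1)] reachable_refl le_trans by metis
qed

lemma height_from_exit:
  assumes e: "e \<in> arcs G" "\<not> cyclic_arc e" and f: "cyclic_arc f" "head G f = tail G e"
  shows "height_from (head G e) + 2 \<le> height_from (tail G e)"
proof -
  obtain C where C: "C \<in> cycles G" "f \<in> cycle_arcs C" using f(1) by (rule cyclic_arc_in_cycle)
  then have tC: "tail G e \<in> cycle_verts G C" using cycle_head_in_verts f(2) by metis
  obtain x w where x: "x \<in> SC" "w \<in> verts_of G x" "head G e \<rightarrow>\<^sup>* w"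
    "height_from (head G e) = height_of G x"
    using height_from_attained[of "head G e"] e by auto
  have tw: "tail G e \<rightarrow>\<^sup>* w" using arc_reachable[OF e(1)] x(3) by (rule reachable_trans)
  have "x \<noteq> Cycle C"
  proof
    assume "x = Cycle C"
    then have "w \<rightarrow>\<^sup>* tail G e" using x tC C cycle_mutually_reachable by auto
    then show False using x e reachable_trans unfolding cyclic_arc_def by metis
  qed
  then have "(x, Cycle C) \<in> strictly_below G"
    using x tw tC C by (auto simp: strictly_below_def leads_to_def sinks_and_cycles_def)
  then have "2 + height_of G x \<le> height_of G (Cycle C)" by (rule height_of_exit)
  also have "\<dots> \<le> height_from (tail G e)"
    using C tC e by (intro height_of_le_from[of _ "tail G e"]) (auto simp: sinks_and_cycles_def)
  finally show ?thesis using x by simp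
qed

end

section \<open>Counting walks from above\<close>

context wf_digraph
begin

definition walks_to :: "'a \<Rightarrow> nat \<Rightarrow> 'b list set" where
  "walks_to v n = {p. (\<exists>u. awalk u p v) \<and> length p \<le> n}"

text \<open>
  Cutting off the arrows of the cycle of \<open>v\<close> at the end of a walk leaves such a walk, into some vertex
  of the cycle.
\<close>
definition entering_walks :: "'a \<Rightarrow> nat \<Rightarrow> 'b list set" where
  "entering_walks v n = {p \<in> walks_to v n. p = [] \<or> \<not> cyclic_arc (last p)}"

definition on_cycle :: "'a \<Rightarrow> bool" where
  "on_cycle v \<longleftrightarrow> (\<exists>e. cyclic_arc e \<and> head G e = v)"

lemma walks_to_snoc:
  assumes "p \<in> walks_to v n" "p \<noteq> []"
  shows "last p \<in> arcs G" "head G (last p) = v" "butlast p \<in> walks_to (tail G (last p)) (n - 1)"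
proof -
  obtain r e where p: "p = r @ [e]" using assms(2) by (cases p rule: rev_cases) auto
  then obtain u where u: "awalk u (r @ [e]) v" "length r < n" using assms(1) by (auto simp: walks_to_def)
  then have "awalk u r (tail G e)" "e \<in> arcs G" "head G e = v"
    by (auto simp: awalk_Cons_iff awalk_Nil_iff)
  then show "last p \<in> arcs G" "head G (last p) = v" "butlast p \<in> walks_to (tail G (last p)) (n - 1)"
    using p u(2) by (auto simp: walks_to_def)
qed

end

context disjoint_cycles_digraph
begin

lemma finite_walks_to: "finite (walks_to v n)"
  by (rule finite_subset[OF _ finite_lists_length_le[OF finite_arcs, of n]])
    (auto simp: walks_to_def awalk_def)

lemma finite_entering_walks: "finite (entering_walks v n)"
  using finite_walks_to[of v n] by (simp add: entering_walks_def)

lemma on_cycle_tail: "cyclic_arc e \<Longrightarrow> on_cycle (tail G e)"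
proof -
  assume "cyclic_arc e"
  then obtain C where C: "C \<in> cycles G" "e \<in> cycle_arcs C" by (rule cyclic_arc_in_cycle)
  obtain u p where p: "awalk u p u" "p \<noteq> []" "cycle_arcs C = set p"
    using C(1) by (rule cyclesE)
  have "tail G e \<in> head G ` set p"
    using closed_walk_heads[OF p(1,2)] C(2) p(3) by simp
  then obtain f where "f \<in> set p" "head G f = tail G e" by auto
  then show ?thesis using cycle_arc_cyclic[OF C(1)] p(3) by (auto simp: on_cycle_def)
qed

definition ancestors :: "'a \<Rightarrow> nat" where
  "ancestors v = card {u. u \<rightarrow>\<^sup>* v}"

lemma finite_ancestors: "finite {u. u \<rightarrow>\<^sup>* v}"
  by (rule finite_subset[OF _ finite_verts]) (auto intro: reachable_in_verts)

lemma ancestors_pos: "v \<in> verts G \<Longrightarrow> ancestors v > 0"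
  unfolding ancestors_def using finite_ancestors by (auto simp: card_gt_0_iff intro: exI[of _ v])

lemma ancestors_mono: "u \<rightarrow>\<^sup>* v \<Longrightarrow> ancestors u \<le> ancestors v"
  unfolding ancestors_def using reachable_trans by (intro card_mono finite_ancestors) auto

lemma ancestors_less:
  assumes e: "e \<in> arcs G" "\<not> cyclic_arc e"
  shows "ancestors (tail G e) < ancestors (head G e)"
  unfolding ancestors_def
proof (rule psubset_card_mono[OF finite_ancestors psubsetI])
  have te: "tail G e \<rightarrow>\<^sup>* head G e" using arc_reachable[OF e(1)] .
  then show "{u. u \<rightarrow>\<^sup>* tail G e} \<subseteq> {u. u \<rightarrow>\<^sup>* head G e}"
    using reachable_trans[OF _ te] by auto
  have "head G e \<rightarrow>\<^sup>* head G e" using e by simp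
  moreover have "\<not> head G e \<rightarrow>\<^sup>* tail G e" using e by (simp add: cyclic_arc_def)
  ultimately show "{u. u \<rightarrow>\<^sup>* tail G e} \<noteq> {u. u \<rightarrow>\<^sup>* head G e}" by auto
qed

abbreviation "H \<equiv> digraph_height G"

text \<open>
  An upper bound for the number of cycles that a path can meet before it enters the cycle of \<open>v\<close>,
  or reaches \<open>v\<close> if \<open>v\<close> lies on no cycle.
\<close>
definition entering_exponent :: "'a \<Rightarrow> nat" where
  "entering_exponent v = (H - height_from v) div 2"

definition walk_exponent :: "'a \<Rightarrow> nat" where
  "walk_exponent v = entering_exponent v + (if on_cycle v then 1 else 0)"

text \<open>
  A step that lies on no cycle does not increase the exponent.  If it leaves a cycle, the cycle has
  contributed 1, and this is compensated by the increase of the height by 2.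
\<close>
lemma walk_exponent_entering:
  assumes e: "e \<in> arcs G" "\<not> cyclic_arc e"
  shows "walk_exponent (tail G e) \<le> entering_exponent (head G e)"
proof (cases "on_cycle (tail G e)")
  case True
  then obtain f where f: "cyclic_arc f" "head G f = tail G e" by (auto simp: on_cycle_def)
  have "height_from (head G e) + 2 \<le> height_from (tail G e)" using height_from_exit[OF e f] .
  moreover have "height_from (tail G e) \<le> H" using e by (intro height_from_le) simp
  ultimately show ?thesis using True by (simp add: walk_exponent_def entering_exponent_def)
next
  case False
  have "height_from (head G e) \<le> height_from (tail G e)"
    by (intro height_from_mono arc_reachable e)
  then show ?thesis using False by (simp add: walk_exponent_def entering_exponent_def div_le_mono)
qed

lemma entering_walks_subset:
  "entering_walks v n \<subseteq> insert []
     (\<Union>e\<in>{e \<in> arcs G. head G e = v \<and> \<not> cyclic_arc e}. (\<lambda>r. r @ [e]) ` walks_to (tail G e) n)"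
proof
  fix p assume p: "p \<in> entering_walks v n"
  show "p \<in> insert [] (\<Union>e\<in>{e \<in> arcs G. head G e = v \<and> \<not> cyclic_arc e}.
      (\<lambda>r. r @ [e]) ` walks_to (tail G e) n)"
  proof (cases "p = []")
    case False
    with p have "p \<in> walks_to v n" "\<not> cyclic_arc (last p)" by (auto simp: entering_walks_def)
    moreover have "walks_to (tail G (last p)) (n - 1) \<subseteq> walks_to (tail G (last p)) n"
      by (auto simp: walks_to_def)
    ultimately have "butlast p \<in> walks_to (tail G (last p)) n"
      "last p \<in> {e \<in> arcs G. head G e = v \<and> \<not> cyclic_arc e}"
      using walks_to_snoc[OF _ False, of v n] by auto
    moreover have "p = butlast p @ [last p]" using False by simp
    ultimately show ?thesis by (metis (no_types, lifting) UN_I image_eqI insertI2)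
  qed simp
qed

lemma card_entering_walks:
  assumes "\<And>e. e \<in> arcs G \<Longrightarrow> \<not> cyclic_arc e \<Longrightarrow> head G e = v \<Longrightarrow>
      card (walks_to (tail G e) n) \<le> K * (n + 1) ^ entering_exponent v"
  shows "card (entering_walks v n) \<le> (1 + card (arcs G) * K) * (n + 1) ^ entering_exponent v"
proof -
  let ?E = "{e \<in> arcs G. head G e = v \<and> \<not> cyclic_arc e}"
  let ?U = "\<Union>e\<in>?E. (\<lambda>r. r @ [e]) ` walks_to (tail G e) n"
  have finE: "finite ?E" by simp
  have "card ?U \<le> (\<Sum>e\<in>?E. card ((\<lambda>r. r @ [e]) ` walks_to (tail G e) n))"
    by (rule card_UN_le[OF finE])
  also have "\<dots> \<le> (\<Sum>e\<in>?E. K * (n + 1) ^ entering_exponent v)"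
    using assms by (intro sum_mono le_trans[OF card_image_le[OF finite_walks_to]]) auto
  also have "\<dots> = card ?E * (K * (n + 1) ^ entering_exponent v)" by simp
  also have "\<dots> \<le> card (arcs G) * (K * (n + 1) ^ entering_exponent v)"
    by (intro mult_right_mono card_mono) auto
  finally have U: "card ?U \<le> card (arcs G) * (K * (n + 1) ^ entering_exponent v)" .
  have "card (entering_walks v n) \<le> card (insert [] ?U)"
    using finE finite_walks_to by (intro card_mono entering_walks_subset) auto
  also have "\<dots> \<le> Suc (card ?U)" by (simp add: card_insert_if finite_walks_to)
  also have "\<dots> \<le> (n + 1) ^ entering_exponent v + card (arcs G) * (K * (n + 1) ^ entering_exponent v)"
  proof -
    have "1 \<le> (n + 1) ^ entering_exponent v" by simp
    with U show ?thesis by linarith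
  qed
  finally show ?thesis by (simp add: algebra_simps)
qed

lemma walks_to_noncyclic: "\<not> on_cycle v \<Longrightarrow> walks_to v n = entering_walks v n"
  using walks_to_snoc(2)[of _ v n] by (auto simp: entering_walks_def on_cycle_def)

lemma walks_to_cyclic:
  assumes f: "cyclic_arc f" "head G f = v"
  shows "walks_to v (Suc n) \<subseteq> entering_walks v (Suc n) \<union> (\<lambda>r. r @ [f]) ` walks_to (tail G f) n"
proof
  fix p assume p: "p \<in> walks_to v (Suc n)"
  show "p \<in> entering_walks v (Suc n) \<union> (\<lambda>r. r @ [f]) ` walks_to (tail G f) n"
  proof (cases "p = [] \<or> \<not> cyclic_arc (last p)")
    case True
    then show ?thesis using p by (simp add: entering_walks_def)
  next
    case False
    then have "last p = f"
      using walks_to_snoc[OF p] cyclic_arcs_share_cycle[of "last p" f] f by auto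
    then have "butlast p \<in> walks_to (tail G f) n" "p = butlast p @ [f]"
      using walks_to_snoc[OF p] False append_butlast_last_id[of p] by auto
    then show ?thesis by blast
  qed
qed

lemma walks_to_0: "walks_to v 0 \<subseteq> {[]}"
  by (auto simp: walks_to_def)

text \<open>
  The induction is on the number of ancestors, which drops along reversed arrows that lie on no cycle.
  Along a cycle it is constant.  There an inner induction on the length sums the bounds for walks entering
  the cycle; summing raises the exponent by 1.
\<close>
lemma card_walks_bound_aux:
  "\<exists>K. \<forall>v\<in>verts G. ancestors v \<le> m \<longrightarrow> (\<forall>n.
      card (walks_to v n) \<le> K * (n + 1) ^ walk_exponent v \<and>
      card (entering_walks v n) \<le> K * (n + 1) ^ entering_exponent v)"
proof (induction m)
  case 0
  have "\<not> ancestors v \<le> 0" if "v \<in> verts G" for v using ancestors_pos[OF that] by simp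
  then show ?case by blast
next
  case (Suc m)
  then obtain K where K: "\<And>v n. v \<in> verts G \<Longrightarrow> ancestors v \<le> m \<Longrightarrow>
      card (walks_to v n) \<le> K * (n + 1) ^ walk_exponent v" by metis
  \<comment> \<open>The trivial walk, and one walk into the source of each entering arrow.\<close>
  define K' where "K' = 1 + card (arcs G) * K"
  have ent: "card (entering_walks v n) \<le> K' * (n + 1) ^ entering_exponent v" if v: "ancestors v \<le> Suc m" for v n
    unfolding K'_def
  proof (rule card_entering_walks)
    fix e assume e: "e \<in> arcs G" "\<not> cyclic_arc e" "head G e = v"
    then have "ancestors (tail G e) \<le> m" using ancestors_less[OF e(1,2)] v by simp
    then have "card (walks_to (tail G e) n) \<le> K * (n + 1) ^ walk_exponent (tail G e)"
      using K e by simp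
    also have "\<dots> \<le> K * (n + 1) ^ entering_exponent v"
      using walk_exponent_entering[OF e(1,2)] e(3) by (intro mult_left_mono power_increasing) auto
    finally show "card (walks_to (tail G e) n) \<le> K * (n + 1) ^ entering_exponent v" .
  qed
  have cyc: "card (walks_to v n) \<le> K' * (n + 1) ^ (entering_exponent v + 1)"
    if "on_cycle v" "ancestors v \<le> Suc m" for v n
    using that
  proof (induction n arbitrary: v)
    case 0
    have "card (walks_to v 0) \<le> card {[] :: 'b list}" by (rule card_mono[OF _ walks_to_0]) simp
    then show ?case by (simp add: K'_def)
  next
    case (Suc n)
    obtain f where f: "cyclic_arc f" "head G f = v" using Suc.prems(1) by (auto simp: on_cycle_def)
    have fv: "v \<rightarrow>\<^sup>* tail G f" "tail G f \<rightarrow>\<^sup>* v"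
      using f arc_reachable[of f] by (auto simp: cyclic_arc_def)
    have w: "entering_exponent (tail G f) = entering_exponent v"
      using height_from_mono[OF fv(1)] height_from_mono[OF fv(2)] by (simp add: entering_exponent_def)
    have "ancestors (tail G f) \<le> Suc m"
      using ancestors_mono[OF fv(2)] Suc.prems(2) by simp
    with Suc.IH[OF on_cycle_tail[OF f(1)]] w
    have IH: "card (walks_to (tail G f) n) \<le> K' * (n + 1) ^ (entering_exponent v + 1)" by simp
    have "card (walks_to v (Suc n)) \<le>
        card (entering_walks v (Suc n) \<union> (\<lambda>r. r @ [f]) ` walks_to (tail G f) n)"
      by (intro card_mono walks_to_cyclic f) (simp_all add: finite_entering_walks finite_walks_to)
    also have "\<dots> \<le> card (entering_walks v (Suc n)) + card ((\<lambda>r. r @ [f]) ` walks_to (tail G f) n)"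
      by (rule card_Un_le)
    also have "\<dots> \<le> K' * (Suc n + 1) ^ entering_exponent v + K' * (n + 1) ^ (entering_exponent v + 1)"
      using ent[OF Suc.prems(2)] le_trans[OF card_image_le[OF finite_walks_to] IH]
      by (intro add_mono) auto
    also have "K' * (n + 1) ^ (entering_exponent v + 1) \<le> K' * ((n + 1) * (Suc n + 1) ^ entering_exponent v)"
      by (intro mult_left_mono) (auto intro!: mult_left_mono power_mono simp del: power_Suc add_Suc_right
        simp add: power_add)
    also have "K' * (Suc n + 1) ^ entering_exponent v + K' * ((n + 1) * (Suc n + 1) ^ entering_exponent v)
        = K' * (Suc n + 1) ^ (entering_exponent v + 1)"
      by (simp add: algebra_simps)
    finally show ?case by simp
  qed
  show ?case
  proof (intro exI[of _ K'] ballI impI allI conjI)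
    fix v n assume v: "v \<in> verts G" "ancestors v \<le> Suc m"
    show "card (entering_walks v n) \<le> K' * (n + 1) ^ entering_exponent v" by (rule ent[OF v(2)])
    show "card (walks_to v n) \<le> K' * (n + 1) ^ walk_exponent v"
      using ent[OF v(2), of n] cyc[of v n] v(2) walks_to_noncyclic[of v n]
      by (cases "on_cycle v") (simp_all add: walk_exponent_def)
  qed
qed

lemma card_walks_bound:
  obtains K where "\<And>v n. v \<in> verts G \<Longrightarrow> card (walks_to v n) \<le> K * (n + 1) ^ walk_exponent v"
    "\<And>v n. v \<in> verts G \<Longrightarrow> card (entering_walks v n) \<le> K * (n + 1) ^ entering_exponent v"
proof -
  obtain K where K: "\<forall>v\<in>verts G. ancestors v \<le> card (verts G) \<longrightarrow> (\<forall>n.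
      card (walks_to v n) \<le> K * (n + 1) ^ walk_exponent v \<and>
      card (entering_walks v n) \<le> K * (n + 1) ^ entering_exponent v)"
    using card_walks_bound_aux by blast
  have "ancestors v \<le> card (verts G)" for v
    unfolding ancestors_def by (intro card_mono finite_verts) (auto intro: reachable_in_verts)
  with K show ?thesis using that by blast
qed

text \<open>
  The pairs \<open>(p, q)\<close> for which (CK2) does not shorten \<open>p q\<^sup>*\<close> by cancelling \<open>e e\<^sup>*\<close> in its middle.
\<close>
definition reduced_pairs :: "'a \<Rightarrow> nat \<Rightarrow> ('b list \<times> 'b list) set" where
  "reduced_pairs v n = {(p, q). p \<in> walks_to v n \<and> q \<in> walks_to v n \<and>
     \<not> (p \<noteq> [] \<and> q \<noteq> [] \<and> last p = last q \<and> out_arcs G (tail G (last p)) = {last p})}"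

lemma finite_reduced_pairs: "finite (reduced_pairs v n)"
  by (rule finite_subset[of _ "walks_to v n \<times> walks_to v n"])
    (auto simp: reduced_pairs_def finite_walks_to)

lemma card_prod_bound:
  fixes A :: "'x set" and B :: "'y set"
  assumes "card A \<le> K * (n + 1) ^ a" "card B \<le> K * (n + 1) ^ b" "a + b \<le> h"
  shows "card (A \<times> B) \<le> K * K * (n + 1) ^ h"
proof -
  have "card (A \<times> B) \<le> (K * (n + 1) ^ a) * (K * (n + 1) ^ b)"
    unfolding card_cartesian_product by (intro mult_mono assms) auto
  also have "\<dots> = K * K * (n + 1) ^ (a + b)" by (simp add: power_add mult_ac)
  also have "\<dots> \<le> K * K * (n + 1) ^ h" by (intro mult_left_mono power_increasing assms) auto
  finally show ?thesis .
qed

text \<open>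
  Let \<open>a\<close> be the entering exponent of \<open>v\<close>; then \<open>2 a\<close> is at most \<open>h\<close> minus the height below \<open>v\<close>.  Off the
  cycles this is enough.  On a cycle let \<open>f\<close> be its arrow into \<open>v\<close>.  If \<open>f\<close> is the only arrow leaving
  its source, one of the two walks of a reduced pair is entering, and \<open>2 a + 1 \<le> h\<close> since the height
  below \<open>v\<close> is at least 1.  Otherwise the cycle has an exit, so the height below \<open>v\<close> is at least 2,
  which makes room for \<open>2 a + 2\<close>.
\<close>
lemma card_reduced_pairs:
  obtains K where "\<And>v n. v \<in> verts G \<Longrightarrow> card (reduced_pairs v n) \<le> K * (n + 1) ^ H"
proof -
  obtain K where K: "\<And>v n. v \<in> verts G \<Longrightarrow> card (walks_to v n) \<le> K * (n + 1) ^ walk_exponent v"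
    and K': "\<And>v n. v \<in> verts G \<Longrightarrow> card (entering_walks v n) \<le> K * (n + 1) ^ entering_exponent v"
    using card_walks_bound by blast
  have "card (reduced_pairs v n) \<le> (2 * K * K) * (n + 1) ^ H" if v: "v \<in> verts G" for v n
  proof (cases "on_cycle v")
    case False
    have "reduced_pairs v n \<subseteq> walks_to v n \<times> walks_to v n" by (auto simp: reduced_pairs_def)
    then have "card (reduced_pairs v n) \<le> card (walks_to v n \<times> walks_to v n)"
      by (intro card_mono) (auto simp: finite_walks_to)
    also have "\<dots> \<le> K * K * (n + 1) ^ H"
      by (rule card_prod_bound[OF K[OF v] K[OF v]]) (use False in \<open>simp add: walk_exponent_def entering_exponent_def\<close>)
    finally show ?thesis by simp
  next
    case True
    then obtain f where f: "cyclic_arc f" "head G f = v" by (auto simp: on_cycle_def)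
    have fG: "f \<in> arcs G" using f by (simp add: cyclic_arc_def)
    have le: "height_from v \<le> H" by (rule height_from_le[OF v])
    have dbl: "2 * entering_exponent v \<le> H - height_from v" by (simp add: entering_exponent_def)
    have we: "walk_exponent v = entering_exponent v + 1" using True by (simp add: walk_exponent_def)
    show ?thesis
    proof (cases "out_arcs G (tail G f) = {f}")
      case True
      have "1 \<le> height_from v" using height_from_cyclic[OF f(1)] f(2) by simp
      then have exp: "entering_exponent v + walk_exponent v \<le> H"
        using le dbl we by linarith
      have "reduced_pairs v n \<subseteq> entering_walks v n \<times> walks_to v n \<union> walks_to v n \<times> entering_walks v n"
      proof (rule subrelI)
        fix p q assume pq: "(p, q) \<in> reduced_pairs v n"
        then have w: "p \<in> walks_to v n" "q \<in> walks_to v n" by (auto simp: reduced_pairs_def)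
        have "p \<in> entering_walks v n \<or> q \<in> entering_walks v n"
        proof (rule ccontr)
          assume "\<not> (p \<in> entering_walks v n \<or> q \<in> entering_walks v n)"
          then have c: "p \<noteq> []" "cyclic_arc (last p)" "q \<noteq> []" "cyclic_arc (last q)"
            using w by (auto simp: entering_walks_def)
          then have "last p = f" "last q = f"
            using walks_to_snoc[OF w(1)] walks_to_snoc[OF w(2)] f(2)
              cyclic_arcs_share_cycle[OF _ f(1)] by auto
          then show False using pq c True by (simp add: reduced_pairs_def)
        qed
        then show "(p, q) \<in> entering_walks v n \<times> walks_to v n \<union> walks_to v n \<times> entering_walks v n"
          using w by auto
      qed
      then have "card (reduced_pairs v n) \<le>
          card (entering_walks v n \<times> walks_to v n \<union> walks_to v n \<times> entering_walks v n)"
        by (intro card_mono) (auto simp: finite_walks_to finite_entering_walks)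
      also have "\<dots> \<le> card (entering_walks v n \<times> walks_to v n) + card (walks_to v n \<times> entering_walks v n)"
        by (rule card_Un_le)
      also have "\<dots> \<le> K * K * (n + 1) ^ H + K * K * (n + 1) ^ H"
        using exp by (intro add_mono card_prod_bound[OF K'[OF v] K[OF v]] card_prod_bound[OF K[OF v] K'[OF v]]) auto
      finally show ?thesis by (simp add: algebra_simps)
    next
      case False
      have "f \<in> out_arcs G (tail G f)" using fG by simp
      with False obtain g where "g \<in> out_arcs G (tail G f)" "g \<noteq> f" by blast
      then have g: "g \<in> arcs G" "tail G g = tail G f" "g \<noteq> f" by auto
      then have ncg: "\<not> cyclic_arc g" using cyclic_arcs_share_cycle[OF _ f(1)] by auto
      obtain f' where f': "cyclic_arc f'" "head G f' = tail G f"
        using on_cycle_tail[OF f(1)] by (auto simp: on_cycle_def)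
      have "2 \<le> height_from (tail G f)"
        using height_from_exit[OF g(1) ncg f'(1)] f'(2) g(2) by simp
      also have "\<dots> \<le> height_from v"
        using f by (intro height_from_mono) (auto simp: cyclic_arc_def)
      finally have "walk_exponent v + walk_exponent v \<le> H"
        using le dbl we by linarith
      have "reduced_pairs v n \<subseteq> walks_to v n \<times> walks_to v n" by (auto simp: reduced_pairs_def)
      then have "card (reduced_pairs v n) \<le> card (walks_to v n \<times> walks_to v n)"
        by (intro card_mono) (auto simp: finite_walks_to)
      also have "\<dots> \<le> K * K * (n + 1) ^ H"
        by (rule card_prod_bound[OF K[OF v] K[OF v]]) fact
      finally show ?thesis by simp
    qed
  qed
  then show ?thesis using that by blast
qed

end

section \<open>Spanning the Leavitt path algebra\<close>

definition lpa_rels :: "('v, 'e) pre_digraph \<Rightarrow> ('k::field, ('v, 'e) lpa_gen) free_algebra set" where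
  "lpa_rels G = lpa_rels_V G \<union> lpa_rels_E G \<union> lpa_rels_CK1 G \<union> lpa_rels_CK2 G"

text \<open>
  The argument \<open>field_type\<close> fixes the field of coefficients, which a digraph does not determine.
\<close>
locale leavitt = disjoint_cycles_digraph G for G :: "('v, 'e) pre_digraph" +
  fixes field_type :: "'k::field itself"
begin

abbreviation ideal :: "('k, ('v, 'e) lpa_gen) free_algebra set" where
  "ideal \<equiv> ideal_on (lpa_gens G) (lpa_rels G)"

definition congruent :: "('v, 'e) lpa_gen list \<Rightarrow> ('v, 'e) lpa_gen list \<Rightarrow> bool" where
  "congruent us vs \<longleftrightarrow> (word us - word vs :: ('k, ('v, 'e) lpa_gen) free_algebra) \<in> ideal"

notation congruent (infix "\<approx>" 50)

definition null :: "('v, 'e) lpa_gen list \<Rightarrow> bool" where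
  "null us \<longleftrightarrow> (word us :: ('k, ('v, 'e) lpa_gen) free_algebra) \<in> ideal"

lemma gens [simp]:
  "Vertex v \<in> lpa_gens G \<longleftrightarrow> v \<in> verts G"
  "Arrow a \<in> lpa_gens G \<longleftrightarrow> a \<in> arcs G"
  "Ghost a \<in> lpa_gens G \<longleftrightarrow> a \<in> arcs G"
  by (auto simp: lpa_gens_def)

lemma finite_gens: "finite (lpa_gens G)"
  by (simp add: lpa_gens_def)

lemma gen_mult_gen: "gen x * gen y = word [x, y]"
  by (simp add: word_Cons word_Nil)

lemma rels_free: "(lpa_rels G :: ('k, ('v, 'e) lpa_gen) free_algebra set) \<subseteq> free_on (lpa_gens G)"
  unfolding lpa_rels_def lpa_rels_V_def lpa_rels_E_def lpa_rels_CK1_def lpa_rels_CK2_def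
  by (auto intro!: free_on_diff free_on_mult free_on_gen free_on_sum free_on_zero)

lemma rel: "r \<in> lpa_rels G \<Longrightarrow> r \<in> ideal"
  by (rule ideal_on.base)

lemma vertex_vertex: "v \<in> verts G \<Longrightarrow> [Vertex v, Vertex v] \<approx> [Vertex v]"
  unfolding congruent_def
  by (rule rel) (auto simp: lpa_rels_def lpa_rels_V_def gen_mult_gen[symmetric] gen_eq_word[symmetric])

lemma vertex_vertex_null: "v \<in> verts G \<Longrightarrow> w \<in> verts G \<Longrightarrow> v \<noteq> w \<Longrightarrow> null [Vertex v, Vertex w]"
  unfolding null_def
  by (rule rel) (auto simp: lpa_rels_def lpa_rels_V_def gen_mult_gen[symmetric])

lemma E_rels:
  assumes "a \<in> arcs G"
  shows "[Vertex (tail G a), Arrow a] \<approx> [Arrow a]" "[Arrow a, Vertex (head G a)] \<approx> [Arrow a]"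
    "[Vertex (head G a), Ghost a] \<approx> [Ghost a]" "[Ghost a, Vertex (tail G a)] \<approx> [Ghost a]"
  using assms unfolding congruent_def
  by - (rule rel, force simp: lpa_rels_def lpa_rels_E_def gen_mult_gen[symmetric] gen_eq_word[symmetric])+

lemma ghost_arrow: "a \<in> arcs G \<Longrightarrow> [Ghost a, Arrow a] \<approx> [Vertex (head G a)]"
  unfolding congruent_def
  by (rule rel) (auto simp: lpa_rels_def lpa_rels_CK1_def gen_mult_gen[symmetric] gen_eq_word[symmetric])

lemma ghost_arrow_null: "a \<in> arcs G \<Longrightarrow> b \<in> arcs G \<Longrightarrow> a \<noteq> b \<Longrightarrow> null [Ghost a, Arrow b]"
  unfolding null_def
  by (rule rel) (auto simp: lpa_rels_def lpa_rels_CK1_def gen_mult_gen[symmetric])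

lemma congruent_refl [simp]: "us \<approx> us"
  by (simp add: congruent_def ideal_on.zero)

lemma congruent_sym: "us \<approx> vs \<Longrightarrow> vs \<approx> us"
  unfolding congruent_def using ideal_on.scale[of "word us - word vs" "lpa_gens G" "lpa_rels G" "-1"]
  by (simp add: scale_minus_one)

lemma congruent_trans [trans]: "us \<approx> vs \<Longrightarrow> vs \<approx> ws \<Longrightarrow> us \<approx> ws"
  unfolding congruent_def using ideal_on.add[of "word us - word vs" "lpa_gens G" "lpa_rels G" "word vs - word ws"]
  by simp

lemma null_congruent: "us \<approx> vs \<Longrightarrow> null vs \<Longrightarrow> null us"
  unfolding congruent_def null_def using ideal_on.add[of "word us - word vs" "lpa_gens G" "lpa_rels G" "word vs"]
  by simp

text \<open>
  The only use of (CK2) for the upper bound.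
\<close>
lemma sole_arc:
  assumes "out_arcs G v = {a}"
  shows "[Arrow a, Ghost a] \<approx> [Vertex v]"
proof (rule congruent_sym)
  have "a \<in> out_arcs G v" using assms by simp
  then have "v \<in> verts G" by auto
  then show "[Vertex v] \<approx> [Arrow a, Ghost a]"
    unfolding congruent_def using assms
    by (intro rel) (auto simp: lpa_rels_def lpa_rels_CK2_def gen_mult_gen[symmetric] gen_eq_word[symmetric]
        intro!: exI[of _ v])
qed

lemma congruent_context:
  assumes "us \<approx> vs" "set as \<subseteq> lpa_gens G" "set bs \<subseteq> lpa_gens G"
  shows "as @ us @ bs \<approx> as @ vs @ bs"
  using ideal_on_context[OF assms[unfolded congruent_def]] by (simp add: congruent_def word_append algebra_simps)

lemma null_context:
  assumes "null us" "set as \<subseteq> lpa_gens G" "set bs \<subseteq> lpa_gens G"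
  shows "null (as @ us @ bs)"
  using ideal_on_context[OF assms[unfolded null_def]] by (simp add: null_def word_append mult.assoc)

lemma vertex_arrow_null:
  assumes "v \<in> verts G" "a \<in> arcs G" "v \<noteq> tail G a"
  shows "null [Vertex v, Arrow a]"
proof (rule null_congruent)
  show "[Vertex v, Arrow a] \<approx> [Vertex v, Vertex (tail G a), Arrow a]"
    using congruent_context[OF congruent_sym[OF E_rels(1)], of a "[Vertex v]" "[]"] assms by simp
  show "null [Vertex v, Vertex (tail G a), Arrow a]"
    using null_context[OF vertex_vertex_null, of v "tail G a" "[]" "[Arrow a]"] assms by simp
qed

lemma arrow_vertex_null:
  assumes "v \<in> verts G" "a \<in> arcs G" "v \<noteq> head G a"
  shows "null [Arrow a, Vertex v]"
proof (rule null_congruent)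
  show "[Arrow a, Vertex v] \<approx> [Arrow a, Vertex (head G a), Vertex v]"
    using congruent_context[OF congruent_sym[OF E_rels(2)], of a "[]" "[Vertex v]"] assms by simp
  show "null [Arrow a, Vertex (head G a), Vertex v]"
    using null_context[OF vertex_vertex_null, of "head G a" v "[Arrow a]" "[]"] assms by simp
qed

lemma ghost_vertex_null:
  assumes "v \<in> verts G" "a \<in> arcs G" "v \<noteq> tail G a"
  shows "null [Ghost a, Vertex v]"
proof (rule null_congruent)
  show "[Ghost a, Vertex v] \<approx> [Ghost a, Vertex (tail G a), Vertex v]"
    using congruent_context[OF congruent_sym[OF E_rels(4)], of a "[]" "[Vertex v]"] assms by simp
  show "null [Ghost a, Vertex (tail G a), Vertex v]"
    using null_context[OF vertex_vertex_null, of "tail G a" v "[Ghost a]" "[]"] assms by simp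
qed

lemma vertex_ghost_null:
  assumes "v \<in> verts G" "a \<in> arcs G" "v \<noteq> head G a"
  shows "null [Vertex v, Ghost a]"
proof (rule null_congruent)
  show "[Vertex v, Ghost a] \<approx> [Vertex v, Vertex (head G a), Ghost a]"
    using congruent_context[OF congruent_sym[OF E_rels(3)], of a "[Vertex v]" "[]"] assms by simp
  show "null [Vertex v, Vertex (head G a), Ghost a]"
    using null_context[OF vertex_vertex_null, of v "head G a" "[]" "[Ghost a]"] assms by simp
qed

lemma arrow_arrow_null:
  assumes "a \<in> arcs G" "b \<in> arcs G" "head G a \<noteq> tail G b"
  shows "null [Arrow a, Arrow b]"
proof (rule null_congruent)
  show "[Arrow a, Arrow b] \<approx> [Arrow a, Vertex (head G a), Arrow b]"
    using congruent_context[OF congruent_sym[OF E_rels(2)], of a "[]" "[Arrow b]"] assms by simp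
  show "null [Arrow a, Vertex (head G a), Arrow b]"
    using null_context[OF vertex_arrow_null, of "head G a" b "[Arrow a]" "[]"] assms by simp
qed

definition unit :: "('k, ('v, 'e) lpa_gen) free_algebra" where
  "unit = (\<Sum>v\<in>verts G. gen (Vertex v))"

text \<open>
  In the product of a generator with the sum of all vertices a single summand survives modulo the ideal.
\<close>
lemma sum_vertices_absorb:
  fixes f :: "'v \<Rightarrow> ('k, ('v, 'e) lpa_gen) free_algebra"
  assumes u: "u \<in> verts G" and one: "f u - g \<in> ideal"
    and zero: "\<And>v. v \<in> verts G \<Longrightarrow> v \<noteq> u \<Longrightarrow> f v \<in> ideal"
  shows "(\<Sum>v\<in>verts G. f v) - g \<in> ideal"
proof -
  have sum: "(\<Sum>v\<in>S. f v) \<in> ideal" if "finite S" "S \<subseteq> verts G - {u}" for S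
    using that by (induction S) (auto intro: ideal_on.zero ideal_on.add zero)
  have "(\<Sum>v\<in>verts G. f v) - g = (f u - g) + (\<Sum>v\<in>verts G - {u}. f v)"
    using u by (simp add: sum.remove)
  also have "\<dots> \<in> ideal" using one sum[of "verts G - {u}"] by (intro ideal_on.add) auto
  finally show ?thesis .
qed

lemma unit_gen: "x \<in> lpa_gens G \<Longrightarrow> unit * gen x - gen x \<in> ideal"
proof -
  assume x: "x \<in> lpa_gens G"
  define u where "u = (case x of Vertex v \<Rightarrow> v | Arrow a \<Rightarrow> tail G a | Ghost a \<Rightarrow> head G a)"
  have "unit * gen x = (\<Sum>v\<in>verts G. word [Vertex v, x])"
    by (simp add: unit_def sum_distrib_right gen_mult_gen)
  moreover have "(\<Sum>v\<in>verts G. word [Vertex v, x]) - word [x] \<in> ideal"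
  proof (rule sum_vertices_absorb[of u])
    show "u \<in> verts G" using x by (cases x) (auto simp: u_def)
    show "word [Vertex u, x] - word [x] \<in> ideal"
      using x vertex_vertex E_rels by (cases x) (auto simp: u_def congruent_def)
    show "word [Vertex v, x] \<in> ideal" if "v \<in> verts G" "v \<noteq> u" for v
      using that x vertex_vertex_null vertex_arrow_null vertex_ghost_null
      by (cases x) (auto simp: u_def null_def)
  qed
  ultimately show ?thesis by (simp add: gen_eq_word)
qed

lemma gen_unit: "x \<in> lpa_gens G \<Longrightarrow> gen x * unit - gen x \<in> ideal"
proof -
  assume x: "x \<in> lpa_gens G"
  define u where "u = (case x of Vertex v \<Rightarrow> v | Arrow a \<Rightarrow> head G a | Ghost a \<Rightarrow> tail G a)"
  have "gen x * unit = (\<Sum>v\<in>verts G. word [x, Vertex v])"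
    by (simp add: unit_def sum_distrib_left gen_mult_gen)
  moreover have "(\<Sum>v\<in>verts G. word [x, Vertex v]) - word [x] \<in> ideal"
  proof (rule sum_vertices_absorb[of u])
    show "u \<in> verts G" using x by (cases x) (auto simp: u_def)
    show "word [x, Vertex u] - word [x] \<in> ideal"
      using x vertex_vertex E_rels by (cases x) (auto simp: u_def congruent_def)
    show "word [x, Vertex v] \<in> ideal" if "v \<in> verts G" "v \<noteq> u" for v
      using that x vertex_vertex_null arrow_vertex_null ghost_vertex_null
      by (cases x) (auto simp: u_def null_def)
  qed
  ultimately show ?thesis by (simp add: gen_eq_word)
qed

sublocale P: presented_unital "lpa_gens G" "lpa_rels G" unit
  by unfold_locales
    (use rels_free unit_gen gen_unit in \<open>auto simp: unit_def intro!: free_on_sum free_on_gen\<close>)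

lemma leavitt_path_algebra_eq: "leavitt_path_algebra G = P.A"
  by (simp add: leavitt_path_algebra_def lpa_rels_def unit_def)

subsection \<open>Reduced monomials span\<close>

definition path_monomial :: "'e list \<Rightarrow> 'v \<Rightarrow> 'e list \<Rightarrow> ('v, 'e) lpa_gen list" where
  "path_monomial p v q = map Arrow p @ Vertex v # map Ghost (rev q)"

definition is_walk_to :: "'e list \<Rightarrow> 'v \<Rightarrow> bool" where
  "is_walk_to p v \<longleftrightarrow> (\<exists>u. awalk u p v)"

lemma walk_to_gens:
  assumes "is_walk_to p v" "is_walk_to q v"
  shows "set (map Arrow p) \<subseteq> lpa_gens G" "set (map Ghost (rev q)) \<subseteq> lpa_gens G"
    "v \<in> verts G" "set (path_monomial p v q) \<subseteq> lpa_gens G"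
proof -
  obtain u where u: "awalk u p v" using assms(1) by (auto simp: is_walk_to_def)
  obtain w where w: "awalk w q v" using assms(2) by (auto simp: is_walk_to_def)
  show "v \<in> verts G" using u by (rule awalk_last_in_verts)
  moreover show "set (map Arrow p) \<subseteq> lpa_gens G" "set (map Ghost (rev q)) \<subseteq> lpa_gens G"
    using u w by (auto simp: awalk_def)
  ultimately show "set (path_monomial p v q) \<subseteq> lpa_gens G" by (auto simp: path_monomial_def)
qed

lemma vertex_path_monomial:
  assumes p: "awalk u p v" and q: "is_walk_to q v"
  shows "Vertex u # path_monomial p v q \<approx> path_monomial p v q"
proof (cases p)
  case Nil
  then have "u = v" "v \<in> verts G" using p by (auto simp: awalk_Nil_iff)
  then show ?thesis
    using congruent_context[OF vertex_vertex, of v "[]" "map Ghost (rev q)"] walk_to_gens[OF q q] Nil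
    by (simp add: path_monomial_def)
next
  case (Cons e p')
  then have "e \<in> arcs G" "tail G e = u" using p by (auto simp: awalk_Cons_iff)
  moreover have "is_walk_to p v" using p by (auto simp: is_walk_to_def)
  ultimately show ?thesis
    using congruent_context[OF E_rels(1), of e "[]" "map Arrow p' @ Vertex v # map Ghost (rev q)"]
      walk_to_gens[of p v q] q Cons by (simp add: path_monomial_def)
qed

definition normalizes :: "('v, 'e) lpa_gen list \<Rightarrow> nat \<Rightarrow> bool" where
  "normalizes ws n \<longleftrightarrow> null ws \<or> (\<exists>p v q. is_walk_to p v \<and> is_walk_to q v \<and>
      length p + length q \<le> n \<and> ws \<approx> path_monomial p v q)"

lemma normalizesI:
  "is_walk_to p v \<Longrightarrow> is_walk_to q v \<Longrightarrow> length p + length q \<le> n \<Longrightarrow> ws \<approx> path_monomial p v q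
    \<Longrightarrow> normalizes ws n"
  unfolding normalizes_def by blast

lemma normalizes_congruent:
  assumes c: "us \<approx> vs" and vs: "normalizes vs m" and mn: "m \<le> n"
  shows "normalizes us n"
proof (cases "null vs")
  case True
  then show ?thesis using null_congruent[OF c] by (simp add: normalizes_def)
next
  case False
  then obtain p v q where p: "is_walk_to p v" "is_walk_to q v" "length p + length q \<le> m"
    "vs \<approx> path_monomial p v q" using vs by (auto simp: normalizes_def)
  have "length p + length q \<le> n" using p(3) mn by simp
  then show ?thesis using p(1,2) congruent_trans[OF c p(4)] by (intro normalizesI)
qed

lemma normalizes_null_prefix:
  assumes "null [x, y]" "set zs \<subseteq> lpa_gens G"
  shows "normalizes (x # y # zs) n"
  using null_context[OF assms(1), of "[]" zs] assms(2) by (simp add: normalizes_def)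

text \<open>
  The rewriting step.  A vertex is absorbed, an arrow extends \<open>p\<close>, and a ghost arrow cancels the
  first arrow of \<open>p\<close> or, if \<open>p\<close> is trivial, extends \<open>q\<close>.  All products of mismatched letters vanish.
\<close>
lemma normalizes_Cons:
  assumes x: "x \<in> lpa_gens G" and p: "is_walk_to p v" and q: "is_walk_to q v"
  shows "normalizes (x # path_monomial p v q) (Suc (length p + length q))"
proof -
  note gens' = walk_to_gens[OF p q]
  have vG: "v \<in> verts G" by fact
  let ?Q = "map Ghost (rev q)"
  show ?thesis
  proof (cases x)
    case (Vertex w)
    then have w: "w \<in> verts G" using x by simp
    obtain u where u: "awalk u p v" using p by (auto simp: is_walk_to_def)
    show ?thesis
    proof (cases "w = u")
      case True
      then show ?thesis
        using vertex_path_monomial[OF u q] Vertex p q by (intro normalizesI[of p v q]) auto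
    next
      case False
      show ?thesis
      proof (cases p)
        case Nil
        then have "u = v" using u by (simp add: awalk_Nil_iff)
        then show ?thesis
          using normalizes_null_prefix[OF vertex_vertex_null[OF w vG], of ?Q] False Vertex Nil gens'
          by (simp add: path_monomial_def)
      next
        case (Cons e p')
        then have "e \<in> arcs G" "tail G e = u" using u by (auto simp: awalk_Cons_iff)
        then show ?thesis
          using normalizes_null_prefix[OF vertex_arrow_null[OF w], of e "map Arrow p' @ Vertex v # ?Q"]
            False Vertex Cons gens' by (simp add: path_monomial_def)
      qed
    qed
  next
    case (Arrow f)
    then have f: "f \<in> arcs G" using x by simp
    obtain u where u: "awalk u p v" using p by (auto simp: is_walk_to_def)
    show ?thesis
    proof (cases "head G f = u")
      case True
      then have "is_walk_to (f # p) v" using f u by (auto simp: is_walk_to_def awalk_Cons_iff)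
      then show ?thesis
        using q Arrow by (intro normalizesI[of "f # p" v q]) (auto simp: path_monomial_def)
    next
      case False
      show ?thesis
      proof (cases p)
        case Nil
        then have "u = v" using u by (simp add: awalk_Nil_iff)
        then show ?thesis
          using normalizes_null_prefix[OF arrow_vertex_null[OF vG f], of ?Q] False Arrow Nil gens'
          by (simp add: path_monomial_def)
      next
        case (Cons e p')
        then have "e \<in> arcs G" "tail G e = u" using u by (auto simp: awalk_Cons_iff)
        then show ?thesis
          using normalizes_null_prefix[OF arrow_arrow_null[OF f], of e "map Arrow p' @ Vertex v # ?Q"]
            False Arrow Cons gens' by (simp add: path_monomial_def)
      qed
    qed
  next
    case (Ghost f)
    then have f: "f \<in> arcs G" using x by simp
    show ?thesis
    proof (cases p)
      case Nil
      show ?thesis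
      proof (cases "v = tail G f")
        case True
        obtain u where "awalk u q (tail G f)" using q True by (auto simp: is_walk_to_def)
        moreover have "awalk (tail G f) [f] (head G f)" using f by (simp add: awalk_Cons_iff awalk_Nil_iff)
        ultimately have "awalk u (q @ [f]) (head G f)" by (rule awalk_appendI)
        then have "is_walk_to (q @ [f]) (head G f)" unfolding is_walk_to_def by blast
        moreover have "is_walk_to [] (head G f)" using f by (auto simp: is_walk_to_def awalk_Nil_iff)
        moreover have "Ghost f # Vertex v # ?Q \<approx> Ghost f # ?Q"
          using congruent_context[OF E_rels(4)[OF f], of "[]" ?Q] gens' True by simp
        moreover have "Ghost f # ?Q \<approx> Vertex (head G f) # Ghost f # ?Q"
          using congruent_context[OF congruent_sym[OF E_rels(3)[OF f]], of "[]" ?Q] gens' by simp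
        ultimately show ?thesis
          using Ghost Nil
          by (intro normalizesI[of "[]" "head G f" "q @ [f]"]) (auto simp: path_monomial_def intro: congruent_trans)
      next
        case False
        then show ?thesis
          using normalizes_null_prefix[OF ghost_vertex_null[OF vG f], of ?Q] Ghost Nil gens'
          by (simp add: path_monomial_def)
      qed
    next
      case (Cons e p')
      then have e: "e \<in> arcs G" and p': "awalk (head G e) p' v"
        using p by (auto simp: is_walk_to_def awalk_Cons_iff)
      show ?thesis
      proof (cases "f = e")
        case True
        have "x # path_monomial p v q \<approx> Vertex (head G e) # path_monomial p' v q"
          using congruent_context[OF ghost_arrow[OF e], of "[]" "map Arrow p' @ Vertex v # ?Q"] gens' Cons Ghost True
          by (simp add: path_monomial_def)
        also have "\<dots> \<approx> path_monomial p' v q" by (rule vertex_path_monomial[OF p' q])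
        finally show ?thesis
          using p' q Cons by (intro normalizesI[of p' v q]) (auto simp: is_walk_to_def)
      next
        case False
        then show ?thesis
          using normalizes_null_prefix[OF ghost_arrow_null[OF f e], of "map Arrow p' @ Vertex v # ?Q"]
            Ghost Cons gens' by (simp add: path_monomial_def)
      qed
    qed
  qed
qed

lemma normalizes_word: "ws \<noteq> [] \<Longrightarrow> set ws \<subseteq> lpa_gens G \<Longrightarrow> normalizes ws (length ws)"
proof (induction ws rule: list_nonempty_induct)
  case (single x)
  show ?case
  proof (cases x)
    case (Vertex v)
    then show ?thesis using single
      by (intro normalizesI[of "[]" v "[]"]) (auto simp: is_walk_to_def path_monomial_def awalk_Nil_iff)
  next
    case (Arrow a)
    then show ?thesis using single E_rels(2)[of a]
      by (intro normalizesI[of "[a]" "head G a" "[]"])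
        (auto simp: is_walk_to_def path_monomial_def awalk_Nil_iff awalk_Cons_iff intro: congruent_sym)
  next
    case (Ghost a)
    then show ?thesis using single E_rels(3)[of a]
      by (intro normalizesI[of "[]" "head G a" "[a]"])
        (auto simp: is_walk_to_def path_monomial_def awalk_Nil_iff awalk_Cons_iff intro: congruent_sym)
  qed
next
  case (cons x ws)
  then have x: "x \<in> lpa_gens G" and ws: "set ws \<subseteq> lpa_gens G" and "normalizes ws (length ws)" by auto
  then consider "null ws" | p v q where "is_walk_to p v" "is_walk_to q v"
    "length p + length q \<le> length ws" "ws \<approx> path_monomial p v q"
    unfolding normalizes_def by blast
  then show ?case
  proof cases
    case 1
    then show ?thesis using null_context[of ws "[x]" "[]"] x by (simp add: normalizes_def)
  next
    case 2
    have c: "x # ws \<approx> x # path_monomial p v q"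
      using congruent_context[OF 2(4), of "[x]" "[]"] x by simp
    have "normalizes (x # path_monomial p v q) (Suc (length p + length q))"
      by (rule normalizes_Cons[OF x 2(1,2)])
    then show ?thesis using 2(3) by (intro normalizes_congruent[OF c]) auto
  qed
qed

text \<open>
  Cancel \<open>e e\<^sup>*\<close> in the middle, with \<open>e\<close> the only arrow leaving its source, as long as possible.
\<close>
lemma path_monomial_reduce:
  assumes "is_walk_to p v" "is_walk_to q v" "length p \<le> n" "length q \<le> n"
  shows "\<exists>v' p' q'. v' \<in> verts G \<and> (p', q') \<in> reduced_pairs v' n \<and>
     path_monomial p v q \<approx> path_monomial p' v' q'"
  using assms
proof (induction p arbitrary: v q rule: rev_induct)
  case Nil
  then have "[] \<in> walks_to v n" "q \<in> walks_to v n" by (simp_all add: walks_to_def is_walk_to_def)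
  then have "([], q) \<in> reduced_pairs v n" by (simp add: reduced_pairs_def)
  then show ?case using walk_to_gens(3)[OF Nil(1,2)] congruent_refl by blast
next
  case (snoc e p)
  note gens' = walk_to_gens[OF snoc.prems(1,2)]
  show ?case
  proof (cases "q \<noteq> [] \<and> last q = e \<and> out_arcs G (tail G e) = {e}")
    case False
    have "p @ [e] \<in> walks_to v n" "q \<in> walks_to v n"
      using snoc.prems by (simp_all add: walks_to_def is_walk_to_def)
    then have "(p @ [e], q) \<in> reduced_pairs v n"
      unfolding reduced_pairs_def using False by auto
    then show ?thesis using gens'(3) congruent_refl by blast
  next
    case True
    then obtain r where q: "q = r @ [e]" by (cases q rule: rev_cases) auto
    have e: "e \<in> arcs G" "head G e = v" and p: "is_walk_to p (tail G e)" and r: "is_walk_to r (tail G e)"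
      using snoc.prems q by (auto simp: is_walk_to_def awalk_Cons_iff awalk_Nil_iff)
    have g: "set (map Arrow p) \<subseteq> lpa_gens G" "set (map Ghost (rev r)) \<subseteq> lpa_gens G"
      using walk_to_gens[OF p r] by auto
    have "path_monomial (p @ [e]) v q = map Arrow p @ [Arrow e, Vertex v] @ Ghost e # map Ghost (rev r)"
      by (simp add: path_monomial_def q)
    also have "\<dots> \<approx> map Arrow p @ [Arrow e] @ Ghost e # map Ghost (rev r)"
      using E_rels(2)[OF e(1)] e g by (intro congruent_context) auto
    also have "map Arrow p @ [Arrow e] @ Ghost e # map Ghost (rev r) =
        map Arrow p @ [Arrow e, Ghost e] @ map Ghost (rev r)" by simp
    also have "\<dots> \<approx> map Arrow p @ [Vertex (tail G e)] @ map Ghost (rev r)"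
      using True g by (intro congruent_context sole_arc) auto
    also have "\<dots> = path_monomial p (tail G e) r" by (simp add: path_monomial_def)
    finally have c: "path_monomial (p @ [e]) v q \<approx> path_monomial p (tail G e) r" .
    obtain v' p' q' where "v' \<in> verts G" "(p', q') \<in> reduced_pairs v' n"
      and c': "path_monomial p (tail G e) r \<approx> path_monomial p' v' q'"
      using snoc.IH[OF p r] snoc.prems q by auto
    moreover have "path_monomial (p @ [e]) v q \<approx> path_monomial p' v' q'" using c c' by (rule congruent_trans)
    ultimately show ?thesis by (intro exI conjI)
  qed
qed

definition reduced_words :: "nat \<Rightarrow> ('v, 'e) lpa_gen list set" where
  "reduced_words n = (\<Union>v\<in>verts G. (\<lambda>(p, q). path_monomial p v q) ` reduced_pairs v n)"

lemma word_reduces: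
  assumes "ws \<noteq> []" "set ws \<subseteq> lpa_gens G" "length ws \<le> n"
  shows "null ws \<or> (\<exists>us\<in>reduced_words n. ws \<approx> us)"
proof (cases "null ws")
  case False
  then obtain p v q where "is_walk_to p v" "is_walk_to q v"
    "length p + length q \<le> length ws" and c: "ws \<approx> path_monomial p v q"
    using normalizes_word[OF assms(1,2)] unfolding normalizes_def by blast
  then obtain v' p' q' where r: "v' \<in> verts G" "(p', q') \<in> reduced_pairs v' n"
     "path_monomial p v q \<approx> path_monomial p' v' q'"
    using path_monomial_reduce[of p v q n] assms(3) by auto
  have "path_monomial p' v' q' \<in> reduced_words n"
    unfolding reduced_words_def using r(1,2) by (intro UN_I[of v'] image_eqI[of _ _ "(p', q')"]) auto
  moreover have "ws \<approx> path_monomial p' v' q'" using c r(3) by (rule congruent_trans)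
  ultimately show ?thesis by (intro disjI2 bexI)
qed simp

lemma reduced_words_gens: "us \<in> reduced_words n \<Longrightarrow> us \<noteq> [] \<and> set us \<subseteq> lpa_gens G"
proof -
  assume "us \<in> reduced_words n"
  then obtain v p q where us: "us = path_monomial p v q" and "(p, q) \<in> reduced_pairs v n"
    by (auto simp: reduced_words_def)
  then have "is_walk_to p v" "is_walk_to q v"
    by (simp_all add: reduced_pairs_def walks_to_def is_walk_to_def)
  then show ?thesis using walk_to_gens(4)[of p v q] us by (simp add: path_monomial_def)
qed

lemma card_reduced_words:
  obtains C where "\<And>n. n \<ge> 1 \<Longrightarrow> card (reduced_words n) \<le> C * n ^ H"
proof -
  obtain K where K: "\<And>v n. v \<in> verts G \<Longrightarrow> card (reduced_pairs v n) \<le> K * (n + 1) ^ H"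
    using card_reduced_pairs by blast
  have "card (reduced_words n) \<le> (card (verts G) * K * 2 ^ H) * n ^ H" if n: "n \<ge> 1" for n
  proof -
    have "card (reduced_words n) \<le> (\<Sum>v\<in>verts G. card ((\<lambda>(p, q). path_monomial p v q) ` reduced_pairs v n))"
      unfolding reduced_words_def by (rule card_UN_le) simp
    also have "\<dots> \<le> (\<Sum>v\<in>verts G. K * (2 * n) ^ H)"
    proof (rule sum_mono)
      fix v assume v: "v \<in> verts G"
      have "card ((\<lambda>(p, q). path_monomial p v q) ` reduced_pairs v n) \<le> card (reduced_pairs v n)"
        by (rule card_image_le[OF finite_reduced_pairs])
      also have "\<dots> \<le> K * (n + 1) ^ H" by (rule K[OF v])
      also have "\<dots> \<le> K * (2 * n) ^ H" using n by (intro mult_left_mono power_mono) auto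
      finally show "card ((\<lambda>(p, q). path_monomial p v q) ` reduced_pairs v n) \<le> K * (2 * n) ^ H" .
    qed
    also have "\<dots> = (card (verts G) * K * 2 ^ H) * n ^ H" by (simp add: power_mult_distrib)
    finally show ?thesis .
  qed
  then show ?thesis using that by blast
qed

lemma finite_reduced_words: "finite (reduced_words n)"
  unfolding reduced_words_def using finite_reduced_pairs by auto

abbreviation "cls_word ws \<equiv> P.cls (word ws)"
abbreviation "gen_classes \<equiv> (\<lambda>x. P.cls (gen x)) ` lpa_gens G"

text \<open>
  The empty monomial is the unit.  It lies in the span as a sum of vertices, which have length 1;
  this is where \<open>n \<ge> 1\<close> enters.
\<close>
lemma monomials_in_reduced_span:
  assumes n: "n \<ge> 1"
  shows "P.A.monomials gen_classes n \<subseteq> P.A.span (cls_word ` reduced_words n)"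
proof
  let ?S = "P.A.span (cls_word ` reduced_words n)"
  have Tc: "cls_word ` reduced_words n \<subseteq> carrier P.A"
    using reduced_words_gens by (auto intro!: P.cls_closed free_on_word)
  have sub: "submodule class_ring ?S P.A" by (rule P.A.span_is_submodule[OF Tc])
  have own: "cls_word ` reduced_words n \<subseteq> ?S" by (rule P.A.in_own_span[OF Tc])
  have zero: "P.cls 0 \<in> ?S" using sub by (simp add: submodule_def P.zero_A[symmetric])
  have words: "cls_word ws \<in> ?S" if "ws \<noteq> []" "set ws \<subseteq> lpa_gens G" "length ws \<le> n" for ws
    using word_reduces[OF that]
  proof
    assume "null ws"
    then have "cls_word ws = P.cls 0" by (simp add: null_def P.cls_eq_iff)
    then show ?thesis using zero by simp
  next
    assume "\<exists>us\<in>reduced_words n. ws \<approx> us"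
    then obtain us where us: "us \<in> reduced_words n" "ws \<approx> us" by blast
    then have "cls_word ws = cls_word us" by (simp add: congruent_def P.cls_eq_iff)
    then show ?thesis using us own by auto
  qed
  have unit: "P.cls unit \<in> ?S"
  proof -
    have "P.cls (\<Sum>v\<in>V. gen (Vertex v)) \<in> ?S" if "finite V" "V \<subseteq> verts G" for V
      using that
    proof (induction V)
      case empty
      then show ?case using zero by simp
    next
      case (insert v V)
      have "P.cls (gen (Vertex v)) \<in> ?S"
        using words[of "[Vertex v]"] n insert by (simp add: gen_eq_word)
      then have "P.cls (gen (Vertex v)) \<oplus>\<^bsub>P.A\<^esub> P.cls (\<Sum>v\<in>V. gen (Vertex v)) \<in> ?S"
        using insert sub by (simp add: submodule_def)
      then show ?case using insert by (simp add: P.add_A)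
    qed
    then show ?thesis by (simp add: unit_def)
  qed
  fix x assume "x \<in> P.A.monomials gen_classes n"
  then obtain xs where xs: "x = P.A.monomial xs" "set xs \<subseteq> gen_classes" "length xs \<le> n"
    by (auto simp: P.A.monomials_def)
  have "xs \<in> map (\<lambda>x. P.cls (gen x)) ` lists (lpa_gens G)"
    unfolding lists_image[symmetric] using xs(2) by (simp add: lists_eq_set)
  then obtain ws where ws: "xs = map (\<lambda>x. P.cls (gen x)) ws" "set ws \<subseteq> lpa_gens G"
    by (auto simp: lists_eq_set)
  show "x \<in> ?S"
  proof (cases "ws = []")
    case True
    then show ?thesis using xs ws unit by (simp add: P.one_A)
  next
    case False
    then show ?thesis using xs ws words[of ws] by (simp add: P.monomial_cls)
  qed
qed

end

section \<open>Counting maximal paths from below\<close>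

text \<open>
  Maximal paths are infinite sequences, padded by \<^const>\<open>None\<close> after the end of a path into a sink.  So
  finite and infinite maximal paths are treated alike.
\<close>
definition prepend :: "'e list \<Rightarrow> (nat \<Rightarrow> 'e option) \<Rightarrow> (nat \<Rightarrow> 'e option)" where
  "prepend p y n = (if n < length p then Some (p ! n) else y (n - length p))"

lemma prepend_Nil [simp]: "prepend [] y = y"
  by (simp add: prepend_def fun_eq_iff)

lemma prepend_append: "prepend (p @ q) y = prepend p (prepend q y)"
  by (auto simp: prepend_def fun_eq_iff nth_append)

lemma prepend_Cons: "prepend (e # p) y = prepend [e] (prepend p y)"
  using prepend_append[of "[e]" p y] by simp

lemma prepend_shift: "prepend p y (n + length p) = y n"
  by (simp add: prepend_def)

lemma prepend_inject: "prepend p y = prepend p z \<longleftrightarrow> y = z"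
proof
  assume eq: "prepend p y = prepend p z"
  show "y = z"
  proof
    fix n show "y n = z n" using prepend_shift[of p y n] prepend_shift[of p z n] eq by simp
  qed
qed simp

definition end_point :: "'e list \<Rightarrow> nat \<Rightarrow> 'e option" where
  "end_point c = (if c = [] then (\<lambda>_. None) else (\<lambda>n. Some (c ! (n mod length c))))"

lemma prepend_end_point: "prepend c (end_point c) = end_point c"
  by (auto simp: prepend_def end_point_def fun_eq_iff le_mod_geq)

abbreviation list_power :: "'e list \<Rightarrow> nat \<Rightarrow> 'e list" where
  "list_power s n \<equiv> concat (replicate n s)"

lemma length_list_power: "length (list_power s n) = n * length s"
  by (induction n) auto

lemma prepend_power_end_point: "prepend (list_power c n) (end_point c) = end_point c"
  by (induction n) (simp_all add: prepend_append prepend_end_point)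

lemma (in wf_digraph) awalk_power: "awalk u s u \<Longrightarrow> awalk u (list_power s n) u"
proof (induction n)
  case 0
  then show ?case using awalk_hd_in_verts by (auto simp: awalk_Nil_iff)
next
  case (Suc n)
  then show ?case by (auto intro: awalk_appendI)
qed

text \<open>
  The first place where the sequences differ from the periodic sequence of \<open>s\<close> shows how
  often \<open>s\<close> was run through.
\<close>
lemma prepend_power_inject:
  assumes s: "s \<noteq> []" "hd s \<noteq> e"
    and eq: "prepend (list_power s a) (prepend [e] y) = prepend (list_power s b) (prepend [e] z)"
  shows "a = b \<and> y = z"
proof -
  have *: "\<not> a < b" if eq: "prepend (list_power s a) (prepend [e] y) = prepend (list_power s b) (prepend [e] z)"
    for a b :: nat and y z
  proof
    assume "a < b"
    then have "b = a + Suc (b - a - 1)" by simp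
    then have "list_power s b = list_power s a @ s @ list_power s (b - a - 1)"
      by (metis concat.simps(2) concat_append replicate_Suc replicate_add)
    then have "prepend [e] y = prepend s (prepend (list_power s (b - a - 1)) (prepend [e] z))"
      using eq by (simp add: prepend_append prepend_inject)
    from fun_cong[OF this, of 0] show False using s by (simp add: prepend_def hd_conv_nth)
  qed
  from *[OF eq] *[OF eq[symmetric]] have "a = b" by simp
  with eq show ?thesis by (simp add: prepend_inject)
qed

context wf_digraph
begin

text \<open>
  Counting the sequences rather than the walks \<open>p\<close> identifies walks that differ only by
  full rounds \<open>c\<close> at their end.  These rounds are counted separately, by the exponent of \<open>c\<close>.
\<close>
definition points :: "'b list \<Rightarrow> 'a \<Rightarrow> 'a \<Rightarrow> nat \<Rightarrow> (nat \<Rightarrow> 'b option) set" where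
  "points c w v n = {prepend p (end_point c) | p. awalk v p w \<and> length p \<le> n}"

text \<open>
  Stating the growth at multiples of \<open>m\<close> replaces the constant factor of a polynomial bound
  and keeps all counting within the natural numbers.
\<close>
definition points_grow :: "'b list \<Rightarrow> 'a \<Rightarrow> 'a \<Rightarrow> nat \<Rightarrow> bool" where
  "points_grow c w v k \<longleftrightarrow> (\<exists>m\<ge>1. \<forall>n\<ge>1. n ^ k \<le> card (points c w v (m * n)))"

text \<open>A sink, with the trivial walk, or a vertex on a cycle that cannot be left, with the walk
  around that cycle.\<close>
definition terminal :: "'a \<Rightarrow> 'b list \<Rightarrow> bool" where
  "terminal w c \<longleftrightarrow> awalk w c w \<and> (\<forall>e\<in>set c. out_arcs G (tail G e) = {e}) \<and>
     (c = [] \<longrightarrow> out_arcs G w = {})"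

end

context fin_digraph
begin

lemma finite_points: "finite (points c w v n)"
proof -
  have "points c w v n \<subseteq> (\<lambda>p. prepend p (end_point c)) ` {p. set p \<subseteq> arcs G \<and> length p \<le> n}"
    by (auto simp: points_def awalk_def)
  then show ?thesis by (rule finite_subset) (simp add: finite_lists_length_le)
qed

lemma points_grow_base:
  assumes "w \<in> verts G" shows "points_grow c w w 0"
proof -
  have "card (points c w w (1 * n)) \<ge> 1" for n
  proof -
    have "end_point c \<in> points c w w (1 * n)"
      unfolding points_def using assms by (intro CollectI exI[of _ "[]"]) (simp add: awalk_Nil_iff)
    then have "card (points c w w (1 * n)) \<noteq> 0" using finite_points by auto
    then show ?thesis by simp
  qed
  then show ?thesis unfolding points_grow_def by (intro exI[of _ 1]) simp
qed

lemma points_grow_reachable: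
  assumes uv: "u \<rightarrow>\<^sup>* v" and g: "points_grow c w v k"
  shows "points_grow c w u k"
proof -
  obtain g where g': "awalk u g v" using uv reachable_awalk by blast
  obtain m where m: "m \<ge> 1" "\<And>n. n \<ge> 1 \<Longrightarrow> n ^ k \<le> card (points c w v (m * n))"
    using g unfolding points_grow_def by blast
  have "n ^ k \<le> card (points c w u ((m + length g) * n))" if n: "n \<ge> 1" for n
  proof -
    have "prepend g ` points c w v (m * n) \<subseteq> points c w u ((m + length g) * n)"
    proof
      fix y assume "y \<in> prepend g ` points c w v (m * n)"
      then obtain p where p: "y = prepend (g @ p) (end_point c)" "awalk v p w" "length p \<le> m * n"
        by (auto simp: points_def prepend_append)
      have "length g \<le> length g * n" using n by simp
      then have "length (g @ p) \<le> (m + length g) * n"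
        using p(3) unfolding add_mult_distrib length_append by linarith
      moreover have "awalk u (g @ p) w" using g' p(2) by (rule awalk_appendI)
      ultimately show "y \<in> points c w u ((m + length g) * n)" using p(1) unfolding points_def by auto
    qed
    then have "card (prepend g ` points c w v (m * n)) \<le> card (points c w u ((m + length g) * n))"
      by (intro card_mono finite_points)
    moreover have "card (prepend g ` points c w v (m * n)) = card (points c w v (m * n))"
      by (intro card_image) (simp add: inj_on_def prepend_inject)
    ultimately show ?thesis using m(2)[OF n] by simp
  qed
  then show ?thesis unfolding points_grow_def using m(1) by (intro exI[of _ "m + length g"]) simp
qed

text \<open>
  One more free parameter: the number of rounds \<open>s\<close> before leaving through \<open>e\<close>.
\<close>
lemma points_grow_cycle:
  assumes s: "awalk u s u" "s \<noteq> []" "hd s \<noteq> e" and e: "e \<in> arcs G" "tail G e = u"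
    and g: "points_grow c w (head G e) k"
  shows "points_grow c w u (Suc k)"
proof -
  obtain m where m: "m \<ge> 1" "\<And>n. n \<ge> 1 \<Longrightarrow> n ^ k \<le> card (points c w (head G e) (m * n))"
    using g unfolding points_grow_def by blast
  \<comment> \<open>\<open>n\<close> rounds \<open>s\<close>, the exit, and a walk of length \<open>m * n\<close>; the summand 1 pays for the exit since \<open>n \<ge> 1\<close>.\<close>
  define M where "M = m + length s + 1"
  have "n ^ Suc k \<le> card (points c w u (M * n))" if n: "n \<ge> 1" for n
  proof -
    let ?f = "\<lambda>(a, y). prepend (list_power s a) (prepend [e] y)"
    let ?D = "{..<n} \<times> points c w (head G e) (m * n)"
    have "?f ` ?D \<subseteq> points c w u (M * n)"
    proof
      fix x assume "x \<in> ?f ` ?D"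
      then obtain a p where x: "x = prepend (list_power s a) (prepend [e] (prepend p (end_point c)))"
        and p: "a < n" "awalk (head G e) p w" "length p \<le> m * n"
        by (auto simp: points_def)
      have x': "x = prepend (list_power s a @ [e] @ p) (end_point c)"
        by (simp only: x prepend_append)
      have "awalk u (e # p) w" using e p(2) by (simp add: awalk_Cons_iff)
      then have "awalk u (list_power s a @ [e] @ p) w"
        using awalk_appendI[OF awalk_power[OF s(1)]] by simp
      moreover have "length (list_power s a @ [e] @ p) \<le> M * n"
      proof -
        have "a * length s \<le> n * length s" using p(1) by simp
        moreover have "length (list_power s a @ [e] @ p) = a * length s + 1 + length p"
          by (simp add: length_list_power)
        moreover have "M * n = m * n + n * length s + n" by (simp add: M_def algebra_simps)
        ultimately show ?thesis using p(3) n by linarith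
      qed
      ultimately show "x \<in> points c w u (M * n)" using x' unfolding points_def by blast
    qed
    then have "card (?f ` ?D) \<le> card (points c w u (M * n))" by (intro card_mono finite_points)
    moreover have "card (?f ` ?D) = card ?D"
    proof (intro card_image inj_onI)
      fix x y assume "?f x = ?f y"
      then show "x = y" using prepend_power_inject[OF s(2,3), of "fst x" "snd x" "fst y" "snd y"]
        by (simp add: case_prod_unfold prod_eq_iff)
    qed
    moreover have "n ^ Suc k \<le> card ?D"
      using m(2)[OF n] by (simp add: card_cartesian_product)
    ultimately show ?thesis by linarith
  qed
  then show ?thesis unfolding points_grow_def by (intro exI[of _ M]) (simp add: M_def)
qed

end

context disjoint_cycles_digraph
begin

lemma cycle_walk_at:
  assumes C: "C \<in> cycles G" and u: "u \<in> cycle_verts G C"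
  obtains g p where "awalk u (g # p) u" "set (g # p) = cycle_arcs C"
proof -
  obtain g where g: "g \<in> cycle_arcs C" "u = tail G g"
    using u unfolding cycle_verts_def by (rule imageE)
  obtain p where p: "cycle (g # p)" "awalk (tail G g) (g # p) (tail G g)"
    using cycle_through_cyclic_arc[OF cycle_arc_cyclic[OF C g(1)]] by metis
  let ?C = "range (\<lambda>n. rotate n (g # p))"
  have "?C \<in> cycles G" "cycle_arcs ?C = set (g # p)"
    using p(1) by (auto simp: cycles_def cycle_arcs_rotations)
  moreover from this have "?C = C"
    using cycles_eqI[of ?C C u] C u g(2) by (simp add: cycle_verts_def)
  ultimately have "set (g # p) = cycle_arcs C" by simp
  then show ?thesis using that p(2) g(2) by simp
qed

text \<open>
  Descend from \<open>x\<close> through exits, always to a sink or cycle of the largest height, until a sink or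
  a cycle without exit is reached.
\<close>
lemma points_grow_height:
  "x \<in> SC \<Longrightarrow> v \<in> verts_of G x \<Longrightarrow>
     \<exists>w c k. terminal w c \<and> points_grow c w v k \<and> height_of G x = 2 * k + (if c = [] then 0 else 1)"
proof (induction "height_of G x" arbitrary: x v rule: less_induct)
  case less
  show ?case
  proof (cases x)
    case (Sink a)
    then have "v \<in> sinks G" using less.prems by (auto simp: sinks_and_cycles_def)
    then have "v \<in> verts G" "terminal v []" by (auto simp: terminal_def sinks_def awalk_Nil_iff)
    then show ?thesis
      using points_grow_base[of v "[]"] Sink by (intro exI[of _ v] exI[of _ "[]"] exI[of _ 0]) simp
  next
    case (Cycle C)
    then have C: "C \<in> cycles G" and v: "v \<in> cycle_verts G C"
      using less.prems by (auto simp: sinks_and_cycles_def)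
    show ?thesis
    proof (cases "exits G C = {}")
      case True
      obtain g p where gp: "awalk v (g # p) v" "set (g # p) = cycle_arcs C"
        using C v by (rule cycle_walk_at)
      have "out_arcs G (tail G f) = {f}" if f: "f \<in> cycle_arcs C" for f
      proof -
        have "f \<in> arcs G" using f cycle_arcs_in_arcs[OF C] by auto
        moreover have "h = f" if h: "h \<in> arcs G" "tail G h = tail G f" for h
        proof -
          have "tail G h \<in> cycle_verts G C" using cycle_head_in_verts(2)[OF C f] h(2) by simp
          then have "cyclic_arc h" using exits_iff[OF C, of h] True h(1) by simp
          then show ?thesis using cyclic_arcs_share_cycle cycle_arc_cyclic[OF C f] h(2) by simp
        qed
        ultimately show ?thesis by auto
      qed
      then have "terminal v (g # p)" unfolding terminal_def gp(2) using gp(1) by simp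
      moreover have "v \<in> verts G" using gp(1) by (rule awalk_hd_in_verts)
      ultimately show ?thesis
        using points_grow_base[of v "g # p"] height_of_no_exit[OF True] Cycle
        by (intro exI[of _ v] exI[of _ "g # p"] exI[of _ 0]) simp
    next
      case False
      obtain y where y: "(y, Cycle C) \<in> strictly_below G" "height_of G (Cycle C) = 2 + height_of G y"
        using C False by (rule height_of_attained)
      obtain e v' where e: "e \<in> exits G C" "v' \<in> verts_of G y" "head G e \<rightarrow>\<^sup>* v'"
        using y(1) by (rule below_imp_exit)
      have e': "e \<in> arcs G" "\<not> cyclic_arc e" "tail G e \<in> cycle_verts G C"
        using e(1) exits_iff[OF C] by auto
      have "y \<in> SC" using y(1) by (simp add: strictly_below_def)
      then obtain w c k where wck: "terminal w c" "points_grow c w v' k"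
        "height_of G y = 2 * k + (if c = [] then 0 else 1)"
        using less.hyps[of y v'] y(2) e(2) Cycle by auto
      obtain g p where gp: "awalk (tail G e) (g # p) (tail G e)" "set (g # p) = cycle_arcs C"
        using C e'(3) by (rule cycle_walk_at)
      have "g \<in> cycle_arcs C" using gp(2) by auto
      then have "g \<noteq> e" using cycle_arc_cyclic[OF C] e'(2) by auto
      then have "points_grow c w (tail G e) (Suc k)"
        using points_grow_cycle[OF gp(1) _ _ e'(1) refl points_grow_reachable[OF e(3) wck(2)]] by simp
      then have "points_grow c w v (Suc k)"
        by (rule points_grow_reachable[OF cycle_mutually_reachable[OF C v e'(3)]])
      then show ?thesis
        using wck(1,3) y(2) Cycle by (intro exI[of _ w] exI[of _ c] exI[of _ "Suc k"]) simp
    qed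
  qed
qed

lemma points_grow_digraph_height:
  assumes "digraph_height G > 0"
  obtains w c v k where "terminal w c" "points_grow c w v k"
    "digraph_height G = 2 * k + (if c = [] then 0 else 1)"
proof -
  have ne: "cycles G \<noteq> {}" using assms by (auto simp: digraph_height_def split: if_splits)
  then have "digraph_height G \<in> (\<lambda>C. height_of G (Cycle C)) ` cycles G"
    unfolding digraph_height_def using finite_cycles Max_in[of "(\<lambda>C. height_of G (Cycle C)) ` cycles G"]
    by simp
  then obtain C where C: "C \<in> cycles G" "digraph_height G = height_of G (Cycle C)" by blast
  obtain v where "v \<in> cycle_verts G C" using cycle_verts_nonempty[OF C(1)] by blast
  then show ?thesis
    using points_grow_height[of "Cycle C" v] C that by (auto simp: sinks_and_cycles_def)
qed

end

section \<open>The representation on maximal paths\<close>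

locale leavitt_terminal = leavitt G field_type
  for G :: "('v, 'e) pre_digraph" and field_type :: "'k::field itself" +
  fixes w :: 'v and c :: "'e list"
  assumes terminal: "terminal w c"
begin

abbreviation y0 :: "nat \<Rightarrow> 'e option" where "y0 \<equiv> end_point c"

definition max_paths :: "(nat \<Rightarrow> 'e option) set" where
  "max_paths = {prepend p y0 | p. is_walk_to p w}"

definition source :: "(nat \<Rightarrow> 'e option) \<Rightarrow> 'v" where
  "source y = (case y 0 of None \<Rightarrow> w | Some e \<Rightarrow> tail G e)"

definition shift :: "(nat \<Rightarrow> 'e option) \<Rightarrow> (nat \<Rightarrow> 'e option)" where
  "shift y n = y (Suc n)"

lemma prepend_one: "prepend [e] y 0 = Some e" "shift (prepend [e] y) = y"
  by (simp_all add: prepend_def shift_def fun_eq_iff)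

lemma prepend_shift_eq: "y 0 = Some e \<Longrightarrow> prepend [e] (shift y) = y"
proof
  fix n assume "y 0 = Some e"
  then show "prepend [e] (shift y) n = y n" by (cases n) (simp_all add: prepend_def shift_def)
qed

lemma awalk_c: "awalk w c w"
  using terminal by (simp add: terminal_def)

lemma y0_max: "y0 \<in> max_paths"
proof -
  have "is_walk_to [] w" using awalk_c awalk_hd_in_verts by (auto simp: is_walk_to_def awalk_Nil_iff)
  then show ?thesis unfolding max_paths_def by (intro CollectI exI[of _ "[]"]) simp
qed

lemma source_prepend: "awalk u p w \<Longrightarrow> source (prepend p y0) = u"
proof (cases p)
  case Nil
  assume "awalk u p w"
  then have u: "u = w" using Nil by (simp add: awalk_Nil_iff)
  show ?thesis
  proof (cases c)
    case (Cons e c')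
    then have "y0 0 = Some e" by (simp add: end_point_def)
    then have "source y0 = tail G e" by (simp add: source_def)
    moreover have "w = tail G e" using awalk_c unfolding Cons by (simp add: awalk_Cons_iff)
    ultimately show ?thesis using Nil u by simp
  qed (simp add: source_def end_point_def Nil u)
next
  case (Cons e p')
  assume "awalk u p w"
  then show ?thesis using Cons by (simp add: source_def prepend_def awalk_Cons_iff)
qed

lemma max_paths_cons:
  assumes "y \<in> max_paths" "e \<in> arcs G" "source y = head G e"
  shows "prepend [e] y \<in> max_paths"
proof -
  obtain p u where p: "y = prepend p y0" "awalk u p w" using assms(1) by (auto simp: max_paths_def is_walk_to_def)
  then have "u = head G e" using source_prepend assms(3) by simp
  then have "awalk (tail G e) (e # p) w" using p(2) assms(2) by (simp add: awalk_Cons_iff)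
  then have "is_walk_to (e # p) w" unfolding is_walk_to_def by blast
  then show ?thesis unfolding max_paths_def p(1) prepend_Cons[symmetric] by blast
qed

lemma max_paths_Some:
  assumes "y \<in> max_paths" "y 0 = Some e"
  shows "e \<in> arcs G" "shift y \<in> max_paths" "source (shift y) = head G e"
proof -
  have "\<exists>p u. y = prepend p y0 \<and> awalk u p w \<and> p \<noteq> []"
  proof -
    obtain p u where p: "y = prepend p y0" "awalk u p w" using assms(1) by (auto simp: max_paths_def is_walk_to_def)
    show ?thesis
    proof (cases "p = []")
      case True
      then have "y = prepend c y0" using p(1) by (simp add: prepend_end_point)
      moreover have "c \<noteq> []" using p(1) True assms(2) by (auto simp: end_point_def)
      ultimately show ?thesis using awalk_c by blast
    next
      case False
      then show ?thesis using p by blast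
    qed
  qed
  then obtain f p u where p: "y = prepend (f # p) y0" "awalk u (f # p) w" by (metis neq_Nil_conv)
  have "f = e" using p(1) assms(2) by (simp add: prepend_def)
  then have y: "y = prepend [e] (prepend p y0)" and e: "e \<in> arcs G" "awalk (head G e) p w"
    using p prepend_Cons[of e p y0] by (auto simp: awalk_Cons_iff)
  show "e \<in> arcs G" by (rule e(1))
  have "shift y = prepend p y0" by (simp add: y prepend_one)
  then show "shift y \<in> max_paths" "source (shift y) = head G e"
    using e(2) source_prepend by (auto simp: max_paths_def is_walk_to_def)
qed

lemma max_paths_None:
  assumes "y \<in> max_paths" "y 0 = None"
  shows "y = y0" "out_arcs G w = {}"
proof -
  obtain p where p: "y = prepend p y0" using assms(1) by (auto simp: max_paths_def)
  then have "p = []" using assms(2) by (cases p) (auto simp: prepend_def)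
  then show "y = y0" using p by simp
  then have "c = []" using assms(2) by (auto simp: end_point_def split: if_splits)
  then show "out_arcs G w = {}" using terminal by (simp add: terminal_def)
qed

lemma max_paths_first_arc:
  assumes y: "y \<in> max_paths" and z: "range z \<subseteq> Some ` set c" and src: "source y = source z"
  obtains f where "y 0 = Some f" "z 0 = Some f"
proof -
  have "z 0 \<in> Some ` set c" using z by auto
  then obtain f where f: "z 0 = Some f" "f \<in> set c" by auto
  have out: "out_arcs G (tail G f) = {f}" using terminal f(2) by (simp add: terminal_def)
  have sz: "source z = tail G f" using f(1) by (simp add: source_def)
  have "y 0 = Some f"
  proof (cases "y 0")
    case None
    then have "source y = w" "out_arcs G w = {}" using max_paths_None(2)[OF y] by (auto simp: source_def)
    then show ?thesis using out sz src by simp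
  next
    case (Some e)
    then have "e \<in> out_arcs G (tail G f)" using max_paths_Some(1)[OF y] sz src by (simp add: source_def)
    then show ?thesis using out Some by simp
  qed
  then show ?thesis using that f(1) by simp
qed

lemma max_paths_agree:
  "y \<in> max_paths \<Longrightarrow> z \<in> max_paths \<Longrightarrow> range z \<subseteq> Some ` set c \<Longrightarrow> source y = source z \<Longrightarrow> y n = z n"
proof (induction n arbitrary: y z)
  case 0
  obtain f where "y 0 = Some f" "z 0 = Some f" using 0(1,3,4) by (rule max_paths_first_arc)
  then show ?case by simp
next
  case (Suc n)
  obtain f where f: "y 0 = Some f" "z 0 = Some f" using Suc.prems(1,3,4) by (rule max_paths_first_arc)
  have "shift y n = shift z n"
  proof (rule Suc.IH)
    show "range (shift z) \<subseteq> Some ` set c" using Suc.prems(3) by (auto simp: shift_def)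
  qed (use max_paths_Some[OF Suc.prems(1) f(1)] max_paths_Some[OF Suc.prems(2) f(2)] in simp_all)
  then show ?case by (simp add: shift_def)
qed

text \<open>
  From a terminal vertex there is at most one way to go on.  This makes the monomials \<open>p q\<^sup>*\<close> with end \<open>w\<close>
  act as matrix units.
\<close>
lemma max_path_at_terminal:
  assumes y: "y \<in> max_paths" and s: "source y = w"
  shows "y = y0"
proof (cases "c = []")
  case True
  then have w: "out_arcs G w = {}" using terminal by (simp add: terminal_def)
  show ?thesis
  proof (cases "y 0")
    case None
    then show ?thesis using max_paths_None(1)[OF y] by simp
  next
    case (Some e)
    then have "e \<in> out_arcs G w" using max_paths_Some(1)[OF y Some] s by (simp add: source_def)
    then show ?thesis using w by simp
  qed
next
  case False
  have "range y0 \<subseteq> Some ` set c" using False by (auto simp: end_point_def)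
  moreover have "source y0 = w" using source_prepend[of w "[]"] awalk_c awalk_hd_in_verts by (auto simp: awalk_Nil_iff)
  ultimately show ?thesis using max_paths_agree[OF y y0_max] s by (auto simp: fun_eq_iff)
qed

text \<open>
  An arrow, acting on the indicator function of \<open>(y, z)\<close>, prepends itself to \<open>y\<close> and raises \<open>z\<close> by 1; a ghost
  arrow removes itself from the front of \<open>y\<close> and lowers \<open>z\<close> by 1.  Both give zero where this is impossible.  In terms of the values of a function the
  arguments move the opposite way.
\<close>
fun oper :: "('v, 'e) lpa_gen \<Rightarrow> ((nat \<Rightarrow> 'e option) \<times> int \<Rightarrow> 'k) \<Rightarrow> ((nat \<Rightarrow> 'e option) \<times> int \<Rightarrow> 'k)" where
  "oper (Vertex v) f (y, z) = (if y \<in> max_paths \<and> source y = v then f (y, z) else 0)"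
| "oper (Arrow e) f (y, z) = (if y \<in> max_paths \<and> y 0 = Some e then f (shift y, z - 1) else 0)"
| "oper (Ghost e) f (y, z) =
     (if y \<in> max_paths \<and> source y = head G e \<and> e \<in> arcs G then f (prepend [e] y, z + 1) else 0)"

sublocale rep: free_algebra_rep oper
proof
  fix g f h show "oper g (\<lambda>x. f x + h x) = (\<lambda>x. oper g f x + oper g h x)"
    by (cases g) (auto simp: fun_eq_iff)
next
  fix g a f show "oper g (\<lambda>x. a * f x) = (\<lambda>x. a * oper g f x)"
    by (cases g) (auto simp: fun_eq_iff)
qed

lemma source_cons: "source (prepend [e] y) = tail G e"
  by (simp add: source_def prepend_one)

lemma source_Some: "y 0 = Some e \<Longrightarrow> source y = tail G e"
  by (simp add: source_def)

lemma act_gen_fun: "rep.act (gen g) f = oper g f"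
  by (simp add: fun_eq_iff rep.act_gen)

text \<open>
  For (CK2), a maximal path from a vertex with outgoing arrows begins with exactly one of them, so exactly one
  summand acts as the identity on it.
\<close>
lemma rels_act_zero:
  assumes "r \<in> lpa_rels G"
  shows "rep.act r f x = 0"
proof -
  obtain y z where x: "x = (y, z)" by (cases x)
  note sim = rep.act_diff rep.act_mult act_gen_fun rep.act_gen x
  from assms consider "r \<in> lpa_rels_V G" | "r \<in> lpa_rels_E G" | "r \<in> lpa_rels_CK1 G" | "r \<in> lpa_rels_CK2 G"
    unfolding lpa_rels_def by blast
  then show ?thesis
  proof cases
    case 1
    then show ?thesis by (auto simp: lpa_rels_V_def sim)
  next
    case 2
    then show ?thesis
      unfolding lpa_rels_E_def
      by (auto simp: sim source_Some source_cons max_paths_Some max_paths_cons)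
  next
    case 3
    then show ?thesis
      unfolding lpa_rels_CK1_def
      by (auto simp: sim prepend_one max_paths_cons)
  next
    case 4
    then obtain v where v: "v \<in> verts G" "out_arcs G v \<noteq> {}"
      and r: "r = gen (Vertex v) - (\<Sum>e\<in>out_arcs G v. gen (Arrow e) * gen (Ghost e))"
      unfolding lpa_rels_CK2_def by blast
    have arrow_ghost: "oper (Arrow e) (oper (Ghost e) f) (y, z) = (if y \<in> max_paths \<and> y 0 = Some e then f (y, z) else 0)" for e
      using max_paths_Some[of y e] by (simp add: prepend_shift_eq)
    have "(\<Sum>e\<in>out_arcs G v. oper (Arrow e) (oper (Ghost e) f) (y, z)) = oper (Vertex v) f (y, z)"
    proof (cases "y \<in> max_paths \<and> source y = v")
      case False
      then have "oper (Arrow e) (oper (Ghost e) f) (y, z) = 0" if "e \<in> out_arcs G v" for e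
        using that unfolding arrow_ghost by (auto simp: source_Some)
      then have sum0: "(\<Sum>e\<in>out_arcs G v. oper (Arrow e) (oper (Ghost e) f) (y, z)) = 0"
        by (intro sum.neutral ballI)
      show ?thesis unfolding sum0 using False by auto
    next
      case True
      show ?thesis
      proof (cases "y 0")
        case None
        have "source y = w" using None by (simp add: source_def)
        moreover have "out_arcs G w = {}" using max_paths_None(2)[of y] True None by simp
        ultimately show ?thesis using True v(2) by simp
      next
        case (Some e)
        then have e: "e \<in> out_arcs G v" using True max_paths_Some(1)[of y e] by (simp add: source_def)
        have "(\<Sum>e'\<in>out_arcs G v. oper (Arrow e') (oper (Ghost e') f) (y, z))
            = (\<Sum>e'\<in>out_arcs G v. if e' = e then f (y, z) else 0)"
          unfolding arrow_ghost using True Some by (intro sum.cong) auto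
        also have "\<dots> = f (y, z)"
        proof -
          have "finite (out_arcs G v)" by (rule finite_subset[OF _ finite_arcs]) auto
          then show ?thesis using e by (simp only: sum.delta if_True)
        qed
        finally show ?thesis using True by simp
      qed
    qed
    then show ?thesis by (simp add: r rep.act_diff rep.act_sum rep.act_mult act_gen_fun x)
  qed
qed

lemma ideal_act_zero: "p \<in> ideal \<Longrightarrow> rep.act p f x = 0"
  by (rule rep.act_ideal_eq_0[OF rels_act_zero])

definition delta :: "(nat \<Rightarrow> 'e option) \<Rightarrow> int \<Rightarrow> (nat \<Rightarrow> 'e option) \<times> int \<Rightarrow> 'k" where
  "delta y z x = (if x = (y, z) then 1 else 0)"

lemma oper_vertex_delta:
  assumes "y \<in> max_paths"
  shows "oper (Vertex v) (delta y z) = (if source y = v then delta y z else (\<lambda>x. 0))"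
proof
  fix x show "oper (Vertex v) (delta y z) x = (if source y = v then delta y z else (\<lambda>x. 0)) x"
    using assms by (cases x) (auto simp: delta_def)
qed

lemma oper_arrow_delta:
  assumes "y \<in> max_paths" "e \<in> arcs G" "source y = head G e"
  shows "oper (Arrow e) (delta y z) = delta (prepend [e] y) (z + 1)"
proof
  fix x show "oper (Arrow e) (delta y z) x = delta (prepend [e] y) (z + 1) x"
    using max_paths_cons[OF assms] by (cases x) (auto simp: delta_def prepend_one prepend_shift_eq)
qed

lemma oper_ghost_delta:
  assumes "y \<in> max_paths"
  shows "oper (Ghost e) (delta y z) = (if y 0 = Some e then delta (shift y) (z - 1) else (\<lambda>x. 0))"
proof
  fix x show "oper (Ghost e) (delta y z) x = (if y 0 = Some e then delta (shift y) (z - 1) else (\<lambda>x. 0)) x"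
    using assms max_paths_Some[OF assms, of e]
    by (cases x) (auto simp: delta_def prepend_one prepend_shift_eq)
qed

lemma ghosts_delta:
  "y \<in> max_paths \<Longrightarrow> rep.act_word (map Ghost (rev q)) (delta y z) =
     (if \<exists>u. y = prepend q u then delta (\<lambda>i. y (i + length q)) (z - int (length q)) else (\<lambda>x. 0))"
proof (induction q arbitrary: y z)
  case (Cons e q)
  show ?case
  proof (cases "y 0 = Some e")
    case True
    have "(\<exists>u. y = prepend (e # q) u) \<longleftrightarrow> (\<exists>u. shift y = prepend q u)"
      unfolding prepend_Cons[of e q] using prepend_one(2) prepend_shift_eq[of y e] True by metis
    moreover have "(\<lambda>i. shift y (i + length q)) = (\<lambda>i. y (i + length (e # q)))" by (simp add: shift_def)
    ultimately show ?thesis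
      using Cons.IH[OF max_paths_Some(2)[OF Cons.prems True], of "z - 1"] True
      by (simp add: oper_ghost_delta[OF Cons.prems] algebra_simps)
  next
    case False
    then have "\<not> (\<exists>u. y = prepend (e # q) u)" by (auto simp: prepend_def)
    then show ?thesis using False by (simp add: oper_ghost_delta[OF Cons.prems] rep.act_word_zero)
  qed
qed simp

lemma arrows_delta:
  "awalk u p w \<Longrightarrow> rep.act_word (map Arrow p) (delta y0 z) = delta (prepend p y0) (z + int (length p))"
proof (induction p arbitrary: u)
  case (Cons e p)
  then have e: "e \<in> arcs G" "awalk (head G e) p w" by (auto simp: awalk_Cons_iff)
  have "prepend p y0 \<in> max_paths" using e(2) by (auto simp: max_paths_def is_walk_to_def)
  then show ?case
    using oper_arrow_delta[OF _ e(1), of "prepend p y0"] source_prepend[OF e(2)] Cons.IH[OF e(2)]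
    by (simp add: prepend_Cons[of e p] algebra_simps)
qed simp

text \<open>
  The matrix unit from \<open>q y\<^sub>0\<close> to \<open>p y\<^sub>0\<close>, with its shift of degrees.
\<close>
lemma path_monomial_delta:
  assumes p: "is_walk_to p w" and q: "is_walk_to q w" and y: "y \<in> max_paths"
  shows "rep.act_word (path_monomial p w q) (delta y z) =
    (if y = prepend q y0 then delta (prepend p y0) (z + int (length p) - int (length q)) else (\<lambda>x. 0))"
proof -
  let ?G = "rep.act_word (map Ghost (rev q)) (delta y z)"
  have eq: "rep.act_word (path_monomial p w q) (delta y z)
      = rep.act_word (map Arrow p) (oper (Vertex w) ?G)"
    by (simp add: path_monomial_def)
  show ?thesis
  proof (cases "\<exists>u. y = prepend q u")
    case False
    then have "y \<noteq> prepend q y0" by blast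
    moreover have "?G = (\<lambda>x. 0)" using ghosts_delta[OF y] False by simp
    moreover have "oper (Vertex w) (\<lambda>x. 0) = (\<lambda>x. 0)" by (auto simp: fun_eq_iff simp del: split_paired_All)
    ultimately show ?thesis unfolding eq by (simp add: rep.act_word_zero)
  next
    case True
    then obtain u where u: "y = prepend q u" by blast
    have "(\<lambda>i. y (i + length q)) = u" by (simp add: u prepend_def)
    then have G: "?G = delta u (z - int (length q))" using ghosts_delta[OF y, of q z] True by simp
    have um: "u \<in> max_paths"
      using y unfolding u
    proof (induction q)
      case (Cons e q)
      have "prepend (e # q) u 0 = Some e" by (simp add: prepend_def)
      from max_paths_Some(2)[OF Cons.prems this] have "prepend q u \<in> max_paths"
        unfolding prepend_Cons[of e q] prepend_one .
      then show ?case by (rule Cons.IH)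
    qed simp
    show ?thesis
    proof (cases "source u = w")
      case True
      then have "u = y0" using max_path_at_terminal um by blast
      moreover obtain v where "awalk v p w" using p by (auto simp: is_walk_to_def)
      ultimately show ?thesis unfolding eq G
        using oper_vertex_delta[OF um] True arrows_delta u by (simp add: algebra_simps)
    next
      case False
      have "u \<noteq> y0" using False source_prepend[OF awalk_c] by (auto simp: prepend_end_point)
      then have "y \<noteq> prepend q y0" using u by (simp add: prepend_inject)
      then show ?thesis unfolding eq G
        using oper_vertex_delta[OF um] False by (simp add: rep.act_word_zero)
    qed
  qed
qed

text \<open>
  Take \<open>p c\<^sup>i q\<^sup>*\<close>, where \<open>p\<close> and \<open>q\<close> run through representatives of the points.  The position of the matrix
  unit recovers \<open>p\<close> and \<open>q\<close>, and then the shift of degrees recovers \<open>i\<close>.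
\<close>
lemma independent_monomials:
  obtains S where "P.A.lin_indpt S" "S \<subseteq> P.A.span (P.A.monomials gen_classes (2 * N + n * length c + 1))"
    "card S = card (points c w v N) * card (points c w v N) * (if c = [] then 1 else n)"
proof -
  define Y where "Y = points c w v N"
  define walk where "walk y = (SOME p. y = prepend p y0 \<and> awalk v p w \<and> length p \<le> N)" for y
  have walk: "prepend (walk y) y0 = y" "awalk v (walk y) w" "length (walk y) \<le> N" if "y \<in> Y" for y
  proof -
    have "\<exists>p. y = prepend p y0 \<and> awalk v p w \<and> length p \<le> N"
      using that by (auto simp: Y_def points_def)
    from someI_ex[OF this] show "prepend (walk y) y0 = y" "awalk v (walk y) w" "length (walk y) \<le> N"
      unfolding walk_def by simp_all
  qed
  have Ym: "y \<in> max_paths" if "y \<in> Y" for y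
    using walk[OF that] by (force simp: max_paths_def is_walk_to_def)
  \<comment> \<open>At a sink the powers of the empty walk coincide.\<close>
  define I where "I = (if c = [] then {0} else {..<n})"
  define J where "J = Y \<times> I \<times> Y"
  define lft where "lft = (\<lambda>(y, i, y' :: nat \<Rightarrow> 'e option). walk y @ list_power c i)"
  define a where "a = (\<lambda>j. path_monomial (lft j) w (walk (snd (snd j))))"
  define \<phi> where "\<phi> = (\<lambda>j p. rep.act p (delta (snd (snd j)) 0)
      (fst j, int (length (lft j)) - int (length (walk (snd (snd j))))))"
  have finJ: "finite J" unfolding J_def I_def Y_def using finite_points by simp
  have lftw: "is_walk_to (lft j) w" "prepend (lft j) y0 = fst j" if jJ: "j \<in> J" for j
  proof -
    obtain y i y' where j: "j = (y, i, y')" "y \<in> Y" "i \<in> I" "y' \<in> Y" using jJ by (auto simp: J_def)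
    have "awalk v (walk y @ list_power c i) w"
      using walk(2)[OF j(2)] awalk_power[OF awalk_c] by (rule awalk_appendI)
    then show "is_walk_to (lft j) w" unfolding is_walk_to_def by (auto simp: lft_def j(1))
    show "prepend (lft j) y0 = fst j"
      using walk(1)[OF j(2)] by (simp add: lft_def j(1) prepend_append prepend_power_end_point)
  qed
  have rgt: "is_walk_to (walk (snd (snd j))) w" "snd (snd j) \<in> Y" if jJ: "j \<in> J" for j
  proof -
    show Y: "snd (snd j) \<in> Y" using jJ by (auto simp: J_def)
    show "is_walk_to (walk (snd (snd j))) w" unfolding is_walk_to_def using walk(2)[OF Y] by blast
  qed
  have gens': "a j \<noteq> []" "set (a j) \<subseteq> lpa_gens G" if "j \<in> J" for j
    using walk_to_gens(4)[OF lftw(1)[OF that] rgt(1)[OF that]] by (auto simp: a_def path_monomial_def)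
  have dual: "\<phi> j (word (a j')) = (if j = j' then 1 else 0)" if jJ: "j \<in> J" and jJ': "j' \<in> J" for j j'
  proof -
    obtain y i y' where j: "j = (y, i, y')" "y \<in> Y" "i \<in> I" "y' \<in> Y" using jJ by (auto simp: J_def)
    obtain x l x' where j': "j' = (x, l, x')" "x \<in> Y" "l \<in> I" "x' \<in> Y" using jJ' by (auto simp: J_def)
    have len: "length (lft (y, i, y')) = length (walk y) + i * length c" for y i y'
      by (simp add: lft_def length_list_power)
    have "\<phi> j (word (a j')) = rep.act_word (a j') (delta y' 0)
        (y, int (length (lft j)) - int (length (walk y')))"
      by (simp add: \<phi>_def rep.act_word_eq j(1))
    also have "rep.act_word (a j') (delta y' 0) =
        (if y' = x' then delta x (int (length (lft j')) - int (length (walk x'))) else (\<lambda>x. 0))"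
      unfolding a_def
      using path_monomial_delta[OF lftw(1)[OF jJ'] rgt(1)[OF jJ'] Ym[OF j(4)], of 0]
        walk(1)[OF j'(4)] lftw(2)[OF jJ'] by (simp add: j'(1))
    finally have \<phi>: "\<phi> j (word (a j')) = (if y' = x' \<and> y = x \<and> length (lft j) = length (lft j') then 1 else 0)"
      by (auto simp: delta_def)
    have "y = x \<Longrightarrow> length (lft j) = length (lft j') \<Longrightarrow> i = l"
      using j(3) j'(3) unfolding j(1) j'(1) len I_def by (auto split: if_splits)
    then show ?thesis unfolding \<phi> by (auto simp: j(1) j'(1))
  qed
  have free: "word (a j) \<in> free_on (lpa_gens G)" if "j \<in> J" for j
    using gens'[OF that] by (rule free_on_word)
  have add: "\<phi> j (p + q) = \<phi> j p + \<phi> j q" for j p q by (simp add: \<phi>_def rep.act_add)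
  have scale: "\<phi> j (scale b p) = b * \<phi> j p" for j b p by (simp add: \<phi>_def rep.act_scale)
  have vanish: "\<phi> j p = 0" if "p \<in> ideal" for j p by (simp add: \<phi>_def ideal_act_zero[OF that])
  note dual_basis = P.independent_by_functionals[where \<phi> = \<phi> and a = "\<lambda>j. word (a j)",
      OF finJ free add scale vanish dual]
  have indep: "P.A.lin_indpt ((\<lambda>j. P.cls (word (a j))) ` J)" by (rule dual_basis(1))
  have card_image: "card ((\<lambda>j. P.cls (word (a j))) ` J) = card J" by (rule dual_basis(2))
  have low: "(\<lambda>j. P.cls (word (a j))) ` J \<subseteq> P.A.span (P.A.monomials gen_classes (2 * N + n * length c + 1))"
  proof
    fix s assume "s \<in> (\<lambda>j. P.cls (word (a j))) ` J"
    then obtain j where jJ: "j \<in> J" and s: "s = P.cls (word (a j))" by blast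
    obtain y i y' where j: "j = (y, i, y')" "y \<in> Y" "i \<in> I" "y' \<in> Y" using jJ by (auto simp: J_def)
    have "i * length c \<le> n * length c" using j(3) by (auto simp: I_def split: if_splits)
    moreover have "length (a j) = length (walk y) + i * length c + 1 + length (walk y')"
      by (simp add: a_def path_monomial_def lft_def j(1) length_list_power)
    ultimately have "length (a j) \<le> 2 * N + n * length c + 1"
      using walk(3)[OF j(2)] walk(3)[OF j(4)] by linarith
    then have "P.A.monomial (map (\<lambda>x. P.cls (gen x)) (a j)) \<in> P.A.monomials gen_classes (2 * N + n * length c + 1)"
      using gens'(2)[OF jJ] by (intro P.A.monomial_in_monomials) auto
    then have "s \<in> P.A.monomials gen_classes (2 * N + n * length c + 1)"
      by (simp add: s P.monomial_cls[OF gens'[OF jJ]])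
    moreover have "gen_classes \<subseteq> carrier P.A" by (auto intro: P.cls_closed free_on_gen)
    ultimately show "s \<in> P.A.span (P.A.monomials gen_classes (2 * N + n * length c + 1))"
      by (intro subsetD[OF P.A.in_own_span[OF P.A.monomials_closed]])
  qed
  have "card J = card Y * card Y * (if c = [] then 1 else n)"
    by (simp add: J_def I_def card_cartesian_product)
  with card_image show ?thesis by (intro that[OF indep low]) (simp add: Y_def)
qed

end

theorem (in leavitt) GKdim_leavitt:
  "GKdim class_ring P.A = ereal (real (digraph_height G))"
proof -
  interpret fg: fg_algebra class_ring P.A gen_classes
    by (rule P.fg_algebra_A[OF finite_gens])
  obtain C where C: "\<And>n. n \<ge> 1 \<Longrightarrow> card (reduced_words n) \<le> C * n ^ H"
    using card_reduced_words by blast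
  have upper: "\<exists>T. finite T \<and> T \<subseteq> carrier P.A \<and> card T \<le> C * n ^ H \<and> P.A.monomials gen_classes n \<subseteq> P.A.span T"
    if n: "n \<ge> 1" for n
  proof (intro exI conjI)
    show "finite (cls_word ` reduced_words n)" using finite_reduced_words by simp
    show "cls_word ` reduced_words n \<subseteq> carrier P.A"
      using reduced_words_gens by (auto intro!: P.cls_closed free_on_word)
    show "card (cls_word ` reduced_words n) \<le> C * n ^ H"
      using card_image_le[OF finite_reduced_words] C[OF n] by (rule le_trans)
    show "P.A.monomials gen_classes n \<subseteq> P.A.span (cls_word ` reduced_words n)"
      by (rule monomials_in_reduced_span[OF n])
  qed
  have "\<exists>M\<ge>1. \<forall>n. H > 0 \<longrightarrow> n \<ge> 1 \<longrightarrow>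
      (\<exists>S. P.A.lin_indpt S \<and> S \<subseteq> P.A.span (P.A.monomials gen_classes (M * n)) \<and> n ^ H \<le> card S)"
  proof (cases "H > 0")
    case True
    then obtain w c v k where t: "terminal w c" and g: "points_grow c w v k"
      and H: "H = 2 * k + (if c = [] then 0 else 1)"
      by (rule points_grow_digraph_height)
    interpret leavitt_terminal G field_type w c by unfold_locales (rule t)
    obtain m where m: "m \<ge> 1" "\<And>n. n \<ge> 1 \<Longrightarrow> n ^ k \<le> card (points c w v (m * n))"
      using g unfolding points_grow_def by blast
    \<comment> \<open>Two walks of length \<open>m * n\<close>, fewer than \<open>n\<close> rounds \<open>c\<close>, and the letter for the vertex.\<close>
    define M where "M = 2 * m + length c + 1"
    have "\<exists>S. P.A.lin_indpt S \<and> S \<subseteq> P.A.span (P.A.monomials gen_classes (M * n)) \<and> n ^ H \<le> card S"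
      if n: "n \<ge> 1" for n
    proof -
      obtain S where S: "P.A.lin_indpt S"
        "S \<subseteq> P.A.span (P.A.monomials gen_classes (2 * (m * n) + n * length c + 1))"
        "card S = card (points c w v (m * n)) * card (points c w v (m * n)) * (if c = [] then 1 else n)"
        by (rule independent_monomials)
      have "2 * (m * n) + n * length c + 1 \<le> M * n" using n by (simp add: M_def algebra_simps)
      then have "P.A.span (P.A.monomials gen_classes (2 * (m * n) + n * length c + 1))
          \<subseteq> P.A.span (P.A.monomials gen_classes (M * n))"
        by (intro P.A.span_is_monotone P.A.monomials_mono)
      moreover have "n ^ H \<le> card S"
      proof -
        have "n ^ H = n ^ k * n ^ k * (if c = [] then 1 else n)"
          by (simp add: H power_add mult_2)
        also have "\<dots> \<le> card S" unfolding S(3) using m(2)[OF n] by (intro mult_mono) auto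
        finally show ?thesis .
      qed
      ultimately show ?thesis using S(1) subset_trans[OF S(2)] by (intro exI[of _ S] conjI)
    qed
    then show ?thesis by (intro exI[of _ M]) (simp add: M_def)
  qed auto
  then obtain M where M: "M \<ge> 1" and lower: "\<forall>n. H > 0 \<longrightarrow> n \<ge> 1 \<longrightarrow>
      (\<exists>S. P.A.lin_indpt S \<and> S \<subseteq> P.A.span (P.A.monomials gen_classes (M * n)) \<and> n ^ H \<le> card S)"
    by (elim exE conjE)
  show ?thesis by (rule fg.GKdim_eqI[OF upper M lower[rule_format]])
qed

theorem theorem27:
  fixes G :: "('v, 'e) pre_digraph"
  assumes "fin_digraph G"
    and "disjoint_cycles G"
  shows "GKdim class_ring
           (leavitt_path_algebra G :: ('k::field, ('k, ('v, 'e) lpa_gen) free_algebra set) module)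
         = ereal (real (digraph_height G))"
proof -
  interpret leavitt G "TYPE('k)"
    by (intro leavitt.intro disjoint_cycles_digraph.intro assms disjoint_cycles_digraph_axioms.intro)
  show ?thesis unfolding leavitt_path_algebra_eq by (rule GKdim_leavitt)
qed

end
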